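(* Let $q$ be a prime power, $I=(n_1,\dots,n_l)$ a composition of $n$, $m_0=0$, $m_k=\sum_{i=1}^k n_i$, $\mathcal{P}=\mathbb{F}_q[x_1,\dots,x_n]$, and for each $1\le i\le l$ let $G_i\le\operatorname{GL}_{n_i}(q)$ be a subgroup and $\mathcal{P}_i=\mathbb{F}_q[x_{m_{i-1}+1},\dots,x_{m_i}]$. Assume that for each $i$ the invariant ring $\mathcal{P}_i^{G_i}$ is a polynomial algebra and that the monomial $x_{m_{i-1}+1}^{\alpha_{i1}}\cdots x_{m_i}^{\alpha_{i,n_i}}$ generates a block basis for $\mathcal{P}_i$ over $\mathcal{P}_i^{G_i}$. Then $$\prod_{i=1}^{l}\prod_{j=1}^{n_i}x_{m_{i-1}+j}^{(\alpha_{ij}+1)q^{m_{i-1}}-1}$$ generates a block basis of $\mathcal{P}$ over $\mathcal{P}^{G_I}$.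
   Context: $G_I\le\operatorname{GL}_n(q)$ is the group of all block upper triangular matrices whose $i$-th diagonal block lies in $G_i$ ($1\le i\le l$), with arbitrary entries of $\mathbb{F}_q$ above the diagonal blocks. $\operatorname{GL}_n(q)$ acts on $V=\langle x_1,\dots,x_n\rangle_{\mathbb{F}_q}=\mathbb{F}_q^n$ naturally, i.e. $g\cdot x_k=\sum_i g_{ik}x_i$, and on $\mathcal{P}=S^\bullet(V)$ by algebra automorphisms; likewise $G_i\le\operatorname{GL}_{n_i}(q)$ acts on $\mathcal{P}_i$ via its natural action on $\langle x_{m_{i-1}+1},\dots,x_{m_i}\rangle$. For a polynomial ring $R$ over $\mathbb{F}_q$ in given variables and a graded subalgebra $A$ which is a polynomial algebra on homogeneous generators and over which $R$ is free, a monomial $f\in R$ generates a block basis for $R$ over $A$ if the set of all monomial factors (monic monomial divisors) of $f$ projects to an $\mathbb{F}_q$-basis of $R/(A_+)$, where $(A_+)$ is the ideal of $R$ generated by the homogeneous elements of $A$ of positive degree. *)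

theory Defs
  imports "HOL-Library.Poly_Mapping" "Jordan_Normal_Form.Matrix"
begin

section \<open>Polynomials\<close>

text \<open>
  Polynomials live in one ambient ring in the variables \<open>x\<^sub>0, x\<^sub>1, \<dots>\<close>; the ring
  \<open>k[x\<^sub>v | v \<in> X]\<close> is the subset \<open>poly_ring X\<close> of it. Variables and blocks are numbered from 0.
\<close>

type_synonym 'k mpoly = "(nat \<Rightarrow>\<^sub>0 nat) \<Rightarrow>\<^sub>0 'k"

definition Cst :: "'k::comm_ring_1 \<Rightarrow> 'k mpoly"
  where "Cst c = Poly_Mapping.single 0 c"

definition Var :: "nat \<Rightarrow> 'k::comm_ring_1 mpoly"
  where "Var v = Poly_Mapping.single (Poly_Mapping.single v 1) 1"

definition poly_ring :: "nat set \<Rightarrow> 'k::comm_ring_1 mpoly set"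
  where "poly_ring X = {p. \<forall>m \<in> Poly_Mapping.keys p. Poly_Mapping.keys m \<subseteq> X}"

definition homogeneous :: "nat \<Rightarrow> 'k::comm_ring_1 mpoly \<Rightarrow> bool"
  where "homogeneous d p \<longleftrightarrow>
    (\<forall>m \<in> Poly_Mapping.keys p. (\<Sum>v \<in> Poly_Mapping.keys m. Poly_Mapping.lookup m v) = d)"

text \<open>The algebra homomorphism given by \<open>x\<^sub>v \<mapsto> \<sigma> v\<close>.\<close>

definition subst :: "(nat \<Rightarrow> 'k::comm_ring_1 mpoly) \<Rightarrow> 'k mpoly \<Rightarrow> 'k mpoly"
  where "subst \<sigma> p = (\<Sum>m \<in> Poly_Mapping.keys p. Cst (Poly_Mapping.lookup p m) *
    (\<Prod>v \<in> Poly_Mapping.keys m. \<sigma> v ^ Poly_Mapping.lookup m v))"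

text \<open>
  Being the image of \<open>subst f\<close>, \<open>A\<close> is the algebra \<open>k[f 0, \<dots>, f (r - 1)]\<close>, and injectivity is
  algebraic independence of the generators.
\<close>

definition polynomial_generators :: "nat \<Rightarrow> (nat \<Rightarrow> 'k::comm_ring_1 mpoly) \<Rightarrow> 'k mpoly set \<Rightarrow> bool"
  where "polynomial_generators r f A \<longleftrightarrow> bij_betw (subst f) (poly_ring {..<r}) A"

definition polynomial_algebra :: "'k::comm_ring_1 mpoly set \<Rightarrow> bool"
  where "polynomial_algebra A \<longleftrightarrow> (\<exists>r f. polynomial_generators r f A)"

definition homogeneous_polynomial_algebra :: "'k::comm_ring_1 mpoly set \<Rightarrow> bool"
  where "homogeneous_polynomial_algebra A \<longleftrightarrow>
    (\<exists>r f. polynomial_generators r f A \<and> (\<forall>i<r. \<exists>d. homogeneous d (f i)))"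


section \<open>Free modules, ideals and bases of quotients\<close>

text \<open>
  \<open>combos A B\<close> are the finitely supported coefficient families in \<open>A\<close> indexed by \<open>B\<close>, and
  \<open>comb c\<close> is the linear combination \<open>\<Sum>\<^sub>b c\<^sub>b b\<close>.
\<close>

definition combos :: "'r::comm_ring_1 set \<Rightarrow> 'r set \<Rightarrow> ('r \<Rightarrow>\<^sub>0 'r) set"
  where "combos A B = {c. Poly_Mapping.keys c \<subseteq> B \<and> range (Poly_Mapping.lookup c) \<subseteq> A}"

definition comb :: "('r::comm_ring_1 \<Rightarrow>\<^sub>0 'r) \<Rightarrow> 'r"
  where "comb c = (\<Sum>b \<in> Poly_Mapping.keys c. Poly_Mapping.lookup c b * b)"

definition free_over :: "'r::comm_ring_1 set \<Rightarrow> 'r set \<Rightarrow> bool"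
  where "free_over A R \<longleftrightarrow> (\<exists>B \<subseteq> R. \<forall>p \<in> R. \<exists>!c. c \<in> combos A B \<and> p = comb c)"

definition ideal_gen :: "'r::comm_ring_1 set \<Rightarrow> 'r set \<Rightarrow> 'r set"
  where "ideal_gen R S = comb ` combos R S"

text \<open>The residue classes of the elements of \<open>B\<close> form a \<open>K\<close>-basis of \<open>R / J\<close>.\<close>

definition projects_to_basis :: "'r::comm_ring_1 set \<Rightarrow> 'r set \<Rightarrow> 'r set \<Rightarrow> 'r set \<Rightarrow> bool"
  where "projects_to_basis K R J B \<longleftrightarrow> B \<subseteq> R \<and>
    (\<forall>p \<in> R. \<exists>c \<in> combos K B. p - comb c \<in> J) \<and>
    (\<forall>c \<in> combos K B. comb c \<in> J \<longrightarrow> c = 0)"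


section \<open>Block bases\<close>

definition monic_monomial :: "'k::comm_ring_1 mpoly \<Rightarrow> bool"
  where "monic_monomial f \<longleftrightarrow> (\<exists>e. f = Poly_Mapping.single e 1)"

definition monomial_factors :: "'k::comm_ring_1 mpoly \<Rightarrow> 'k mpoly set"
  where "monomial_factors f = {h. monic_monomial h \<and> h dvd f}"

definition positive_part :: "'k::comm_ring_1 mpoly set \<Rightarrow> 'k mpoly set"
  where "positive_part A = {a \<in> A. \<exists>d>0. homogeneous d a}"

text \<open>
  Homogeneity of the generators makes \<open>A\<close> a graded subalgebra; \<open>range Cst\<close> is the coefficient field.
\<close>

definition generates_block_basis :: "nat set \<Rightarrow> 'k::comm_ring_1 mpoly set \<Rightarrow> 'k mpoly \<Rightarrow> bool"
  where "generates_block_basis X A f \<longleftrightarrow>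
    f \<in> poly_ring X \<and> monic_monomial f \<and>
    A \<subseteq> poly_ring X \<and>
    homogeneous_polynomial_algebra A \<and>
    free_over A (poly_ring X) \<and>
    projects_to_basis (range Cst) (poly_ring X) (ideal_gen (poly_ring X) (positive_part A))
      (monomial_factors f)"


section \<open>Linear groups and invariants\<close>

definition GL :: "nat \<Rightarrow> 'k::field mat monoid"
  where "GL d = units_of (ring_mat TYPE('k) d ())"

text \<open>
  A \<open>d \<times> d\<close> matrix acts on the variables \<open>x\<^sub>s, \<dots>, x\<^bsub>s+d-1\<^esub>\<close> by \<open>g \<cdot> x\<^bsub>s+k\<^esub> = \<Sum>\<^sub>i g\<^bsub>ik\<^esub> x\<^bsub>s+i\<^esub>\<close>.
\<close>

definition act :: "nat \<Rightarrow> 'k::field mat \<Rightarrow> 'k mpoly \<Rightarrow> 'k mpoly"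
  where "act s g = subst (\<lambda>v.
    if s \<le> v \<and> v < s + dim_col g
    then \<Sum>i<dim_row g. Cst (g $$ (i, v - s)) * Var (s + i)
    else Var v)"

definition invariants :: "nat \<Rightarrow> nat \<Rightarrow> 'k::field mat set \<Rightarrow> 'k mpoly set"
  where "invariants s d H = {p \<in> poly_ring {s..<s + d}. \<forall>g \<in> H. act s g p = p}"


section \<open>Compositions and block triangular groups\<close>

definition composition :: "nat list \<Rightarrow> nat \<Rightarrow> bool"
  where "composition ns n \<longleftrightarrow> (\<forall>k \<in> set ns. 0 < k) \<and> sum_list ns = n"

text \<open>Block \<open>i\<close> consists of the indices \<open>offset ns i + j\<close> with \<open>j < ns ! i\<close>.\<close>

definition offset :: "nat list \<Rightarrow> nat \<Rightarrow> nat"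
  where "offset ns i = sum_list (take i ns)"

definition diag_block :: "nat list \<Rightarrow> nat \<Rightarrow> 'k mat \<Rightarrow> 'k mat"
  where "diag_block ns i g =
    mat (ns ! i) (ns ! i) (\<lambda>(a, b). g $$ (offset ns i + a, offset ns i + b))"

definition block_upper_triangular :: "nat list \<Rightarrow> 'k::zero mat \<Rightarrow> bool"
  where "block_upper_triangular ns g \<longleftrightarrow>
    (\<forall>i < length ns. \<forall>j < i. \<forall>a < ns ! i. \<forall>b < ns ! j. g $$ (offset ns i + a, offset ns j + b) = 0)"

definition block_group :: "nat list \<Rightarrow> (nat \<Rightarrow> 'k::field mat set) \<Rightarrow> 'k mat set"
  where "block_group ns G = {g \<in> carrier (GL (sum_list ns)).
    block_upper_triangular ns g \<and> (\<forall>i < length ns. diag_block ns i g \<in> G i)}"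

end

theory Submission
  imports Defs "HOL-Computational_Algebra.Polynomial" "Jordan_Normal_Form.Determinant"
begin

text \<open>
  By induction it suffices to add one block to a block triangular group. Let \<open>X\<close> be the \<open>m\<close> old and
  \<open>Y\<close> the new variables, and let \<open>H\<close> and \<open>K\<close> be the groups on the diagonal. The polynomial
  \<open>F(z) = \<Prod>\<^sub>u (z + u)\<close>, with \<open>u\<close> ranging over the linear forms in \<open>X\<close>, is additive and homogeneous of
  degree \<open>Q = q\<^sup>m\<close>. Let \<open>\<Phi>\<close> be the substitution \<open>x\<^sub>v \<mapsto> F(x\<^sub>v)\<close> for \<open>v \<in> Y\<close> that fixes the variables in
  \<open>X\<close>. It commutes with \<open>H \<times> K\<close>, and its image is the ring of invariants of the unipotent part. So the
  invariants of the whole group are the image under \<open>\<Phi>\<close> of the invariants of \<open>H \<times> K\<close>, which are the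
  tensor product of those of \<open>H\<close> and of \<open>K\<close>.

  With respect to the degree in \<open>Y\<close>, the leading part of \<open>\<Phi>\<close> is \<open>x\<^sub>v \<mapsto> x\<^sub>v\<^sup>Q\<close>. The polynomial ring is free
  over the image of the latter, with the monomials of exponents less than \<open>Q\<close> in \<open>Y\<close> as a basis, and a
  basis stays a basis when the leading part is replaced by \<open>\<Phi>\<close>. An exponent \<open>\<alpha>\<close> thus becomes
  \<open>Q \<alpha> + (Q - 1) = (\<alpha> + 1) Q - 1\<close>. Finally, by a graded Nakayama lemma, the factors of a monomial project
  to a basis modulo the positive part of \<open>A\<close> if and only if they are a basis over \<open>A\<close>.
\<close>

text \<open>A block basis is a statement about a quotient by an ideal, and such statements do not
  compose along a tower of rings. The work is therefore done with \<open>free_basis\<close>, an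
  indexed basis over the subring itself: these bases multiply along towers, survive base change and
  injective substitutions, and uniqueness of coefficients turns invariance of an element into
  invariance of its coefficients. With \<open>P\<close> the whole polynomial ring, the tower is
  \<open>\<Phi>\<close>(invariants of H and K) below \<open>\<Phi>\<close>(invariants of K) below
  \<open>P\<close>. The lower step keeps the monomials of the old block because
  \<open>\<Phi>\<close> fixes the old variables; the upper step carries the deformation. The leading
  part is taken for the degree in Y alone because F(x_v) is homogeneous for the total degree, so
  only the former separates \<open>x_v^Q\<close> from the other terms. \<open>\<Phi>\<close>
  commutes with K because F is linear over the field: it is additive, and \<open>a^Q = a\<close>
  handles scalars. It commutes with H because H permutes the linear forms. The freeness assumed for
  each block supplies the independence half of the Nakayama argument.\<close>

abbreviation "lookup \<equiv> Poly_Mapping.lookup"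
abbreviation "keys \<equiv> Poly_Mapping.keys"
abbreviation "single \<equiv> Poly_Mapping.single"
abbreviation mon :: "(nat \<Rightarrow>\<^sub>0 nat) \<Rightarrow> 'k::comm_ring_1 mpoly"
  where "mon e \<equiv> single e 1"

section \<open>Polynomials\<close>

lemma expand: "p = (\<Sum>e\<in>keys p. single e (lookup p e))"
  by (rule poly_mapping_eqI)
     (auto simp: lookup_sum lookup_single when_def in_keys_iff sum.delta)

lemma mpoly_induct [case_names single add]:
  fixes p :: "'a \<Rightarrow>\<^sub>0 'b::comm_monoid_add"
  assumes "\<And>e c. P (single e c)" and "\<And>p q. P p \<Longrightarrow> P q \<Longrightarrow> P (p + q)"
  shows "P p"
proof -
  have "P (\<Sum>e\<in>S. single e (lookup p e))" if "finite S" for S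
    using that by (induction S rule: finite_induct) (use assms assms(1)[of undefined 0] in auto)
  from this[of "keys p"] show ?thesis using expand[of p] by simp
qed

lemma Cst_mult_mon: "Cst c * mon e = single e c"
  by (simp add: Cst_def mult_single)

lemma Cst_0 [simp]: "Cst 0 = 0" and Cst_1 [simp]: "Cst 1 = 1"
  by (simp_all add: Cst_def)

lemma Cst_eq_0_iff [simp]: "Cst c = 0 \<longleftrightarrow> c = 0"
  by (metis Cst_def lookup_single_eq lookup_zero single_zero)

lemma Cst_add: "Cst (a + b) = Cst a + Cst b"   and Cst_mult: "Cst (a * b) = Cst a * Cst b" and Cst_uminus: "Cst (- a) = - Cst a"
  by (simp_all add: Cst_def single_add single_uminus mult_single)

lemma Cst_sum: "Cst (sum f S) = (\<Sum>x\<in>S. Cst (f x))"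
  by (induction S rule: infinite_finite_induct) (auto simp: Cst_add)

lemma Cst_power: "Cst (a ^ n) = Cst a ^ n"
  by (induction n) (auto simp: Cst_mult)

lemma mon_add: "mon (e + f) = mon e * mon f"
  by (simp add: mult_single)

lemma mon_sum: "mon (\<Sum>x\<in>S. f x) = (\<Prod>x\<in>S. mon (f x))"
  by (induction S rule: infinite_finite_induct) (auto simp: mon_add mult_single)

lemma Var_power: "Var v ^ n = mon (single v n)"
  by (induction n) (auto simp: Var_def mult_single simp flip: single_add)

lemma mon_eq_prod: "mon e = (\<Prod>v\<in>keys e. Var v ^ lookup e v)"
  by (subst expand) (simp add: mon_sum Var_power)

lemma lookup_mon_mult: "lookup (mon e * p) (e + f) = lookup p f"
proof (induction p rule: mpoly_induct)
  case (single g c)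
  then show ?case by (simp add: mult_single lookup_single)
qed (simp add: distrib_left lookup_add)

lemma keys_mon_mult: "keys (mon e * p) = (+) e ` keys p"
proof -
  have "keys (mon e * p) \<subseteq> (+) e ` keys p"
    using keys_mult[of "mon e :: _ \<Rightarrow>\<^sub>0 'a" p] by (auto split: if_splits)
  moreover have "e + f \<in> keys (mon e * p)" if "f \<in> keys p" for f
    using that by (simp add: in_keys_iff lookup_mon_mult)
  ultimately show ?thesis by auto
qed

lemma keys_add_nat: "keys (e + f) = keys e \<union> keys f" for e f :: "'a \<Rightarrow>\<^sub>0 nat"
  by (auto simp: in_keys_iff lookup_add)

lemma lookup_Cst_mult: "lookup (Cst c * p) e = c * lookup p e"
proof (induction p rule: mpoly_induct)
  case (single g d)
  then show ?case by (simp add: Cst_def mult_single lookup_single when_def)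
qed (simp add: distrib_left lookup_add)

subsection \<open>The rings \<^term>\<open>poly_ring X\<close>\<close>

lemma poly_ring_iff: "p \<in> poly_ring X \<longleftrightarrow> (\<forall>e\<in>keys p. keys e \<subseteq> X)"
  by (simp add: poly_ring_def)

lemma poly_ring_mono: "X \<subseteq> Y \<Longrightarrow> poly_ring X \<subseteq> poly_ring Y"
  unfolding poly_ring_def by blast

lemma poly_ring_UNIV [simp]: "poly_ring UNIV = UNIV"
  by (auto simp: poly_ring_iff)

lemma single_in_poly_ring [intro]: "keys e \<subseteq> X \<Longrightarrow> single e c \<in> poly_ring X"
  by (auto simp: poly_ring_iff)

lemma Cst_in_poly_ring [simp, intro]: "Cst c \<in> poly_ring X"
  by (auto simp: poly_ring_iff Cst_def)

lemma zero_in_poly_ring [simp, intro]: "0 \<in> poly_ring X"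
  and one_in_poly_ring [simp, intro]: "1 \<in> poly_ring X"
  by (auto simp: poly_ring_iff)

lemma Var_in_poly_ring [intro]: "v \<in> X \<Longrightarrow> Var v \<in> poly_ring X"
  by (auto simp: poly_ring_iff Var_def)

lemma add_in_poly_ring [intro]: "p \<in> poly_ring X \<Longrightarrow> q \<in> poly_ring X \<Longrightarrow> p + q \<in> poly_ring X"
  unfolding poly_ring_iff using keys_add[of p q] by auto

lemma uminus_in_poly_ring [intro]: "p \<in> poly_ring X \<Longrightarrow> - p \<in> poly_ring X"
  unfolding poly_ring_iff by (simp add: in_keys_iff)

lemma diff_in_poly_ring [intro]: "p \<in> poly_ring X \<Longrightarrow> q \<in> poly_ring X \<Longrightarrow> p - q \<in> poly_ring X"
  using add_in_poly_ring[of p X "- q"] by auto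

lemma mult_in_poly_ring [intro]: "p \<in> poly_ring X \<Longrightarrow> q \<in> poly_ring X \<Longrightarrow> p * q \<in> poly_ring X"
  unfolding poly_ring_iff using keys_mult[of p q] by (fastforce simp: keys_add_nat)

lemma sum_in_poly_ring [intro]: "(\<And>x. x \<in> S \<Longrightarrow> f x \<in> poly_ring X) \<Longrightarrow> sum f S \<in> poly_ring X"
  by (induction S rule: infinite_finite_induct) auto

lemma prod_in_poly_ring [intro]: "(\<And>x. x \<in> S \<Longrightarrow> f x \<in> poly_ring X) \<Longrightarrow> prod f S \<in> poly_ring X"
  by (induction S rule: infinite_finite_induct) auto

lemma power_in_poly_ring [intro]: "p \<in> poly_ring X \<Longrightarrow> p ^ n \<in> poly_ring X"
  by (induction n) auto

lemma poly_ring_mon_induct [consumes 1, case_names single add]: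
  assumes "p \<in> poly_ring X"
    and "\<And>e c. keys e \<subseteq> X \<Longrightarrow> P (single e c)" and "\<And>p q. P p \<Longrightarrow> P q \<Longrightarrow> P (p + q)"
  shows "P p"
proof -
  have P0: "P 0" using assms(2)[of 0 0] by simp
  have "P (\<Sum>e\<in>S. single e (lookup p e))" if "finite S" "S \<subseteq> keys p" for S
    using that by (induction S rule: finite_induct) (use assms P0 in \<open>auto simp: poly_ring_iff\<close>)
  from this[of "keys p"] show ?thesis using expand[of p] by simp
qed

lemma poly_ring_induct [consumes 1, case_names Cst Var add mult]:
  assumes "p \<in> poly_ring X"
    and C: "\<And>c. P (Cst c)" and V: "\<And>v. v \<in> X \<Longrightarrow> P (Var v)"
    and A: "\<And>p q. P p \<Longrightarrow> P q \<Longrightarrow> P (p + q)"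
    and M: "\<And>p q. P p \<Longrightarrow> P q \<Longrightarrow> P (p * q)"
  shows "P p"
  using assms(1)
proof (induction p rule: poly_ring_mon_induct)
  case (single e c)
  have P1: "P 1" using C[of 1] by simp
  have pow: "P (Var v ^ k)" if "v \<in> X" for v k
    using P1 by (induction k) (auto intro: M V that)
  have "P (\<Prod>v\<in>S. Var v ^ lookup e v)" if "finite S" "S \<subseteq> X" for S
    using that by (induction S rule: finite_induct) (auto intro: M P1 pow)
  then have "P (mon e)" using single by (simp add: mon_eq_prod)
  then show ?case using M[OF C, of "mon e" c] by (simp add: Cst_mult_mon)
qed (auto intro: A)

subsection \<open>Substitution\<close>

lemma subst_superset:
  assumes "finite S" "keys p \<subseteq> S"
  shows "subst \<sigma> p = (\<Sum>e\<in>S. Cst (lookup p e) * (\<Prod>v\<in>keys e. \<sigma> v ^ lookup e v))"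
  unfolding subst_def using assms by (intro sum.mono_neutral_left) (auto simp: in_keys_iff)

lemma subst_single: "subst \<sigma> (single e c) = Cst c * (\<Prod>v\<in>keys e. \<sigma> v ^ lookup e v)"
  by (subst subst_superset[of "{e}"]) auto

lemma subst_zero [simp]: "subst \<sigma> 0 = 0"
  by (simp add: subst_def)

lemma subst_add: "subst \<sigma> (p + q) = subst \<sigma> p + subst \<sigma> q"
proof -
  have "keys (p + q) \<subseteq> keys p \<union> keys q" by (rule keys_add)
  then show ?thesis
    by (simp add: subst_superset[of "keys p \<union> keys q"] lookup_add Cst_add distrib_right sum.distrib)
qed

lemma subst_uminus: "subst \<sigma> (- p) = - subst \<sigma> p"
  using subst_add[of \<sigma> p "- p"] by (simp add: eq_neg_iff_add_eq_0 add.commute)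

lemma subst_diff: "subst \<sigma> (p - q) = subst \<sigma> p - subst \<sigma> q"
  using subst_add[of \<sigma> p "- q"] by (simp add: subst_uminus)

lemma subst_sum: "subst \<sigma> (sum f S) = (\<Sum>x\<in>S. subst \<sigma> (f x))"
  by (induction S rule: infinite_finite_induct) (auto simp: subst_add)

lemma subst_Cst [simp]: "subst \<sigma> (Cst c) = Cst c"
  using subst_single[of \<sigma> 0 c] by (simp add: Cst_def)

lemma subst_Var [simp]: "subst \<sigma> (Var v) = \<sigma> v"
  by (simp add: Var_def subst_single)

lemma subst_one [simp]: "subst \<sigma> 1 = 1"
  using subst_Cst[of \<sigma> 1] by simp

lemma subst_mult: "subst \<sigma> (p * q) = subst \<sigma> p * subst \<sigma> q"
proof (induction p rule: mpoly_induct)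
  case (single e c)
  show ?case
  proof (induction q rule: mpoly_induct)
    case (single f d)
    have ext: "(\<Prod>v\<in>keys g. \<sigma> v ^ lookup g v) = (\<Prod>v\<in>keys e \<union> keys f. \<sigma> v ^ lookup g v)"
      if "keys g \<subseteq> keys e \<union> keys f" for g
      using that by (intro prod.mono_neutral_left) (auto simp: in_keys_iff)
    show ?case
      by (simp add: mult_single subst_single Cst_mult ext keys_add_nat lookup_add power_add
          prod.distrib)
  qed (simp add: distrib_left subst_add)
qed (simp add: distrib_right subst_add)

lemma subst_prod: "subst \<sigma> (prod f S) = (\<Prod>x\<in>S. subst \<sigma> (f x))"
  by (induction S rule: infinite_finite_induct) (auto simp: subst_mult)

lemma subst_power: "subst \<sigma> (p ^ n) = subst \<sigma> p ^ n"
  by (induction n) (auto simp: subst_mult)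

lemmas subst_hom = subst_add subst_uminus subst_diff subst_sum subst_mult subst_prod subst_power

lemma subst_cong:
  assumes "p \<in> poly_ring X" "\<And>v. v \<in> X \<Longrightarrow> \<sigma> v = \<tau> v"
  shows "subst \<sigma> p = subst \<tau> p"
  using assms(1) by (induction p rule: poly_ring_induct) (auto simp: subst_hom assms(2))

lemma subst_id:
  assumes "p \<in> poly_ring X" "\<And>v. v \<in> X \<Longrightarrow> \<sigma> v = Var v"
  shows "subst \<sigma> p = p"
  using assms(1) by (induction p rule: poly_ring_induct) (auto simp: subst_hom assms(2))

lemma subst_subst: "subst \<sigma> (subst \<tau> p) = subst (\<lambda>v. subst \<sigma> (\<tau> v)) p"
proof -
  have "p \<in> poly_ring UNIV" by simp
  then show ?thesis by (induction p rule: poly_ring_induct) (auto simp: subst_hom)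
qed

lemma subst_in_poly_ring:
  assumes "p \<in> poly_ring X" "\<And>v. v \<in> X \<Longrightarrow> \<sigma> v \<in> poly_ring Y"
  shows "subst \<sigma> p \<in> poly_ring Y"
  using assms(1) by (induction p rule: poly_ring_induct) (auto simp: subst_hom assms(2))

subsection \<open>Gradings\<close>

text \<open>Selecting by a predicate on keys covers homogeneous components, truncations by degree
  and the restriction \<open>restr\<close> of an exponent to a set of variables with one set of
  lemmas.\<close>

definition part :: "('a \<Rightarrow> bool) \<Rightarrow> ('a \<Rightarrow>\<^sub>0 'b::comm_monoid_add) \<Rightarrow> 'a \<Rightarrow>\<^sub>0 'b"
  where "part R p = (\<Sum>e | e \<in> keys p \<and> R e. single e (lookup p e))"

lemma lookup_part: "lookup (part R p) e = (if R e then lookup p e else 0)"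
  unfolding part_def by (auto simp: lookup_sum lookup_single when_def in_keys_iff sum.delta)

lemma keys_part: "keys (part R p) = {e \<in> keys p. R e}"
  by (auto simp: in_keys_iff lookup_part split: if_splits)

lemma part_zero [simp]: "part R 0 = 0"
  by (rule poly_mapping_eqI) (simp add: lookup_part)

lemma part_add: "part R (p + q) = part R p + part R q"
  by (rule poly_mapping_eqI) (simp add: lookup_part lookup_add)

lemma part_sum: "part R (sum f S) = (\<Sum>x\<in>S. part R (f x))"
  by (induction S rule: infinite_finite_induct) (auto simp: part_add)

lemma part_all: "(\<And>e. e \<in> keys p \<Longrightarrow> R e) \<Longrightarrow> part R p = p"
  by (rule poly_mapping_eqI) (auto simp: lookup_part in_keys_iff)

lemma part_none: "(\<And>e. e \<in> keys p \<Longrightarrow> \<not> R e) \<Longrightarrow> part R p = 0"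
  by (rule poly_mapping_eqI) (auto simp: lookup_part in_keys_iff)

lemma part_part [simp]: "part R (part R p) = part R p"
  by (rule part_all) (simp add: keys_part)

lemma part_in_poly_ring [intro]: "p \<in> poly_ring X \<Longrightarrow> part R p \<in> poly_ring X"
  by (auto simp: poly_ring_iff keys_part)

text \<open>The values lie in a general cancellative monoid because this is used both for degrees
  \<open>wt B\<close> and for the map \<open>stretch B Q\<close> from exponents to exponents.
  Cancellation yields the value 0 at 0.\<close>

definition additive :: "((nat \<Rightarrow>\<^sub>0 nat) \<Rightarrow> 'c::cancel_comm_monoid_add) \<Rightarrow> bool"
  where "additive \<kappa> \<longleftrightarrow> (\<forall>e f. \<kappa> (e + f) = \<kappa> e + \<kappa> f)"

definition graded :: "((nat \<Rightarrow>\<^sub>0 nat) \<Rightarrow> 'c) \<Rightarrow> 'c \<Rightarrow> 'k::comm_ring_1 mpoly \<Rightarrow> bool"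
  where "graded \<kappa> c p \<longleftrightarrow> (\<forall>e\<in>keys p. \<kappa> e = c)"

lemma additive_add: "additive \<kappa> \<Longrightarrow> \<kappa> (e + f) = \<kappa> e + \<kappa> f"
  by (simp add: additive_def)

lemma additive_zero: "additive \<kappa> \<Longrightarrow> \<kappa> 0 = 0"
  using additive_add[of \<kappa> 0 0] by simp

lemma graded_zero [simp]: "graded \<kappa> c 0"
  by (simp add: graded_def)

lemma graded_add: "graded \<kappa> c p \<Longrightarrow> graded \<kappa> c q \<Longrightarrow> graded \<kappa> c (p + q)"
  unfolding graded_def using keys_add[of p q] by auto

lemma graded_sum: "(\<And>x. x \<in> S \<Longrightarrow> graded \<kappa> c (f x)) \<Longrightarrow> graded \<kappa> c (sum f S)"
  by (induction S rule: infinite_finite_induct) (auto intro: graded_add)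

lemma graded_mult:
  "additive \<kappa> \<Longrightarrow> graded \<kappa> c p \<Longrightarrow> graded \<kappa> d q \<Longrightarrow> graded \<kappa> (c + d) (p * q)"
  unfolding graded_def using keys_mult[of p q] by (fastforce simp: additive_add)

lemma graded_Cst: "additive \<kappa> \<Longrightarrow> graded \<kappa> 0 (Cst c)"
  by (simp add: graded_def Cst_def additive_zero)

lemma graded_one: "additive \<kappa> \<Longrightarrow> graded \<kappa> 0 1"
  by (simp add: graded_def additive_zero)

lemma graded_Cst_mult: "additive \<kappa> \<Longrightarrow> graded \<kappa> c p \<Longrightarrow> graded \<kappa> c (Cst a * p)"
  using graded_mult[of \<kappa> 0 "Cst a" c p] by (simp add: graded_Cst)

lemma graded_prod:
  "additive \<kappa> \<Longrightarrow> (\<And>x. x \<in> S \<Longrightarrow> graded \<kappa> (d x) (f x)) \<Longrightarrow> graded \<kappa> (\<Sum>x\<in>S. d x) (prod f S)"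
  by (induction S rule: infinite_finite_induct) (auto intro: graded_mult graded_one)

text \<open>The degree is an \<open>n\<close>-fold sum since a general monoid has no multiplication
  by natural numbers. The same holds for the multiplicities in
  \<open>additive_expand\<close>.\<close>

lemma graded_power: "additive \<kappa> \<Longrightarrow> graded \<kappa> d p \<Longrightarrow> graded \<kappa> (\<Sum>i<n. d) (p ^ n)"
  using graded_prod[of \<kappa> "{..<n}" "\<lambda>_. d" "\<lambda>_. p"] by simp

lemma graded_mon: "graded \<kappa> (\<kappa> e) (single e c)"
  by (simp add: graded_def)

lemma additive_sum: "additive \<kappa> \<Longrightarrow> \<kappa> (sum f S) = (\<Sum>x\<in>S. \<kappa> (f x))"
  by (induction S rule: infinite_finite_induct) (auto simp: additive_add additive_zero)

lemma additive_single: "additive \<kappa> \<Longrightarrow> \<kappa> (single v n) = (\<Sum>i<n. \<kappa> (single v 1))"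
proof (induction n)
  case (Suc n)
  have "single v (Suc n) = single v n + single v 1"
    by (simp flip: single_add)
  then show ?case using Suc by (simp only: additive_add) simp
qed (simp add: additive_zero)

lemma additive_expand:
  assumes "additive \<kappa>"
  shows "\<kappa> e = (\<Sum>v\<in>keys e. \<Sum>i<lookup e v. \<kappa> (single v 1))"
proof -
  have "\<kappa> e = \<kappa> (\<Sum>v\<in>keys e. single v (lookup e v))"
    by (simp flip: expand)
  also have "\<dots> = (\<Sum>v\<in>keys e. \<kappa> (single v (lookup e v)))"
    by (rule additive_sum[OF assms])
  finally show ?thesis
    by (simp only: additive_single[OF assms, of _ "lookup e _"])
qed

lemma graded_subst_single:
  assumes "additive \<kappa>" "\<And>v. graded \<kappa> (\<kappa> (single v 1)) (\<sigma> v)"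
  shows "graded \<kappa> (\<kappa> e) (subst \<sigma> (single e c))"
  unfolding subst_single additive_expand[OF assms(1), of e]
  by (intro graded_Cst_mult graded_prod graded_power assms)

text \<open>Each variable is replaced by something of its own degree, so every monomial keeps its
  degree and any selection by degree commutes with the substitution. For linear actions this makes
  rings of invariants graded.\<close>

lemma part_subst:
  assumes "additive \<kappa>" "\<And>v. graded \<kappa> (\<kappa> (single v 1)) (\<sigma> v)"
  shows "part (\<lambda>e. R (\<kappa> e)) (subst \<sigma> p) = subst \<sigma> (part (\<lambda>e. R (\<kappa> e)) p)"
proof (induction p rule: mpoly_induct)
  case (single e c)
  note g = graded_subst_single[OF assms, of e c]
  show ?case
  proof (cases "R (\<kappa> e)")
    case True
    then show ?thesis using g unfolding graded_def
      by (subst (1 2) part_all) (auto split: if_splits)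
  next
    case False
    then show ?thesis using g unfolding graded_def
      by (subst (1 2) part_none) (auto split: if_splits)
  qed
qed (simp add: part_add subst_add)

text \<open>Multiplication by \<open>t\<close> shifts degrees by \<open>d\<close>. This lets a
  truncation of a product be pushed onto one factor, so that the result is again a multiple of
  \<open>t\<close>.\<close>

lemma part_graded_mult:
  assumes "additive \<kappa>" "graded \<kappa> d t"
  shows "part (\<lambda>e. R (\<kappa> e)) (p * t) = part (\<lambda>e. R (\<kappa> e + d)) p * t"
proof (induction p rule: mpoly_induct)
  case (single e c)
  have g: "graded \<kappa> (\<kappa> e + d) (single e c * t)"
    by (intro graded_mult assms graded_mon)
  show ?case
  proof (cases "R (\<kappa> e + d)")
    case True
    then show ?thesis using g unfolding graded_def by (subst (1 2) part_all) (auto split: if_splits)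
  next
    case False
    then have "part (\<lambda>e. R (\<kappa> e + d)) (single e c) = 0"
      by (intro part_none) (auto split: if_splits)
    moreover have "part (\<lambda>e. R (\<kappa> e)) (single e c * t) = 0"
      using g False unfolding graded_def by (intro part_none) auto
    ultimately show ?thesis by simp
  qed
qed (simp add: part_add distrib_right)

text \<open>The degree in the variables of \<open>B\<close>; \<open>wt UNIV\<close> is the total
  degree. Summing over the keys in \<open>B\<close> keeps the sum finite for infinite
  \<open>B\<close>.\<close>

definition wt :: "nat set \<Rightarrow> (nat \<Rightarrow>\<^sub>0 nat) \<Rightarrow> nat"
  where "wt B e = (\<Sum>v\<in>keys e \<inter> B. lookup e v)"

lemma wt_superset: "finite S \<Longrightarrow> keys e \<subseteq> S \<Longrightarrow> wt B e = (\<Sum>v\<in>S \<inter> B. lookup e v)"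
  unfolding wt_def by (rule sum.mono_neutral_left) (auto simp: in_keys_iff)

lemma additive_wt: "additive (wt B)"
  unfolding additive_def
proof (intro allI)
  fix e f :: "nat \<Rightarrow>\<^sub>0 nat"
  let ?S = "keys e \<union> keys f"
  show "wt B (e + f) = wt B e + wt B f"
    using wt_superset[of ?S e B] wt_superset[of ?S f B] wt_superset[of ?S "e + f" B]
    by (simp add: keys_add_nat lookup_add sum.distrib)
qed

lemmas wt_add = additive_add[OF additive_wt] and wt_0 [simp] = additive_zero[OF additive_wt]

lemma wt_single: "wt B (single v n) = (if v \<in> B then n else 0)"
  by (subst wt_superset[of "{v}"]) auto

lemma wt_eq_0_iff: "wt UNIV e = 0 \<longleftrightarrow> e = 0"
  by (auto simp: wt_def in_keys_iff intro!: poly_mapping_eqI)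

lemma homogeneous_graded: "homogeneous d p \<longleftrightarrow> graded (wt UNIV) d p"
  by (simp add: homogeneous_def graded_def wt_def)

definition restr :: "nat set \<Rightarrow> (nat \<Rightarrow>\<^sub>0 nat) \<Rightarrow> nat \<Rightarrow>\<^sub>0 nat"
  where "restr X = part (\<lambda>v. v \<in> X)"

lemma lookup_restr: "lookup (restr X e) v = (if v \<in> X then lookup e v else 0)"
  by (simp add: restr_def lookup_part)

lemma keys_restr: "keys (restr X e) = keys e \<inter> X"
  by (auto simp: restr_def keys_part)

lemma restr_add: "restr X (e + f) = restr X e + restr X f"
  by (simp add: restr_def part_add)

lemma restr_split: "e = restr X e + restr (- X) e"
  by (rule poly_mapping_eqI) (simp add: lookup_restr lookup_add)

lemma restr_id: "keys e \<subseteq> X \<Longrightarrow> restr X e = e"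
  by (auto simp: restr_def intro: part_all)

lemma restr_0: "keys e \<inter> X = {} \<Longrightarrow> restr X e = 0"
  by (auto simp: restr_def intro: part_none)

section \<open>Free bases\<close>

text \<open>A family instead of a set of elements: bases can be multiplied and reindexed without
  checking that their members are distinct. It is not part of the notion that combinations with
  coefficients in \<open>A\<close> stay in \<open>R\<close>; lemmas that rely on this assume it as
  \<open>closed\<close>.\<close>

definition free_basis :: "'r::comm_ring_1 set \<Rightarrow> 'r set \<Rightarrow> 'i set \<Rightarrow> ('i \<Rightarrow> 'r) \<Rightarrow> bool"
  where "free_basis A R I x \<longleftrightarrow> finite I \<and>
    (\<forall>p\<in>R. \<exists>a. (\<forall>i\<in>I. a i \<in> A) \<and> p = (\<Sum>i\<in>I. a i * x i)) \<and>
    (\<forall>a. (\<forall>i\<in>I. a i \<in> A) \<and> (\<Sum>i\<in>I. a i * x i) = 0 \<longrightarrow> (\<forall>i\<in>I. a i = 0))"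

lemma free_basisI:
  assumes "finite I"
    and "\<And>p. p \<in> R \<Longrightarrow> \<exists>a. (\<forall>i\<in>I. a i \<in> A) \<and> p = (\<Sum>i\<in>I. a i * x i)"
    and "\<And>a i. (\<And>i. i \<in> I \<Longrightarrow> a i \<in> A) \<Longrightarrow> (\<Sum>i\<in>I. a i * x i) = 0 \<Longrightarrow> i \<in> I \<Longrightarrow> a i = 0"
  shows "free_basis A R I x"
  using assms unfolding free_basis_def by blast

lemma free_basis_finite: "free_basis A R I x \<Longrightarrow> finite I"
  by (simp add: free_basis_def)

lemma free_basis_span:
  assumes "free_basis A R I x" "p \<in> R"
  obtains a where "\<And>i. i \<in> I \<Longrightarrow> a i \<in> A" "p = (\<Sum>i\<in>I. a i * x i)"
  using assms unfolding free_basis_def by blast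

lemma free_basis_indep:
  "free_basis A R I x \<Longrightarrow> (\<And>i. i \<in> I \<Longrightarrow> a i \<in> A) \<Longrightarrow> (\<Sum>i\<in>I. a i * x i) = 0 \<Longrightarrow> i \<in> I \<Longrightarrow> a i = 0"
  unfolding free_basis_def by blast

text \<open>The tower law: expand over the middle ring \<open>C\<close>, then expand the
  coefficients over \<open>A\<close>. Independence is peeled off in the same order, and
  \<open>closed\<close> ensures that the inner sums are coefficients in \<open>C\<close>.\<close>

lemma free_basis_trans:
  assumes AC: "free_basis A C I x" and CR: "free_basis C R J y"
    and closed: "\<And>a. (\<And>i. i \<in> I \<Longrightarrow> a i \<in> A) \<Longrightarrow> (\<Sum>i\<in>I. a i * x i) \<in> C"
  shows "free_basis A R (I \<times> J) (\<lambda>(i, j). x i * y j)"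
proof (rule free_basisI)
  note fin = free_basis_finite[OF AC] free_basis_finite[OF CR]
  show "finite (I \<times> J)" using fin by simp
  have swap: "(\<Sum>k\<in>I \<times> J. a k * (case k of (i, j) \<Rightarrow> x i * y j))
      = (\<Sum>j\<in>J. (\<Sum>i\<in>I. a (i, j) * x i) * y j)" for a
  proof -
    have "(\<Sum>k\<in>I \<times> J. a k * (case k of (i, j) \<Rightarrow> x i * y j))
        = (\<Sum>i\<in>I. \<Sum>j\<in>J. a (i, j) * (x i * y j))"
      by (simp add: sum.cartesian_product split_def)
    also have "\<dots> = (\<Sum>j\<in>J. \<Sum>i\<in>I. a (i, j) * (x i * y j))" by (rule sum.swap)
    finally show ?thesis by (simp add: sum_distrib_right mult.assoc)
  qed
  show "\<exists>a. (\<forall>k\<in>I \<times> J. a k \<in> A) \<and> p = (\<Sum>k\<in>I \<times> J. a k * (case k of (i, j) \<Rightarrow> x i * y j))"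
    if p: "p \<in> R" for p
  proof -
    obtain c where c: "\<And>j. j \<in> J \<Longrightarrow> c j \<in> C" "p = (\<Sum>j\<in>J. c j * y j)"
      using free_basis_span[OF CR p] by blast
    have "\<forall>j\<in>J. \<exists>a. (\<forall>i\<in>I. a i \<in> A) \<and> c j = (\<Sum>i\<in>I. a i * x i)"
      using c(1) AC unfolding free_basis_def by blast
    then obtain a where a: "\<forall>j\<in>J. (\<forall>i\<in>I. a j i \<in> A) \<and> c j = (\<Sum>i\<in>I. a j i * x i)" by metis
    then have "p = (\<Sum>k\<in>I \<times> J. a (snd k) (fst k) * (case k of (i, j) \<Rightarrow> x i * y j))"
      unfolding swap c(2) by (intro sum.cong) auto
    moreover have "\<forall>k\<in>I \<times> J. a (snd k) (fst k) \<in> A" using a by auto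
    ultimately show ?thesis by (intro exI[of _ "\<lambda>k. a (snd k) (fst k)"]) simp
  qed
  show "a k = 0" if a: "\<And>k. k \<in> I \<times> J \<Longrightarrow> a k \<in> A"
    and z: "(\<Sum>k\<in>I \<times> J. a k * (case k of (i, j) \<Rightarrow> x i * y j)) = 0" and k: "k \<in> I \<times> J" for a k
  proof -
    obtain i j where ij: "k = (i, j)" "i \<in> I" "j \<in> J" using k by auto
    have *: "(\<Sum>i\<in>I. a (i, j) * x i) = 0" if "j \<in> J" for j
    proof (rule free_basis_indep[OF CR _ _ that])
      show "(\<Sum>i\<in>I. a (i, j) * x i) \<in> C" if "j \<in> J" for j
        using that a by (intro closed) simp
      show "(\<Sum>j\<in>J. (\<Sum>i\<in>I. a (i, j) * x i) * y j) = 0" using z unfolding swap .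
    qed
    have "a (i, j) = 0"
    proof (rule free_basis_indep[OF AC _ _ ij(2)])
      show "a (i, j) \<in> A" if "i \<in> I" for i using that a ij(3) by simp
    qed (rule *[OF ij(3)])
    then show ?thesis unfolding ij(1) .
  qed
qed

lemma free_basis_reindex:
  assumes "free_basis A R I x" and h: "bij_betw h I J" and y: "\<And>i. i \<in> I \<Longrightarrow> y (h i) = x i"
  shows "free_basis A R J y"
proof (rule free_basisI)
  have inj: "inj_on h I" and J: "J = h ` I" using h by (auto simp: bij_betw_def)
  have re: "(\<Sum>j\<in>J. a j * y j) = (\<Sum>i\<in>I. a (h i) * x i)" for a
    unfolding J sum.reindex[OF inj] by (auto intro: sum.cong simp: y)
  show "finite J" unfolding J using free_basis_finite[OF assms(1)] by simp
  show "\<exists>a. (\<forall>j\<in>J. a j \<in> A) \<and> p = (\<Sum>j\<in>J. a j * y j)" if p: "p \<in> R" for p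
  proof -
    obtain a where a: "\<And>i. i \<in> I \<Longrightarrow> a i \<in> A" "p = (\<Sum>i\<in>I. a i * x i)"
      using free_basis_span[OF assms(1) p] by blast
    have "(\<Sum>j\<in>J. a (the_inv_into I h j) * y j) = p"
      unfolding re a(2) by (auto intro: sum.cong simp: the_inv_into_f_f[OF inj])
    moreover have "\<forall>j\<in>J. a (the_inv_into I h j) \<in> A"
      unfolding J by (auto simp: the_inv_into_f_f[OF inj] a(1))
    ultimately show ?thesis by (intro exI[of _ "\<lambda>j. a (the_inv_into I h j)"]) simp
  qed
  show "a j = 0" if a: "\<And>j. j \<in> J \<Longrightarrow> a j \<in> A" and z: "(\<Sum>j\<in>J. a j * y j) = 0" and j: "j \<in> J" for a j
  proof -
    obtain i where i: "i \<in> I" "j = h i" using j unfolding J by auto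
    show ?thesis unfolding i(2)
      by (rule free_basis_indep[OF assms(1) _ _ i(1), of "\<lambda>i. a (h i)"])
        (use a z in \<open>simp_all add: re\<close>, simp add: J)
  qed
qed

text \<open>Coefficients are pulled back along the substitution; \<open>closed\<close> places the
  pulled-back relation in \<open>R\<close>, where injectivity is available.\<close>

lemma free_basis_subst:
  assumes fb: "free_basis A R I x" and inj: "inj_on (subst \<sigma>) R"
    and closed: "\<And>a. (\<And>i. i \<in> I \<Longrightarrow> a i \<in> A) \<Longrightarrow> (\<Sum>i\<in>I. a i * x i) \<in> R"
    and "0 \<in> R"
  shows "free_basis (subst \<sigma> ` A) (subst \<sigma> ` R) I (\<lambda>i. subst \<sigma> (x i))"
proof (rule free_basisI)
  show "finite I" using free_basis_finite[OF fb] .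
  show "\<exists>a. (\<forall>i\<in>I. a i \<in> subst \<sigma> ` A) \<and> p = (\<Sum>i\<in>I. a i * subst \<sigma> (x i))"
    if p: "p \<in> subst \<sigma> ` R" for p
  proof -
    obtain r where r: "r \<in> R" "p = subst \<sigma> r" using p by auto
    obtain a where a: "\<And>i. i \<in> I \<Longrightarrow> a i \<in> A" "r = (\<Sum>i\<in>I. a i * x i)"
      using free_basis_span[OF fb r(1)] by blast
    then show ?thesis unfolding r(2)
      by (intro exI[of _ "\<lambda>i. subst \<sigma> (a i)"]) (simp add: subst_hom)
  qed
  show "a i = 0" if a: "\<And>i. i \<in> I \<Longrightarrow> a i \<in> subst \<sigma> ` A"
    and z: "(\<Sum>i\<in>I. a i * subst \<sigma> (x i)) = 0" and i: "i \<in> I" for a i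
  proof -
    have "\<forall>i\<in>I. \<exists>b. b \<in> A \<and> a i = subst \<sigma> b" using a by blast
    then obtain b where b: "\<forall>i\<in>I. b i \<in> A \<and> a i = subst \<sigma> (b i)" by metis
    have "subst \<sigma> (\<Sum>i\<in>I. b i * x i) = subst \<sigma> 0"
      using z b by (simp add: subst_hom)
    then have "(\<Sum>i\<in>I. b i * x i) = 0"
      using inj_onD[OF inj] closed[of b] b \<open>0 \<in> R\<close> by blast
    then have "b i = 0" using free_basis_indep[OF fb, of b i] b i by blast
    then show ?thesis using b i by simp
  qed
qed

section \<open>Subalgebras of the polynomial ring\<close>

definition subalgebra :: "'k::comm_ring_1 mpoly set \<Rightarrow> bool"
  where "subalgebra A \<longleftrightarrow> (\<forall>c. Cst c \<in> A) \<and> (\<forall>p\<in>A. \<forall>q\<in>A. p + q \<in> A \<and> p * q \<in> A)"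

context
  fixes A :: "'k::comm_ring_1 mpoly set"
  assumes A: "subalgebra A"
begin

lemma subalgebra_Cst: "Cst c \<in> A"
  and subalgebra_add: "p \<in> A \<Longrightarrow> q \<in> A \<Longrightarrow> p + q \<in> A"
  and subalgebra_mult: "p \<in> A \<Longrightarrow> q \<in> A \<Longrightarrow> p * q \<in> A"
  using A by (auto simp: subalgebra_def)

lemma subalgebra_zero: "0 \<in> A" and subalgebra_one: "1 \<in> A"
  using subalgebra_Cst[of 0] subalgebra_Cst[of 1] by simp_all

lemma subalgebra_sum: "(\<And>x. x \<in> S \<Longrightarrow> f x \<in> A) \<Longrightarrow> sum f S \<in> A"
  by (induction S rule: infinite_finite_induct) (auto intro: subalgebra_add subalgebra_zero)

lemma subalgebra_uminus: "p \<in> A \<Longrightarrow> - p \<in> A"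
  using subalgebra_mult[OF subalgebra_Cst[of "- 1"], of p] by (simp add: Cst_uminus)

lemma subalgebra_diff: "p \<in> A \<Longrightarrow> q \<in> A \<Longrightarrow> p - q \<in> A"
  using subalgebra_add[OF _ subalgebra_uminus, of p q] by simp

lemma subst_in_subalgebra:
  assumes "p \<in> poly_ring X" "\<And>v. v \<in> X \<Longrightarrow> \<sigma> v \<in> A"
  shows "subst \<sigma> p \<in> A"
  using assms(1)
  by (induction p rule: poly_ring_induct)
    (auto simp: subst_hom assms(2) intro: subalgebra_Cst subalgebra_add subalgebra_mult)

end

lemma subalgebra_poly_ring: "subalgebra (poly_ring X)"
  by (auto simp: subalgebra_def)

lemma subalgebra_subst_image:
  assumes "subalgebra A"
  shows "subalgebra (subst \<sigma> ` A)"
  unfolding subalgebra_def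
proof (intro conjI allI ballI)
  show "Cst c \<in> subst \<sigma> ` A" for c
    by (rule image_eqI[of _ _ "Cst c"]) (auto intro: subalgebra_Cst[OF assms])
  fix p q assume "p \<in> subst \<sigma> ` A" "q \<in> subst \<sigma> ` A"
  then show "p + q \<in> subst \<sigma> ` A" "p * q \<in> subst \<sigma> ` A"
    using subalgebra_add[OF assms] subalgebra_mult[OF assms]
    by (auto simp flip: subst_add subst_mult)
qed

subsection \<open>Slices\<close>

text \<open>The coefficient of \<^term>\<open>mon e\<close> when only the variables of \<open>X\<close> are regarded as variables.\<close>

definition slice :: "nat set \<Rightarrow> (nat \<Rightarrow>\<^sub>0 nat) \<Rightarrow> 'k::comm_ring_1 mpoly \<Rightarrow> 'k mpoly"
  where "slice X e p =
    (\<Sum>g | g \<in> keys p \<and> restr X g = e. single (restr (- X) g) (lookup p g))"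

lemma restr_eq_iff:
  fixes e f g :: "nat \<Rightarrow>\<^sub>0 nat"
  shows "restr X g = e \<and> restr (- X) g = f \<longleftrightarrow> keys e \<subseteq> X \<and> keys f \<inter> X = {} \<and> g = e + f"
proof
  assume "restr X g = e \<and> restr (- X) g = f"
  then show "keys e \<subseteq> X \<and> keys f \<inter> X = {} \<and> g = e + f"
    using restr_split[of g X] keys_restr[of X g] keys_restr[of "- X" g] by auto
next
  assume h: "keys e \<subseteq> X \<and> keys f \<inter> X = {} \<and> g = e + f"
  then have "keys e \<inter> - X = {}" "keys f \<subseteq> - X" by auto
  with h show "restr X g = e \<and> restr (- X) g = f"
    by (simp add: restr_add restr_id restr_0)
qed

lemma lookup_slice:
  "lookup (slice X e p) f = (if keys e \<subseteq> X \<and> keys f \<inter> X = {} then lookup p (e + f) else 0)"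
proof -
  have "lookup (slice X e p) f
      = (\<Sum>g | g \<in> keys p \<and> restr X g = e. if restr (- X) g = f then lookup p g else 0)"
    by (simp add: slice_def lookup_sum lookup_single when_def)
  also have "\<dots> = (\<Sum>g\<in>keys p. if restr X g = e \<and> restr (- X) g = f then lookup p g else 0)"
    by (rule sum.mono_neutral_cong_left) auto
  also have "\<dots> = (\<Sum>g\<in>keys p. if g = e + f then
      (if keys e \<subseteq> X \<and> keys f \<inter> X = {} then lookup p (e + f) else 0) else 0)"
    by (rule sum.cong) (auto simp: restr_eq_iff)
  also have "\<dots> = (if keys e \<subseteq> X \<and> keys f \<inter> X = {} then lookup p (e + f) else 0)"
    by (auto simp: sum.delta in_keys_iff)
  finally show ?thesis .
qed

lemma slice_add: "slice X e (p + q) = slice X e p + slice X e q"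
  by (rule poly_mapping_eqI) (simp add: lookup_slice lookup_add)

lemma slice_zero [simp]: "slice X e 0 = 0"
  by (rule poly_mapping_eqI) (simp add: lookup_slice)

lemma slice_sum: "slice X e (sum f S) = (\<Sum>x\<in>S. slice X e (f x))"
  by (induction S rule: infinite_finite_induct) (auto simp: slice_add)

lemma slice_in_poly_ring: "p \<in> poly_ring (X \<union> Y) \<Longrightarrow> slice X e p \<in> poly_ring Y"
  unfolding poly_ring_iff
proof
  fix f assume p: "\<forall>e\<in>keys p. keys e \<subseteq> X \<union> Y" and "f \<in> keys (slice X e p)"
  then have "keys f \<inter> X = {}" "e + f \<in> keys p"
    by (auto simp: in_keys_iff lookup_slice split: if_splits)
  with p show "keys f \<subseteq> Y" using keys_add_nat[of e f] by blast
qed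

lemma lookup_mon_mult_slice:
  assumes "keys e \<subseteq> X"
  shows "lookup (mon e * slice X e p) g = (if restr X g = e then lookup p g else 0)"
proof (cases "restr X g = e")
  case True
  then have g: "g = e + restr (- X) g" using restr_split[of g X] by simp
  have "keys (restr (- X) g) \<inter> X = {}" by (auto simp: keys_restr)
  then have "lookup (mon e * slice X e p) (e + restr (- X) g) = lookup p (e + restr (- X) g)"
    using assms by (simp add: lookup_mon_mult lookup_slice)
  then show ?thesis using g True by simp
next
  case False
  have "g \<notin> keys (mon e * slice X e p)"
  proof
    assume "g \<in> keys (mon e * slice X e p)"
    then obtain f where "g = e + f" "f \<in> keys (slice X e p)" by (auto simp: keys_mon_mult)
    then have "keys f \<inter> X = {}" "g = e + f" by (auto simp: in_keys_iff lookup_slice split: if_splits)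
    then show False using restr_eq_iff[of X g e f] assms False by blast
  qed
  then show ?thesis using False by (simp add: in_keys_iff)
qed

lemma slice_expand: "p = (\<Sum>e\<in>restr X ` keys p. mon e * slice X e p)"
proof (rule poly_mapping_eqI)
  fix g
  have "lookup (\<Sum>e\<in>restr X ` keys p. mon e * slice X e p) g
      = (\<Sum>e\<in>restr X ` keys p. if restr X g = e then lookup p g else 0)"
    unfolding lookup_sum by (rule sum.cong) (auto simp: lookup_mon_mult_slice keys_restr)
  then show "lookup p g = lookup (\<Sum>e\<in>restr X ` keys p. mon e * slice X e p) g"
    by (auto simp: sum.delta in_keys_iff)
qed

lemma slice_eqI:
  assumes "\<And>e. keys e \<subseteq> X \<Longrightarrow> slice X e p = slice X e q"
  shows "p = q"
proof (rule poly_mapping_eqI)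
  fix g
  have "lookup (slice X (restr X g) p) (restr (- X) g) = lookup (slice X (restr X g) q) (restr (- X) g)"
    using assms[of "restr X g"] by (simp add: keys_restr)
  moreover have "keys (restr (- X) g) \<inter> X = {}" by (auto simp: keys_restr)
  ultimately show "lookup p g = lookup q g"
    using restr_split[of g X] by (simp add: lookup_slice keys_restr)
qed

text \<open>Polynomials in \<open>Y\<close> count as scalars when only \<open>X\<close> is regarded
  as variables, and taking coefficients is linear over scalars.\<close>

lemma slice_mult_right:
  assumes "q \<in> poly_ring Y" "X \<inter> Y = {}"
  shows "slice X e (p * q) = slice X e p * q"
  using assms(1)
proof (induction q rule: poly_ring_mon_induct)
  case (single g c)
  have g: "keys g \<inter> X = {}" using single assms(2) by auto
  show ?case
  proof (induction p rule: mpoly_induct)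
    case (single h d)
    have lhs: "slice X e (single h' d') = (if restr X h' = e
        then single (restr (- X) h') d' else 0)" for h' and d' :: 'a
    proof -
      have "{g \<in> keys (single h' d'). restr X g = e}
          = (if d' \<noteq> 0 \<and> restr X h' = e then {h'} else {})" by auto
      then show ?thesis by (auto simp: slice_def)
    qed
    have "keys g \<subseteq> - X" using g by auto
    then show ?case by (simp add: mult_single lhs restr_add restr_id restr_0[OF g])
  qed (simp add: slice_add distrib_right)
qed (simp add: slice_add distrib_left)

lemma slice_of_poly_ring:
  assumes "a \<in> poly_ring X" "keys e \<subseteq> X"
  shows "slice X e a = Cst (lookup a e)"
proof (rule poly_mapping_eqI)
  fix f
  show "lookup (slice X e a) f = lookup (Cst (lookup a e)) f"
  proof (cases "f = 0")
    case False
    have "lookup a (e + f) = 0" if "keys f \<inter> X = {}"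
    proof (rule ccontr)
      assume "lookup a (e + f) \<noteq> 0"
      then have "keys (e + f) \<subseteq> X" using assms(1) by (simp add: poly_ring_iff in_keys_iff)
      then have "keys f \<subseteq> X" by (simp add: keys_add_nat)
      then show False using False restr_id[OF \<open>keys f \<subseteq> X\<close>] restr_0[OF that] by simp
    qed
    then show ?thesis using False by (simp add: lookup_slice Cst_def lookup_single when_def)
  qed (use assms in \<open>simp add: lookup_slice Cst_def\<close>)
qed

lemma slice_mult:
  assumes "a \<in> poly_ring X" "q \<in> poly_ring Y" "X \<inter> Y = {}" "keys e \<subseteq> X"
  shows "slice X e (a * q) = Cst (lookup a e) * q"
  using assms by (simp add: slice_mult_right slice_of_poly_ring)

text \<open>Such a substitution fixes the monomials in \<open>X\<close> and maps scalars, the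
  polynomials in \<open>Y\<close>, to scalars. So it acts coefficientwise.\<close>

lemma slice_subst:
  assumes p: "p \<in> poly_ring (X \<union> Y)" and XY: "X \<inter> Y = {}"
    and X: "\<And>v. v \<in> X \<Longrightarrow> \<sigma> v = Var v" and Y: "\<And>v. v \<in> Y \<Longrightarrow> \<sigma> v \<in> poly_ring Y"
  shows "slice X e (subst \<sigma> p) = subst \<sigma> (slice X e p)"
proof (cases "keys e \<subseteq> X")
  case e: True
  show ?thesis using p
  proof (induction p rule: poly_ring_mon_induct)
    case (single g c)
    let ?a = "mon (restr X g) :: 'a mpoly" and ?q = "single (restr (- X) g) c"
    have a: "?a \<in> poly_ring X" by (auto simp: keys_restr)
    have q: "?q \<in> poly_ring Y" using single by (intro single_in_poly_ring) (auto simp: keys_restr)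
    have q': "subst \<sigma> ?q \<in> poly_ring Y" by (rule subst_in_poly_ring[OF q Y])
    have eq: "single g c = ?a * ?q"
      by (simp add: mult_single flip: restr_split)
    show ?case
      unfolding eq using subst_id[OF a X]
      by (simp add: subst_mult slice_mult[OF a q XY e] slice_mult[OF a q' XY e])
  qed (simp add: slice_add subst_add)
next
  case False
  then have "slice X e p = 0" for p :: "'a mpoly"
    by (intro poly_mapping_eqI) (simp only: lookup_slice if_False simp_thms lookup_zero)
  then show ?thesis by simp
qed

subsection \<open>Fixed rings of sets of substitutions\<close>

text \<open>Sets of substitutions replace groups. The invariants of a direct product acting on
  disjoint sets of variables are then those of a union, without forming a product group.\<close>

definition fixed :: "nat set \<Rightarrow> (nat \<Rightarrow> 'k::comm_ring_1 mpoly) set \<Rightarrow> 'k mpoly set"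
  where "fixed X T = {p \<in> poly_ring X. \<forall>\<sigma>\<in>T. subst \<sigma> p = p}"

lemma subalgebra_fixed: "subalgebra (fixed X T)"
  by (auto simp: subalgebra_def fixed_def subst_hom)

lemma fixed_subset: "fixed X T \<subseteq> poly_ring X"
  by (auto simp: fixed_def)

lemma fixed_Un: "fixed X (S \<union> T) = fixed X S \<inter> fixed X T"
  by (auto simp: fixed_def)

definition moves_only :: "nat set \<Rightarrow> (nat \<Rightarrow> 'k::comm_ring_1 mpoly) set \<Rightarrow> bool"
  where "moves_only Y T \<longleftrightarrow> (\<forall>\<sigma>\<in>T. (\<forall>v. v \<notin> Y \<longrightarrow> \<sigma> v = Var v) \<and> (\<forall>v\<in>Y. \<sigma> v \<in> poly_ring Y))"

lemma moves_only_Var: "moves_only Y T \<Longrightarrow> \<sigma> \<in> T \<Longrightarrow> v \<notin> Y \<Longrightarrow> \<sigma> v = Var v"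
  and moves_only_poly_ring: "moves_only Y T \<Longrightarrow> \<sigma> \<in> T \<Longrightarrow> v \<in> Y \<Longrightarrow> \<sigma> v \<in> poly_ring Y"
  by (auto simp: moves_only_def)

text \<open>\<open>T\<close> acts on the coefficients with respect to \<open>X\<close>, so
  invariance is checked on each of them. In tensor notation, \<open>fixed (X \<union> Y) T\<close>
  is the product of \<open>poly_ring X\<close> and \<open>fixed Y T\<close>.\<close>

lemma fixed_iff_slices:
  assumes "X \<inter> Y = {}" and T: "moves_only Y T"
  shows "p \<in> fixed (X \<union> Y) T \<longleftrightarrow> p \<in> poly_ring (X \<union> Y) \<and> (\<forall>e. slice X e p \<in> fixed Y T)"
proof (cases "p \<in> poly_ring (X \<union> Y)")
  case p: True
  have sl: "slice X e (subst \<sigma> p) = subst \<sigma> (slice X e p)" if "\<sigma> \<in> T" for \<sigma> e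
    using that T assms(1) p by (intro slice_subst[of p X Y]) (auto simp: moves_only_def)
  have "subst \<sigma> p = p \<longleftrightarrow> (\<forall>e. subst \<sigma> (slice X e p) = slice X e p)" if "\<sigma> \<in> T" for \<sigma>
    using slice_eqI[of X "subst \<sigma> p" p] sl[OF that] by metis
  then show ?thesis using p slice_in_poly_ring[OF p] by (auto simp: fixed_def)
qed (auto simp: fixed_def)

lemma mult_in_fixed:
  assumes "X \<inter> Y = {}" "moves_only Y T" "a \<in> poly_ring X" "q \<in> fixed Y T"
  shows "a * q \<in> fixed (X \<union> Y) T"
proof -
  have "subst \<sigma> a = a" if "\<sigma> \<in> T" for \<sigma>
    using assms(1-3) that by (intro subst_id[of a X]) (auto simp: moves_only_def)
  moreover have "a \<in> poly_ring (X \<union> Y)" "q \<in> poly_ring (X \<union> Y)"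
    using assms(3,4) poly_ring_mono[of X "X \<union> Y"] poly_ring_mono[of Y "X \<union> Y"] by (auto simp: fixed_def)
  ultimately show ?thesis using assms(4) by (auto simp: fixed_def subst_mult)
qed

text \<open>Base change from the field to \<open>poly_ring X\<close>. To span, a monomial is split
  into its \<open>X\<close>-part, which joins the coefficients, and its \<open>Y\<close>-part, which
  is expanded. A relation is tested slice by slice.\<close>

lemma free_basis_fixed_extend:
  assumes XY: "X \<inter> Y = {}" and T: "moves_only Y T" and EY: "\<And>e. e \<in> E \<Longrightarrow> keys e \<subseteq> Y"
    and fb: "free_basis (fixed Y T) (poly_ring Y) E mon"
  shows "free_basis (fixed (X \<union> Y) T) (poly_ring (X \<union> Y)) E mon"
proof (rule free_basisI)
  let ?C = "fixed (X \<union> Y) T"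
  show "finite E" by (rule free_basis_finite[OF fb])
  show "\<exists>a. (\<forall>i\<in>E. a i \<in> ?C) \<and> p = (\<Sum>i\<in>E. a i * mon i)" if "p \<in> poly_ring (X \<union> Y)" for p
    using that
  proof (induction p rule: poly_ring_mon_induct)
    case (single g c)
    let ?a = "mon (restr X g) :: 'a mpoly" and ?q = "single (restr (- X) g) c"
    have a: "?a \<in> poly_ring X" by (auto simp: keys_restr)
    have q: "?q \<in> poly_ring Y" using single by (intro single_in_poly_ring) (auto simp: keys_restr)
    have eq: "single g c = ?a * ?q"
      by (simp add: mult_single flip: restr_split)
    obtain b where b: "\<And>i. i \<in> E \<Longrightarrow> b i \<in> fixed Y T" "?q = (\<Sum>i\<in>E. b i * mon i)"
      using free_basis_span[OF fb q] by blast
    then have "\<forall>i\<in>E. ?a * b i \<in> ?C" by (intro ballI mult_in_fixed[OF XY T a])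
    moreover have "single g c = (\<Sum>i\<in>E. ?a * b i * mon i)"
      unfolding eq b(2) by (simp add: sum_distrib_left mult.assoc)
    ultimately show ?case by (intro exI[of _ "\<lambda>i. ?a * b i"]) blast
  next
    case (add p q)
    then obtain a b where "\<forall>i\<in>E. a i \<in> ?C" "p = (\<Sum>i\<in>E. a i * mon i)"
      "\<forall>i\<in>E. b i \<in> ?C" "q = (\<Sum>i\<in>E. b i * mon i)" by blast
    then show ?case
      by (intro exI[of _ "\<lambda>i. a i + b i"])
        (auto simp: distrib_right sum.distrib intro: subalgebra_add[OF subalgebra_fixed])
  qed
  show "a i = 0" if a: "\<And>i. i \<in> E \<Longrightarrow> a i \<in> ?C" and z: "(\<Sum>i\<in>E. a i * mon i) = 0" and i: "i \<in> E" for a i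
  proof -
    have "slice X e (a i) = 0" for e
    proof (rule free_basis_indep[OF fb _ _ i, of "\<lambda>i. slice X e (a i)"])
      show "slice X e (a i) \<in> fixed Y T" if "i \<in> E" for i
        using a[OF that] fixed_iff_slices[OF XY T] by blast
      have "(\<Sum>i\<in>E. slice X e (a i) * mon i) = slice X e (\<Sum>i\<in>E. a i * mon i)"
        unfolding slice_sum
        by (rule sum.cong) (auto simp: slice_mult_right[OF single_in_poly_ring[OF EY] XY])
      then show "(\<Sum>i\<in>E. slice X e (a i) * mon i) = 0" using z by simp
    qed
    then show ?thesis using slice_eqI[of X "a i" 0] by simp
  qed
qed

lemma fixed_commute:
  assumes XY: "X \<inter> Y = {}" and S: "moves_only X S" and T: "moves_only Y T"
    and \<sigma>: "\<sigma> \<in> S" and \<tau>: "\<tau> \<in> T"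
  shows "subst \<sigma> (subst \<tau> p) = subst \<tau> (subst \<sigma> p)"
proof -
  have "subst \<sigma> (\<tau> v) = subst \<tau> (\<sigma> v)" for v
  proof (cases "v \<in> Y")
    case True
    then have "\<tau> v \<in> poly_ring Y" "\<sigma> v = Var v" using S T \<sigma> \<tau> XY True unfolding moves_only_def by blast+
    moreover have "subst \<sigma> (\<tau> v) = \<tau> v"
      by (rule subst_id[of _ Y]) (use S \<sigma> XY calculation in \<open>auto simp: moves_only_def\<close>)
    ultimately show ?thesis by simp
  next
    case v: False
    then have \<tau>v: "\<tau> v = Var v" using T \<tau> by (auto simp: moves_only_def)
    have "subst \<tau> (\<sigma> v) = \<sigma> v"
    proof (cases "v \<in> X")
      case True
      then have "\<sigma> v \<in> poly_ring X" by (rule moves_only_poly_ring[OF S \<sigma>])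
      then show ?thesis using XY by (elim subst_id) (auto intro: moves_only_Var[OF T \<tau>])
    next
      case False
      then show ?thesis using S \<sigma> \<tau>v by (auto simp: moves_only_def)
    qed
    then show ?thesis using \<tau>v by simp
  qed
  then show ?thesis by (simp add: subst_subst)
qed

text \<open>\<open>T\<close> commutes with \<open>S\<close> and fixes the basis monomials, which
  only involve \<open>X\<close>. It therefore maps the expansion of a \<open>T\<close>-invariant
  element to another expansion of the same element, and uniqueness makes the coefficients
  \<open>T\<close>-invariant.\<close>

lemma free_basis_fixed_restrict:
  assumes XY: "X \<inter> Y = {}" and S: "moves_only X S" and T: "moves_only Y T"
    and EX: "\<And>e. e \<in> E \<Longrightarrow> keys e \<subseteq> X"
    and fb: "free_basis (fixed (X \<union> Y) S) (poly_ring (X \<union> Y)) E mon"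
  shows "free_basis (fixed (X \<union> Y) (S \<union> T)) (fixed (X \<union> Y) T) E mon"
proof (rule free_basisI)
  show "finite E" by (rule free_basis_finite[OF fb])
  show "a i = 0" if "\<And>i. i \<in> E \<Longrightarrow> a i \<in> fixed (X \<union> Y) (S \<union> T)" "(\<Sum>i\<in>E. a i * mon i) = 0" "i \<in> E" for a i
    using that by (intro free_basis_indep[OF fb, of a]) (auto simp: fixed_Un)
  show "\<exists>a. (\<forall>i\<in>E. a i \<in> fixed (X \<union> Y) (S \<union> T)) \<and> p = (\<Sum>i\<in>E. a i * mon i)"
    if p: "p \<in> fixed (X \<union> Y) T" for p
  proof -
    obtain a where a: "\<And>i. i \<in> E \<Longrightarrow> a i \<in> fixed (X \<union> Y) S" "p = (\<Sum>i\<in>E. a i * mon i)"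
      using free_basis_span[OF fb, of p] p by (auto simp: fixed_def)
    have "subst \<tau> (a i) = a i" if \<tau>: "\<tau> \<in> T" and i: "i \<in> E" for \<tau> i
    proof -
      \<comment> \<open>These differences are the coefficients of the expansion of
        \<open>subst \<tau> p - p = 0\<close>.\<close>
      have "subst \<tau> (a i) - a i = 0"
      proof (rule free_basis_indep[OF fb _ _ i, of "\<lambda>i. subst \<tau> (a i) - a i"])
        fix i assume i: "i \<in> E"
        have "subst \<tau> (a i) \<in> fixed (X \<union> Y) S"
          unfolding fixed_def
        proof (intro CollectI conjI ballI)
          show "subst \<tau> (a i) \<in> poly_ring (X \<union> Y)"
          proof (rule subst_in_poly_ring)
            show "a i \<in> poly_ring (X \<union> Y)" using a(1)[OF i] by (auto simp: fixed_def)
            show "\<tau> v \<in> poly_ring (X \<union> Y)" if "v \<in> X \<union> Y" for v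
              using that poly_ring_mono[of Y "X \<union> Y"]
                moves_only_Var[OF T \<tau>] moves_only_poly_ring[OF T \<tau>]
              by (cases "v \<in> Y") auto
          qed
          show "subst \<sigma> (subst \<tau> (a i)) = subst \<tau> (a i)" if "\<sigma> \<in> S" for \<sigma>
            using a(1)[OF i] that by (simp add: fixed_commute[OF XY S T that \<tau>] fixed_def)
        qed
        then show "subst \<tau> (a i) - a i \<in> fixed (X \<union> Y) S"
          using subalgebra_diff[OF subalgebra_fixed] a(1)[OF i] by blast
      next
        have m: "subst \<tau> (mon i) = mon i" if "i \<in> E" for i
          using EX[OF that] XY T \<tau> by (intro subst_id[of _ X]) (auto simp: moves_only_def)
        have "subst \<tau> p = p" using p \<tau> by (auto simp: fixed_def)
        then have "(\<Sum>i\<in>E. subst \<tau> (a i) * mon i) = (\<Sum>i\<in>E. a i * mon i)"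
          unfolding a(2) by (simp add: subst_hom m)
        then show "(\<Sum>i\<in>E. (subst \<tau> (a i) - a i) * mon i) = 0"
          by (simp add: left_diff_distrib sum_subtractf)
      qed
      then show ?thesis by simp
    qed
    then show ?thesis using a by (intro exI[of _ a]) (auto simp: fixed_def)
  qed
qed

subsection \<open>Generators\<close>

lemma generator_in_image:
  assumes "bij_betw (subst f) (poly_ring U) A" "v \<in> U"
  shows "f v \<in> A"
proof -
  have "Var v \<in> poly_ring U" using assms(2) by blast
  then have "subst f (Var v) \<in> A" using assms(1) unfolding bij_betw_def by blast
  then show ?thesis by simp
qed

text \<open>Renumbering the generators allows two families of them to be placed side by side. The
  truncated subtraction \<open>v - s\<close> is only evaluated on \<open>v \<ge> s\<close>.\<close>

lemma subst_shift:
  "bij_betw (subst f) (poly_ring {..<r}) A \<Longrightarrow> bij_betw (subst (\<lambda>v. f (v - s))) (poly_ring {s..<s + r}) A"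
proof -
  assume f: "bij_betw (subst f) (poly_ring {..<r}) A"
  let ?h = "subst (\<lambda>v. Var (v - s)) :: 'a mpoly \<Rightarrow> 'a mpoly" and ?k = "subst (\<lambda>v. Var (v + s)) :: 'a mpoly \<Rightarrow> 'a mpoly"
  have "bij_betw ?h (poly_ring {s..<s + r}) (poly_ring {..<r})"
  proof (rule bij_betw_byWitness[where f' = ?k])
    show "\<forall>p\<in>poly_ring {s..<s + r}. ?k (?h p) = p"
      by (auto simp: subst_subst intro!: subst_id)
    show "\<forall>p\<in>poly_ring {..<r}. ?h (?k p) = p"
      by (auto simp: subst_subst intro!: subst_id)
    show "?h ` poly_ring {s..<s + r} \<subseteq> poly_ring {..<r}" "?k ` poly_ring {..<r} \<subseteq> poly_ring {s..<s + r}"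
      by (auto elim!: subst_in_poly_ring intro!: Var_in_poly_ring)
  qed
  from bij_betw_trans[OF this f] show ?thesis
    by (simp add: comp_def subst_subst)
qed

text \<open>
  Expanding in the monomials of \<open>U\<close> before the substitution and in those of \<open>X\<close> and \<open>Y\<close> after it
  reduces the injectivity on a tensor product to the injectivity on both factors.
\<close>

lemma inj_on_subst_Un:
  assumes UV: "U \<inter> V = {}" and XY: "X \<inter> Y = {}"
    and U: "inj_on (subst f) (poly_ring U)" "\<And>v. v \<in> U \<Longrightarrow> f v \<in> poly_ring X"
    and V: "inj_on (subst f) (poly_ring V)" "\<And>v. v \<in> V \<Longrightarrow> f v \<in> poly_ring Y"
  shows "inj_on (subst f) (poly_ring (U \<union> V))"
proof (rule inj_onI)
  fix p' p'' assume p': "p' \<in> poly_ring (U \<union> V)" "p'' \<in> poly_ring (U \<union> V)" "subst f p' = subst f p''"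
  define p where "p = p' - p''"
  have p: "p \<in> poly_ring (U \<union> V)" and z: "subst f p = 0"
    using p' by (auto simp: p_def subst_diff)
  let ?E = "restr U ` keys p"
  define s where "s e = subst f (slice U e p)" for e
  have s: "s e \<in> poly_ring Y" for e
    unfolding s_def using subst_in_poly_ring[OF slice_in_poly_ring[OF p] V(2)] .
  have E: "keys e \<subseteq> U" if "e \<in> ?E" for e using that by (auto simp: keys_restr)
  have fe: "subst f (mon e) \<in> poly_ring X" if "e \<in> ?E" for e
    using E[OF that] by (intro subst_in_poly_ring[OF single_in_poly_ring U(2)])
  have sum0: "(\<Sum>e\<in>?E. subst f (mon e) * s e) = 0"
    using arg_cong[OF slice_expand[of p U], of "subst f"] z by (simp add: subst_hom s_def)
  have lk: "lookup (s e) k = 0" if e: "e \<in> ?E" for e k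
  proof -
    \<comment> \<open>For a fixed monomial \<open>k\<close> in \<open>Y\<close>, collect the
      coefficients of \<open>k\<close> in all the \<open>s e\<close>. The coefficient at
      \<open>h\<close> of the image of \<open>?r\<close> is the coefficient at \<open>k\<close> of
      the slice at \<open>h\<close> of the vanishing sum, so \<open>?r\<close> is in the kernel on
      \<open>poly_ring U\<close>.\<close>
    let ?r = "\<Sum>e\<in>?E. Cst (lookup (s e) k) * mon e"
    have "lookup (subst f ?r) h = 0" for h
    proof (cases "keys h \<subseteq> X")
      case True
      have "(\<Sum>e\<in>?E. Cst (lookup (subst f (mon e)) h) * s e) = slice X h (\<Sum>e\<in>?E. subst f (mon e) * s e)"
        unfolding slice_sum by (intro sum.cong refl) (simp only: slice_mult[OF fe s XY True])
      then have "lookup (\<Sum>e\<in>?E. Cst (lookup (subst f (mon e)) h) * s e) k = 0" using sum0 by simp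
      then have "(\<Sum>e\<in>?E. lookup (s e) k * lookup (subst f (mon e)) h) = 0"
        by (simp only: lookup_sum lookup_Cst_mult) (simp only: mult.commute)
      then show ?thesis
        by (simp only: subst_hom subst_Cst lookup_sum lookup_Cst_mult)
    next
      case False
      have "subst f ?r \<in> poly_ring X"
        unfolding subst_sum subst_mult subst_Cst by (intro sum_in_poly_ring mult_in_poly_ring Cst_in_poly_ring fe)
      then show ?thesis using False by (auto simp: poly_ring_iff in_keys_iff)
    qed
    then have "subst f ?r = subst f 0" by (intro poly_mapping_eqI) (simp only: subst_zero lookup_zero)
    moreover have "?r \<in> poly_ring U"
      by (intro sum_in_poly_ring mult_in_poly_ring Cst_in_poly_ring single_in_poly_ring E)
    ultimately have "?r = 0" using inj_onD[OF U(1)] zero_in_poly_ring by blast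
    then have "lookup ?r e = 0" by simp
    then show ?thesis
      using e by (simp add: lookup_sum lookup_Cst_mult lookup_single when_def if_distrib[of "\<lambda>x. _ * x"] sum.delta cong: if_cong)
  qed
  have "slice U e p = 0" if e: "e \<in> ?E" for e
  proof -
    have "s e = 0" using lk[OF e] by (intro poly_mapping_eqI) simp
    then have "subst f (slice U e p) = subst f 0" by (simp add: s_def)
    then show ?thesis using inj_onD[OF V(1)] zero_in_poly_ring slice_in_poly_ring[OF p] by blast
  qed
  then have "p = 0" using slice_expand[of p U] by simp
  then show "p' = p''" by (simp add: p_def)
qed

text \<open>The surjectivity half of the statement that the invariants of
  \<open>S \<union> T\<close> are the tensor product of the two rings of invariants. The slices of
  an invariant \<open>p\<close> lie in \<open>fixed Y T\<close>; expanding the monomials in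
  \<open>X\<close> over \<open>fixed X S\<close> writes \<open>p\<close> in the basis
  \<open>E\<close> with coefficients in \<open>M\<close>. Since \<open>p\<close> is itself a
  legitimate coefficient of \<open>mon 0\<close>, uniqueness identifies it with an element of
  \<open>M\<close>.\<close>

lemma fixed_union_spanned:
  assumes XY: "X \<inter> Y = {}" and S: "moves_only X S" and T: "moves_only Y T"
    and E: "\<And>e. e \<in> E \<Longrightarrow> keys e \<subseteq> X" "0 \<in> E"
    and fb: "free_basis (fixed X S) (poly_ring X) E mon"
    and M: "subalgebra M" "fixed X S \<subseteq> M" "fixed Y T \<subseteq> M" "M \<subseteq> fixed (X \<union> Y) (S \<union> T)"
  shows "M = fixed (X \<union> Y) (S \<union> T)"
proof
  have XY': "Y \<inter> X = {}" "Y \<union> X = X \<union> Y" using XY by auto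
  have "free_basis (fixed (X \<union> Y) S) (poly_ring (X \<union> Y)) E mon"
    using free_basis_fixed_extend[OF XY'(1) S _ fb] E(1) unfolding XY'(2) by blast
  then have fb': "free_basis (fixed (X \<union> Y) (S \<union> T)) (fixed (X \<union> Y) T) E mon"
    using free_basis_fixed_restrict[OF XY S T] E(1) by blast
  have fin: "finite E" by (rule free_basis_finite[OF fb])
  show "fixed (X \<union> Y) (S \<union> T) \<subseteq> M"
  proof
    fix p assume p: "p \<in> fixed (X \<union> Y) (S \<union> T)"
    then have pT: "p \<in> fixed (X \<union> Y) T" by (simp add: fixed_Un)
    have "\<forall>h\<in>restr X ` keys p. \<exists>a. (\<forall>i\<in>E. a i \<in> fixed X S) \<and> mon h = (\<Sum>i\<in>E. a i * mon i)"
    proof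
      fix h assume "h \<in> restr X ` keys p"
      then have "mon h \<in> poly_ring X" by (auto simp: keys_restr)
      then show "\<exists>a. (\<forall>i\<in>E. a i \<in> fixed X S) \<and> mon h = (\<Sum>i\<in>E. a i * mon i)"
        using fb unfolding free_basis_def by blast
    qed
    from bchoice[OF this] obtain a
      where a: "\<forall>h\<in>restr X ` keys p. (\<forall>i\<in>E. a h i \<in> fixed X S) \<and> mon h = (\<Sum>i\<in>E. a h i * mon i)"
      by (elim exE)
    define b where "b i = (\<Sum>h\<in>restr X ` keys p. a h i * slice X h p)" for i
    have sl: "slice X h p \<in> fixed Y T" for h
      using fixed_iff_slices[OF XY T, of p] pT by blast
    have b: "b i \<in> M" if "i \<in> E" for i
      unfolding b_def using a that sl M(2,3) by (intro subalgebra_sum[OF M(1)] subalgebra_mult[OF M(1)]) blast+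
    have "p = (\<Sum>h\<in>restr X ` keys p. mon h * slice X h p)" by (rule slice_expand)
    also have "\<dots> = (\<Sum>h\<in>restr X ` keys p. \<Sum>i\<in>E. a h i * slice X h p * mon i)"
    proof (rule sum.cong[OF refl])
      fix h assume "h \<in> restr X ` keys p"
      then have "mon h = (\<Sum>i\<in>E. a h i * mon i)" using a by blast
      then have "mon h * slice X h p = (\<Sum>i\<in>E. a h i * mon i) * slice X h p" by (rule arg_cong)
      then show "mon h * slice X h p = (\<Sum>i\<in>E. a h i * slice X h p * mon i)"
        unfolding sum_distrib_right by (simp only: ac_simps)
    qed
    also have "\<dots> = (\<Sum>i\<in>E. b i * mon i)"
      unfolding b_def sum_distrib_right by (rule sum.swap)
    finally have eq: "p = (\<Sum>i\<in>E. b i * mon i)" .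
    \<comment> \<open>Compares the expansion with coefficients \<open>b\<close> to the trivial
      expansion \<open>p = p * mon 0\<close>.\<close>
    have "(\<Sum>i\<in>E. (b i - (if i = 0 then p else 0)) * mon i) = (\<Sum>i\<in>E. b i * mon i) - (\<Sum>i\<in>E. if i = 0 then p else 0)"
      unfolding sum_subtractf[symmetric] by (intro sum.cong refl) (simp add: left_diff_distrib)
    also have "\<dots> = 0" using eq fin E(2) by (simp add: sum.delta)
    finally have "b 0 - (if (0 :: nat \<Rightarrow>\<^sub>0 nat) = 0 then p else 0) = 0"
      by (rule free_basis_indep[OF fb', rotated])
        (use b M(4) E(2) p in \<open>auto intro!: subalgebra_diff[OF subalgebra_fixed] subalgebra_zero[OF subalgebra_fixed]\<close>)
    then have "p = b 0" by simp
    then show "p \<in> M" using b[OF E(2)] by simp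
  qed
qed (rule M(4))

lemma fixed_in_fixed_Un:
  assumes "X \<inter> Y = {}" "moves_only X S" "moves_only Y T" "p \<in> fixed X S"
  shows "p \<in> fixed (X \<union> Y) (S \<union> T)"
proof -
  have "p \<in> poly_ring X" using assms(4) by (simp add: fixed_def)
  then have "subst \<tau> p = p" if "\<tau> \<in> T" for \<tau>
    using assms(1) moves_only_Var[OF assms(3) that] by (intro subst_id[of p X]) auto
  then show ?thesis
    using assms(4) poly_ring_mono[of X "X \<union> Y"] by (auto simp: fixed_def)
qed

lemma bij_betw_subst_fixed_Un:
  fixes f g :: "nat \<Rightarrow> 'k::comm_ring_1 mpoly"
  assumes XY: "X \<inter> Y = {}" and S: "moves_only X S" and T: "moves_only Y T"
    and E: "\<And>e. e \<in> E \<Longrightarrow> keys e \<subseteq> X" "0 \<in> E"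
    and fb: "free_basis (fixed X S) (poly_ring X) E mon"
    and f: "bij_betw (subst f) (poly_ring {..<r}) (fixed X S)"
    and g: "bij_betw (subst g) (poly_ring {..<s}) (fixed Y T)"
  defines "h \<equiv> \<lambda>v. if v < r then f v else g (v - r)"
  shows "bij_betw (subst h) (poly_ring {..<r + s}) (fixed (X \<union> Y) (S \<union> T))"
proof -
  let ?U = "{..<r}" and ?V = "{r..<r + s}"
  let ?M = "subst h ` poly_ring {..<r + s}"
  have UV: "{..<r + s} = ?U \<union> ?V" "?U \<inter> ?V = {}" by auto
  have hU: "subst h p = subst f p" if "p \<in> poly_ring ?U" for p
    by (rule subst_cong[OF that]) (simp add: h_def)
  have hV: "subst h p = subst (\<lambda>v. g (v - r)) p" if "p \<in> poly_ring ?V" for p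
    by (rule subst_cong[OF that]) (simp add: h_def)
  have U: "bij_betw (subst h) (poly_ring ?U) (fixed X S)"
    by (rule iffD2[OF bij_betw_cong[OF hU] f])
  have V: "bij_betw (subst h) (poly_ring ?V) (fixed Y T)"
    by (rule iffD2[OF bij_betw_cong[OF hV] subst_shift[OF g]])
  have h: "h v \<in> fixed X S" if "v \<in> ?U" for v by (rule generator_in_image[OF U that])
  have h': "h v \<in> fixed Y T" if "v \<in> ?V" for v by (rule generator_in_image[OF V that])
  have inj: "inj_on (subst h) (poly_ring {..<r + s})"
    unfolding UV(1) using U V h h' fixed_subset
    by (intro inj_on_subst_Un[OF UV(2) XY]) (blast dest: bij_betw_imp_inj_on)+
  have "?M = fixed (X \<union> Y) (S \<union> T)"
  proof (rule fixed_union_spanned[OF XY S T E fb])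
    show "subalgebra ?M" by (intro subalgebra_subst_image subalgebra_poly_ring)
    show "fixed X S \<subseteq> ?M"
      unfolding bij_betw_imp_surj_on[OF U, symmetric] by (intro image_mono poly_ring_mono) auto
    show "fixed Y T \<subseteq> ?M"
      unfolding bij_betw_imp_surj_on[OF V, symmetric] by (intro image_mono poly_ring_mono) auto
    have XY': "Y \<inter> X = {}" using XY by auto
    have "h v \<in> fixed (X \<union> Y) (S \<union> T)" if "v \<in> {..<r + s}" for v
      using that h[THEN fixed_in_fixed_Un[OF XY S T]] h'[THEN fixed_in_fixed_Un[OF XY' T S]]
      by (cases "v < r") (auto simp: Un_commute)
    then show "?M \<subseteq> fixed (X \<union> Y) (S \<union> T)"
      using subst_in_subalgebra[OF subalgebra_fixed] by blast
  qed
  with inj show ?thesis by (simp add: bij_betw_def)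
qed

section \<open>Deformation of a free basis\<close>

text \<open>The effect on exponents of raising the variables of \<open>B\<close> to the power
  \<open>Q\<close>. Together with the remainders in \<open>box\<close> it encodes division by
  \<open>Q\<close> in each coordinate of \<open>B\<close>.\<close>

definition stretch :: "nat set \<Rightarrow> nat \<Rightarrow> (nat \<Rightarrow>\<^sub>0 nat) \<Rightarrow> nat \<Rightarrow>\<^sub>0 nat"
  where "stretch B Q = Poly_Mapping.mapp (\<lambda>v n. if v \<in> B then Q * n else n)"

definition box :: "nat set \<Rightarrow> nat \<Rightarrow> (nat \<Rightarrow>\<^sub>0 nat) set"
  where "box B Q = {e. keys e \<subseteq> B \<and> (\<forall>v. lookup e v < Q)}"

lemma lookup_mapp_zero: "(\<And>v. h v 0 = 0) \<Longrightarrow> lookup (Poly_Mapping.mapp h e) v = h v (lookup e v)"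
  by (simp add: lookup_mapp when_def in_keys_iff)

lemma lookup_stretch: "lookup (stretch B Q e) v = (if v \<in> B then Q * lookup e v else lookup e v)"
  by (simp add: stretch_def lookup_mapp_zero)

lemma additive_stretch: "additive (stretch B Q)"
  by (auto simp: additive_def lookup_stretch lookup_add algebra_simps intro!: poly_mapping_eqI)

lemma wt_stretch:
  assumes "0 < Q"
  shows "wt B (stretch B Q e) = Q * wt B e"
proof -
  have "keys (stretch B Q e) = keys e"
    using assms by (auto simp: in_keys_iff lookup_stretch split: if_splits)
  then show ?thesis by (auto simp: wt_def lookup_stretch sum_distrib_left intro: sum.cong)
qed

lemma finite_exponents: "finite S \<Longrightarrow> finite {e :: nat \<Rightarrow>\<^sub>0 nat. keys e \<subseteq> S \<and> (\<forall>v. lookup e v \<le> N)}"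
proof -
  assume "finite S"
  then have "finite {f. \<forall>v. (v \<in> S \<longrightarrow> f v \<in> {..N}) \<and> (v \<notin> S \<longrightarrow> f v = (0::nat))}"
    by (intro finite_set_of_finite_funs) auto
  moreover have "lookup ` {e. keys e \<subseteq> S \<and> (\<forall>v. lookup e v \<le> N)}
      \<subseteq> {f. \<forall>v. (v \<in> S \<longrightarrow> f v \<in> {..N}) \<and> (v \<notin> S \<longrightarrow> f v = (0::nat))}"
    by (auto simp: in_keys_iff)
  ultimately have "finite (lookup ` {e :: nat \<Rightarrow>\<^sub>0 nat. keys e \<subseteq> S \<and> (\<forall>v. lookup e v \<le> N)})"
    by (rule finite_subset[rotated])
  then show ?thesis by (rule finite_imageD) (simp add: inj_on_def)
qed

lemma finite_box: "finite B \<Longrightarrow> finite (box B Q)"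
  by (rule finite_subset[OF _ finite_exponents[of B Q]]) (auto simp: box_def intro: less_imp_le)

lemma stretch_add_box_inject:
  assumes "stretch B Q e + g = stretch B Q f + h" "g \<in> box B Q" "h \<in> box B Q"
  shows "e = f \<and> g = h"
proof -
  have "lookup e v = lookup f v \<and> lookup g v = lookup h v" for v
  proof -
    have eq: "lookup (stretch B Q e) v + lookup g v = lookup (stretch B Q f) v + lookup h v"
      using arg_cong[OF assms(1), of "\<lambda>x. lookup x v"] by (simp add: lookup_add)
    show ?thesis
    proof (cases "v \<in> B")
      case True
      have gh: "lookup g v < Q" "lookup h v < Q" using assms by (auto simp: box_def)
      have "(Q * lookup e v + lookup g v) div Q = (Q * lookup f v + lookup h v) div Q"
        "(Q * lookup e v + lookup g v) mod Q = (Q * lookup f v + lookup h v) mod Q"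
        using eq True by (simp_all add: lookup_stretch)
      then show ?thesis using gh by simp
    next
      case False
      then have "lookup g v = 0" "lookup h v = 0" using assms by (auto simp: box_def in_keys_iff)
      then show ?thesis using eq False by (simp add: lookup_stretch)
    qed
  qed
  then show ?thesis by (auto intro: poly_mapping_eqI)
qed

lemma stretch_add_box_exists:
  assumes "0 < Q"
  obtains f g where "e = stretch B Q f + g" "g \<in> box B Q"
    "keys f \<subseteq> keys e" "keys g \<subseteq> keys e"
proof
  let ?f = "Poly_Mapping.mapp (\<lambda>v n. if v \<in> B then n div Q else n) e"
  let ?g = "Poly_Mapping.mapp (\<lambda>v n. if v \<in> B then n mod Q else 0) e"
  show "e = stretch B Q ?f + ?g"
    by (rule poly_mapping_eqI) (simp add: lookup_add lookup_stretch lookup_mapp_zero)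
  show "?g \<in> box B Q"
    using assms by (auto simp: box_def in_keys_iff lookup_mapp_zero split: if_splits)
  show "keys ?f \<subseteq> keys e" "keys ?g \<subseteq> keys e"
    by (rule keys_mapp_subset)+
qed

lemma zero_in_box: "0 < Q \<Longrightarrow> 0 \<in> box B Q"
  by (simp add: box_def)

section \<open>The filtration by degree in \<open>B\<close> and leading parts\<close>

context
  fixes B :: "nat set"
begin

text \<open>The bound is strict so that \<open>low 0\<close> characterizes the zero polynomial,
  which is where inductions on the bound start.\<close>

definition low :: "nat \<Rightarrow> 'k::comm_ring_1 mpoly \<Rightarrow> bool"
  where "low N p \<longleftrightarrow> (\<forall>e\<in>keys p. wt B e < N)"

lemma low_zero [simp]: "low N 0"
  by (simp add: low_def)

lemma low_add: "low N p \<Longrightarrow> low N q \<Longrightarrow> low N (p + q)"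
  unfolding low_def using keys_add[of p q] by auto

lemma low_uminus: "low N p \<Longrightarrow> low N (- p)"
  by (simp add: low_def in_keys_iff)

lemma low_diff: "low N p \<Longrightarrow> low N q \<Longrightarrow> low N (p - q)"
  using low_add[of N p "- q"] by (simp add: low_uminus)

lemma low_sum: "(\<And>x. x \<in> S \<Longrightarrow> low N (f x)) \<Longrightarrow> low N (sum f S)"
  by (induction S rule: infinite_finite_induct) (auto intro: low_add)

text \<open>Degrees below \<open>N\<close> and at most \<open>M\<close> add up to degrees below
  \<open>N + M\<close>; hence the successor in only one hypothesis.\<close>

lemma low_mult: "low N p \<Longrightarrow> low (Suc M) q \<Longrightarrow> low (N + M) (p * q)"
  unfolding low_def using keys_mult[of p q] by (fastforce simp: wt_add)

lemma low_mono: "low N p \<Longrightarrow> N \<le> M \<Longrightarrow> low M p"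
  by (auto simp: low_def)

lemma low_graded: "graded (wt B) N p \<Longrightarrow> low (Suc N) p"
  by (auto simp: low_def graded_def)

text \<open>The component of degree \<open>N\<close> of a polynomial of degree at most
  \<open>N\<close>. It may be zero, so sums and products need no case distinction on the exact
  degree.\<close>

definition leads :: "nat \<Rightarrow> 'k::comm_ring_1 mpoly \<Rightarrow> 'k mpoly \<Rightarrow> bool"
  where "leads N p t \<longleftrightarrow> graded (wt B) N t \<and> low N (p - t)"

lemma leads_low: "leads N p t \<Longrightarrow> low (Suc N) p"
  using low_add[of "Suc N" "p - t" t] low_graded[of N t] low_mono[of N "p - t" "Suc N"]
  by (simp add: leads_def)

lemma leads_mult:
  assumes "leads N p t" "leads M q s"
  shows "leads (N + M) (p * q) (t * s)"
proof -
  have "p * q - t * s = (p - t) * q + (q - s) * t" by (simp add: algebra_simps)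
  moreover have "low (N + M) ((p - t) * q)"
    using assms by (intro low_mult) (auto simp: leads_def intro: leads_low[unfolded leads_def])
  moreover have "low (M + N) ((q - s) * t)"
    using assms by (intro low_mult) (auto simp: leads_def intro: low_graded)
  ultimately have "low (N + M) (p * q - t * s)" by (simp add: low_add add.commute[of M N])
  then show ?thesis using assms by (simp add: leads_def graded_mult[OF additive_wt])
qed

lemma leads_refl: "graded (wt B) N t \<Longrightarrow> leads N t t"
  by (simp add: leads_def)

lemma leads_one: "leads 0 1 1"
  by (intro leads_refl graded_one additive_wt)

lemma leads_power: "leads N p t \<Longrightarrow> leads (n * N) (p ^ n) (t ^ n)"
  by (induction n) (auto intro: leads_one leads_mult)

lemma leads_prod:
  "(\<And>x. x \<in> S \<Longrightarrow> leads (d x) (f x) (g x)) \<Longrightarrow> leads (sum d S) (prod f S) (prod g S)"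
  by (induction S rule: infinite_finite_induct) (auto intro: leads_one leads_mult)

end

section \<open>The model substitution: variables of \<open>B\<close> to the power
  \<open>Q\<close>\<close>

context
  fixes B Z :: "nat set" and Q :: nat
  assumes B: "finite B" "B \<subseteq> Z" and Q: "0 < Q"
begin

text \<open>Coefficients are left alone, so this is an algebra homomorphism over any coefficient
  ring and for any positive \<open>Q\<close>, in contrast to the Frobenius map.\<close>

definition frob :: "nat \<Rightarrow> 'k::comm_ring_1 mpoly"
  where "frob v = (if v \<in> B then Var v ^ Q else Var v)"

lemma frob_mon: "frob v = mon (stretch B Q (single v 1))"
proof -
  have "stretch B Q (single v 1) = single v (if v \<in> B then Q else 1)"
    by (rule poly_mapping_eqI) (auto simp: lookup_stretch lookup_single when_def)
  then show ?thesis by (simp add: frob_def Var_power) (simp add: Var_def)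
qed

lemma subst_frob_single:
  "subst frob (single e c) = single (stretch B Q e) (c :: 'k::comm_ring_1)"
proof -
  have "(mon (stretch B Q e) :: 'k mpoly) = (\<Prod>v\<in>keys e. frob v ^ lookup e v)"
    unfolding additive_expand[OF additive_stretch, of B Q e] mon_sum by (simp add: frob_mon)
  then show ?thesis using Cst_mult_mon[of c "stretch B Q e"] by (simp only: subst_single)
qed

text \<open>Uniqueness of quotient and remainder lets the coefficients of \<open>p\<close> be read
  off from the product, separately for each remainder. Injectivity of \<open>subst frob\<close> and
  independence of the \<open>box\<close> monomials both follow.\<close>

lemma lookup_subst_frob_mult:
  assumes "g \<in> box B Q" "h \<in> box B Q"
  shows "lookup (subst frob p * mon g) (stretch B Q e + h) = (if g = h then lookup p e else 0)"
proof (induction p rule: mpoly_induct)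
  case (single f c)
  have "stretch B Q f + g = stretch B Q e + h \<longleftrightarrow> f = e \<and> g = h"
    using stretch_add_box_inject assms by blast
  then show ?case by (simp add: subst_frob_single mult_single lookup_single when_def)
qed (simp add: subst_add distrib_right lookup_add)

lemma inj_subst_frob: "inj (subst frob :: 'k::comm_ring_1 mpoly \<Rightarrow> _)"
proof (rule injI, rule poly_mapping_eqI)
  fix p q :: "'k mpoly" and e
  assume "subst frob p = subst frob q"
  then show "lookup p e = lookup q e"
    using lookup_subst_frob_mult[OF zero_in_box[OF Q] zero_in_box[OF Q], of p e]
      lookup_subst_frob_mult[OF zero_in_box[OF Q] zero_in_box[OF Q], of q e] by simp
qed

lemma free_basis_frob:
  "free_basis (subst frob ` poly_ring Z) (poly_ring Z :: 'k::comm_ring_1 mpoly set) (box B Q) mon"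
proof (rule free_basisI)
  let ?A = "subst frob ` poly_ring Z :: 'k mpoly set"
  have A: "subalgebra ?A" by (intro subalgebra_subst_image subalgebra_poly_ring)
  show fin: "finite (box B Q)" by (rule finite_box[OF B(1)])
  show "\<exists>a. (\<forall>i\<in>box B Q. a i \<in> ?A) \<and> p = (\<Sum>i\<in>box B Q. a i * mon i)" if "p \<in> poly_ring Z" for p :: "'k mpoly"
    using that
  proof (induction p rule: poly_ring_mon_induct)
    case (single e c)
    obtain f g where e: "e = stretch B Q f + g" "g \<in> box B Q" and f: "keys f \<subseteq> keys e"
      using stretch_add_box_exists[OF Q] by metis
    let ?a = "\<lambda>i. if i = g then subst frob (single f c) else (0 :: 'k mpoly)"
    have "single f c \<in> poly_ring Z" using f single by (intro single_in_poly_ring) auto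
    then have "\<forall>i\<in>box B Q. ?a i \<in> ?A" using subalgebra_zero[OF A] by auto
    moreover have "(\<Sum>i\<in>box B Q. ?a i * mon i) = single e c"
      using fin e(2) by (simp add: if_distrib[of "\<lambda>x. x * _"] sum.delta subst_frob_single mult_single e(1)
          cong: if_cong)
    ultimately show ?case by (intro exI[of _ ?a]) simp
  next
    case (add p q)
    then obtain a b where "\<forall>i\<in>box B Q. a i \<in> ?A" "p = (\<Sum>i\<in>box B Q. a i * mon i)"
      "\<forall>i\<in>box B Q. b i \<in> ?A" "q = (\<Sum>i\<in>box B Q. b i * mon i)" by blast
    then show ?case
      by (intro exI[of _ "\<lambda>i. a i + b i"])
        (simp add: distrib_right sum.distrib subalgebra_add[OF A])
  qed
  show "a g = 0" if a: "\<And>i. i \<in> box B Q \<Longrightarrow> a i \<in> ?A"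
    and z: "(\<Sum>i\<in>box B Q. a i * mon i) = 0" and g: "g \<in> box B Q" for a g
  proof -
    have "\<forall>i\<in>box B Q. \<exists>p. a i = subst frob p" using a by blast
    then obtain b where b: "\<forall>i\<in>box B Q. a i = subst frob (b i)" by metis
    have "lookup (b g) e = 0" for e
    proof -
      have "lookup (\<Sum>i\<in>box B Q. a i * mon i) (stretch B Q e + g)
          = (\<Sum>i\<in>box B Q. if i = g then lookup (b i) e else 0)"
        unfolding lookup_sum using b g by (intro sum.cong) (auto simp: lookup_subst_frob_mult)
      then show ?thesis using z fin g by simp
    qed
    then have "b g = 0" by (intro poly_mapping_eqI) simp
    then show ?thesis using b g by simp
  qed
qed

section \<open>Substitutions with leading part \<open>frob\<close>\<close>

context
  fixes \<sigma> :: "nat \<Rightarrow> 'k::comm_ring_1 mpoly"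
  assumes \<sigma>_out: "\<And>v. v \<notin> B \<Longrightarrow> \<sigma> v = Var v"
    and \<sigma>_in: "\<And>v. v \<in> B \<Longrightarrow> leads B Q (\<sigma> v) (Var v ^ Q)"
    and \<sigma>_Z: "\<And>v. v \<in> B \<Longrightarrow> \<sigma> v \<in> poly_ring Z"
begin

lemma leads_subst: "leads B (Q * wt B e) (subst \<sigma> (single e c)) (subst frob (single e c))"
proof -
  have "leads B (\<Sum>v\<in>keys e. lookup e v * (if v \<in> B then Q else 0))
      (\<Prod>v\<in>keys e. \<sigma> v ^ lookup e v) (\<Prod>v\<in>keys e. frob v ^ lookup e v)"
  proof (intro leads_prod leads_power)
    fix v
    show "leads B (if v \<in> B then Q else 0) (\<sigma> v) (frob v)"
      using \<sigma>_out \<sigma>_in by (auto simp: frob_def graded_def Var_def wt_single intro!: leads_refl)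
  qed
  also have "(\<Sum>v\<in>keys e. lookup e v * (if v \<in> B then Q else 0)) = (\<Sum>v\<in>keys e \<inter> B. Q * lookup e v)"
    by (subst sum.inter_restrict) (auto intro: sum.cong)
  also have "\<dots> = Q * wt B e" by (simp add: wt_def sum_distrib_left)
  finally show ?thesis
    using leads_mult[OF leads_refl[OF graded_Cst[OF additive_wt, where c = c]]]
    by (fastforce simp: subst_single)
qed

lemma low_subst_mult:
  assumes "\<And>e. e \<in> keys a \<Longrightarrow> Q * wt B e + wt B g < N"
  shows "low B N (subst \<sigma> a * mon g)"
proof -
  have "low B N (\<Sum>e\<in>keys a. subst \<sigma> (single e (lookup a e)) * mon g)"
  proof (rule low_sum)
    fix e assume "e \<in> keys a"
    have "low B (Suc (Q * wt B e) + wt B g) (subst \<sigma> (single e (lookup a e)) * mon g)"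
      by (intro low_mult leads_low[OF leads_subst] low_graded graded_mon)
    then show "low B N (subst \<sigma> (single e (lookup a e)) * mon g)"
      by (rule low_mono) (use assms[OF \<open>e \<in> keys a\<close>] in simp)
  qed
  then show ?thesis by (simp flip: subst_sum sum_distrib_right expand)
qed

lemma low_subst_diff_mult:
  assumes "\<And>e. e \<in> keys a \<Longrightarrow> Q * wt B e + wt B g = N"
  shows "low B N (subst \<sigma> a * mon g - subst frob a * mon g)"
proof -
  have "low B N (\<Sum>e\<in>keys a. (subst \<sigma> (single e (lookup a e))
      - subst frob (single e (lookup a e))) * mon g)"
  proof (rule low_sum)
    fix e assume "e \<in> keys a"
    have "low B (Q * wt B e + wt B g) ((subst \<sigma> (single e (lookup a e))
      - subst frob (single e (lookup a e))) * mon g)"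
      using leads_subst[of e] by (intro low_mult low_graded graded_mon) (auto simp: leads_def)
    then show "low B N ((subst \<sigma> (single e (lookup a e))
      - subst frob (single e (lookup a e))) * mon g)"
      using assms[OF \<open>e \<in> keys a\<close>] by simp
  qed
  also have "(\<Sum>e\<in>keys a. (subst \<sigma> (single e (lookup a e))
      - subst frob (single e (lookup a e))) * mon g) = (subst \<sigma> a - subst frob a) * mon g"
    by (simp flip: subst_sum sum_distrib_right expand add: sum_subtractf)
  finally show ?thesis by (simp add: left_diff_distrib)
qed

text \<open>\<open>frob\<close> multiplies the degree in \<open>B\<close> by \<open>Q\<close> and
  \<open>mon g\<close> adds its own degree, so a component of the product comes from one component
  of \<open>a\<close>.\<close>

lemma part_subst_frob_mult:
  fixes a :: "'k mpoly"
  shows "part (\<lambda>e. wt B e = N) (subst frob a * mon g) = subst frob (part (\<lambda>e. Q * wt B e + wt B g = N) a) * mon g"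
proof -
  have "part (\<lambda>e. wt B e + wt B g = N) (subst frob a) = subst frob (part (\<lambda>e. Q * wt B e + wt B g = N) a)"
    for a :: "'k mpoly"
  proof (induction a rule: mpoly_induct)
    case (single e c)
    have "part (\<lambda>e. wt B e + wt B g = N) (single (stretch B Q e) c)
        = (if Q * wt B e + wt B g = N then single (stretch B Q e) c else 0)"
      by (auto intro!: part_all part_none simp: wt_stretch[OF Q] split: if_splits)
    moreover have "part (\<lambda>e. Q * wt B e + wt B g = N) (single e c)
        = (if Q * wt B e + wt B g = N then single e c else 0)"
      by (auto intro!: part_all part_none split: if_splits)
    ultimately show ?case by (simp add: subst_frob_single)
  qed (simp add: part_add subst_add)
  then show ?thesis
    using part_graded_mult[OF additive_wt[of B] graded_mon[of "wt B" g 1], of "\<lambda>n. n = N" "subst frob a"] by simp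
qed

text \<open>Let \<open>?t\<close> be the top component of a nonzero kernel element. Its image under
  \<open>frob\<close> is homogeneous of degree \<open>Q * ?M\<close>, but it equals, up to sign,
  terms of lower degree. So it vanishes, against the injectivity of \<open>frob\<close>.\<close>

lemma inj_subst_deformation: "inj (subst \<sigma>)"
proof (rule injI, rule ccontr)
  fix x y assume xy: "subst \<sigma> x = subst \<sigma> y" "x \<noteq> y"
  let ?p = "x - y" and ?M = "Max (wt B ` keys (x - y))"
  let ?t = "part (\<lambda>e. wt B e = ?M) ?p"
  have p0: "subst \<sigma> ?p = 0" using xy by (simp add: subst_diff)
  have fin: "finite (wt B ` keys ?p)" by simp
  have ne: "wt B ` keys ?p \<noteq> {}" using xy(2) by (simp add: keys_eq_empty)
  have "low B (Q * ?M) (subst \<sigma> (?p - ?t) * mon 0)"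
  proof (rule low_subst_mult)
    fix e assume "e \<in> keys (?p - ?t)"
    then have e: "e \<in> keys ?p" "wt B e \<noteq> ?M"
      by (auto simp: in_keys_iff lookup_minus lookup_part split: if_splits)
    have "wt B e \<le> ?M" using e(1) by (intro Max_ge fin imageI)
    then have "wt B e < ?M" using e(2) by (rule le_neq_implies_less)
    then show "Q * wt B e + wt B 0 < Q * ?M" using Q by simp
  qed
  moreover have "low B (Q * ?M) (subst \<sigma> ?t * mon 0 - subst frob ?t * mon 0)"
    by (rule low_subst_diff_mult) (simp add: keys_part)
  ultimately have "low B (Q * ?M) (subst \<sigma> (?p - ?t) + (subst \<sigma> ?t - subst frob ?t))"
    by (intro low_add) simp_all
  then have "low B (Q * ?M) (- subst frob ?t)"
    using p0 by (simp add: subst_diff)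
  then have low: "low B (Q * ?M) (subst frob ?t)" using low_uminus by fastforce
  have "graded (wt B) (Q * ?M) (\<Sum>e\<in>keys ?t. subst frob (single e (lookup ?t e)))"
    unfolding subst_frob_single
    by (intro graded_sum) (auto simp: graded_def wt_stretch[OF Q] keys_part)
  then have "graded (wt B) (Q * ?M) (subst frob ?t)"
    unfolding subst_sum[symmetric] expand[symmetric] .
  then have "e \<notin> keys (subst frob ?t)" for e
    using low unfolding low_def graded_def by (metis less_irrefl_nat)
  then have "keys (subst frob ?t) = {}" by blast
  then have "subst frob ?t = 0" by (simp only: keys_eq_empty)
  then have "?t = 0" using injD[OF inj_subst_frob, of ?t 0] by simp
  moreover obtain e where "e \<in> keys ?p" "wt B e = ?M" using Max_in[OF fin ne] by auto
  then have "e \<in> keys ?t" by (simp add: keys_part)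
  ultimately show False by simp
qed

text \<open>
  With respect to the degree in the variables of \<open>B\<close>, the top part of \<^term>\<open>subst \<sigma> a\<close> is
  \<^term>\<open>subst frob a\<close>, so a basis for the latter substitution remains one for the former.
\<close>

lemma free_basis_deform:
  assumes C: "subalgebra C" "C \<subseteq> poly_ring Z"
    and C_part: "\<And>p R. p \<in> C \<Longrightarrow> part (\<lambda>e. R (wt B e)) p \<in> C"
    and EZ: "\<And>e. e \<in> E \<Longrightarrow> keys e \<subseteq> Z"
    and fb: "free_basis C (poly_ring Z) E mon"
  shows "free_basis (subst \<sigma> ` C) (poly_ring Z) (E \<times> box B Q) (\<lambda>(b, g). mon (stretch B Q b + g))"
proof -
  let ?I = "E \<times> box B Q" and ?h = "\<lambda>i. stretch B Q (fst i) + snd i"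
  let ?x = "\<lambda>i. mon (?h i) :: 'k mpoly"
  have closed: "(\<Sum>i\<in>E. a i * mon i) \<in> poly_ring Z" if "\<And>i. i \<in> E \<Longrightarrow> a i \<in> C" for a
    using that C EZ by (intro sum_in_poly_ring mult_in_poly_ring single_in_poly_ring) auto
  have fb1: "free_basis (subst frob ` C) (subst frob ` poly_ring Z) E (\<lambda>i. subst frob (mon i))"
    by (rule free_basis_subst[OF fb inj_on_subset[OF inj_subst_frob] closed]) auto
  have "free_basis (subst frob ` C) (poly_ring Z) ?I (\<lambda>(i, j). subst frob (mon i) * mon j)"
  proof (rule free_basis_trans[OF fb1 free_basis_frob])
    fix a assume a: "\<And>i. i \<in> E \<Longrightarrow> a i \<in> subst frob ` C"
    have sub: "subalgebra (subst frob ` poly_ring Z :: 'k mpoly set)"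
      by (intro subalgebra_subst_image subalgebra_poly_ring)
    show "(\<Sum>i\<in>E. a i * subst frob (mon i)) \<in> subst frob ` poly_ring Z"
      using a C(2) EZ by (intro subalgebra_sum[OF sub] subalgebra_mult[OF sub]) blast+
  qed
  then have fb0: "free_basis (subst frob ` C) (poly_ring Z) ?I ?x"
    by (simp add: subst_frob_single mult_single split_def)
  have finI: "finite ?I" by (rule free_basis_finite[OF fb0])
  \<comment> \<open>Induction on the degree bound: expand the top component with
    \<open>frob\<close>, subtract the same expression with \<open>\<sigma>\<close> in place of
    \<open>frob\<close>, and treat the remainder of smaller degree.\<close>
  have span: "\<exists>a. (\<forall>i\<in>?I. a i \<in> C) \<and> p = (\<Sum>i\<in>?I. subst \<sigma> (a i) * ?x i)"
    if "p \<in> poly_ring Z" "low B N p" for p N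
    using that
  proof (induction N arbitrary: p)
    case 0
    then have "p = 0" by (auto simp: low_def intro: ccontr)
    then show ?case by (intro exI[of _ "\<lambda>_. 0"]) (simp add: subalgebra_zero[OF C(1)])
  next
    case (Suc N)
    obtain b where b: "\<And>i. i \<in> ?I \<Longrightarrow> b i \<in> subst frob ` C" "p = (\<Sum>i\<in>?I. b i * ?x i)"
      using free_basis_span[OF fb0 Suc.prems(1)] by blast
    then have "\<forall>i\<in>?I. \<exists>a. a \<in> C \<and> b i = subst frob a" by blast
    then obtain a where a: "\<forall>i\<in>?I. a i \<in> C \<and> b i = subst frob (a i)" by metis
    \<comment> \<open>The part of \<open>a i\<close> whose term has degree exactly \<open>N\<close>
      after \<open>frob\<close> and multiplication by the basis monomial. It stays in
      \<open>C\<close> by \<open>C_part\<close>; this is why the coefficient ring has to be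
      graded.\<close>
    define a' where "a' i = part (\<lambda>e. Q * wt B e + wt B (?h i) = N) (a i)" for i
    have a': "a' i \<in> C" if "i \<in> ?I" for i
      unfolding a'_def using C_part[of "a i" "\<lambda>n. Q * n + wt B (?h i) = N"] a that by blast
    have "part (\<lambda>e. wt B e = N) p = (\<Sum>i\<in>?I. part (\<lambda>e. wt B e = N) (subst frob (a i) * ?x i))"
      unfolding b(2) part_sum using a by (intro sum.cong) auto
    then have top: "part (\<lambda>e. wt B e = N) p = (\<Sum>i\<in>?I. subst frob (a' i) * ?x i)"
      unfolding part_subst_frob_mult a'_def .
    let ?r = "p - (\<Sum>i\<in>?I. subst \<sigma> (a' i) * ?x i)"
    have "?r = (p - part (\<lambda>e. wt B e = N) p)
        - (\<Sum>i\<in>?I. subst \<sigma> (a' i) * ?x i - subst frob (a' i) * ?x i)"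
      unfolding top by (simp add: sum_subtractf)
    moreover have "low B N (p - part (\<lambda>e. wt B e = N) p)"
      using Suc.prems(2) by (auto simp: low_def in_keys_iff lookup_minus lookup_part less_Suc_eq split: if_splits)
    moreover have "low B N (\<Sum>i\<in>?I. subst \<sigma> (a' i) * ?x i - subst frob (a' i) * ?x i)"
      by (intro low_sum low_subst_diff_mult) (simp add: a'_def keys_part)
    ultimately have "low B N ?r" by (simp only: low_diff)
    moreover have "?r \<in> poly_ring Z"
    proof (intro diff_in_poly_ring sum_in_poly_ring mult_in_poly_ring single_in_poly_ring Suc.prems)
      fix i assume i: "i \<in> ?I"
      show "subst \<sigma> (a' i) \<in> poly_ring Z"
      proof (rule subst_in_poly_ring)
        show "a' i \<in> poly_ring Z" using a'[OF i] C(2) by blast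
        show "\<sigma> v \<in> poly_ring Z" if "v \<in> Z" for v
          using \<sigma>_Z[of v] \<sigma>_out[of v] that by (cases "v \<in> B") auto
      qed
      have "keys (?h i) \<subseteq> keys (fst i) \<union> keys (snd i)"
        by (auto simp: in_keys_iff lookup_add lookup_stretch split: if_splits)
      moreover have "keys (fst i) \<subseteq> Z" "keys (snd i) \<subseteq> Z"
        using i EZ[of "fst i"] B(2) by (auto simp: box_def)
      ultimately show "keys (?h i) \<subseteq> Z" by blast
    qed
    ultimately obtain c where c: "\<forall>i\<in>?I. c i \<in> C" "?r = (\<Sum>i\<in>?I. subst \<sigma> (c i) * ?x i)"
      using Suc.IH by blast
    have "p = (\<Sum>i\<in>?I. subst \<sigma> (c i + a' i) * ?x i)"
      using c(2) by (simp add: subst_add distrib_right sum.distrib algebra_simps)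
    then show ?case using c(1) a' subalgebra_add[OF C(1)]
      by (intro exI[of _ "\<lambda>i. c i + a' i"]) simp
  qed
  \<comment> \<open>Induction on a bound for the degrees of the individual terms, not of their sum,
    which is zero. The terms of top degree form a relation for \<open>frob\<close>, so they vanish
    and the bound drops.\<close>
  have indep: "\<forall>i\<in>?I. a i = 0"
    if "\<forall>i\<in>?I. a i \<in> C" "\<forall>i\<in>?I. \<forall>e\<in>keys (a i). Q * wt B e + wt B (?h i) < N"
      "(\<Sum>i\<in>?I. subst \<sigma> (a i) * ?x i) = 0" for a N
    using that
  proof (induction N)
    case 0
    then have "keys (a i) = {}" if "i \<in> ?I" for i using that by blast
    then show ?case by (simp flip: keys_eq_empty)
  next
    case (Suc N)
    define a' where "a' i = part (\<lambda>e. Q * wt B e + wt B (?h i) = N) (a i)" for i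
    have a': "a' i \<in> C" if "i \<in> ?I" for i
      unfolding a'_def using C_part[of "a i" "\<lambda>n. Q * n + wt B (?h i) = N"] Suc.prems that by blast
    \<comment> \<open>Replacing \<open>\<sigma>\<close> by \<open>frob\<close> in the top terms
      costs lower degrees, and the other terms are lower anyway. What remains of the relation is the
      sum of the \<open>frob\<close> terms, homogeneous of degree \<open>N\<close> and at the same
      time of degree below \<open>N\<close>.\<close>
    have "low B N (\<Sum>i\<in>?I. (subst \<sigma> (a' i) * ?x i - subst frob (a' i) * ?x i) + subst \<sigma> (a i - a' i) * ?x i)"
    proof (intro low_sum low_add low_subst_diff_mult low_subst_mult)
      fix i e assume "i \<in> ?I"
      show "e \<in> keys (a' i) \<Longrightarrow> Q * wt B e + wt B (?h i) = N" by (simp add: a'_def keys_part)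
      assume e: "e \<in> keys (a i - a' i)"
      then have "e \<in> keys (a i)" "Q * wt B e + wt B (?h i) \<noteq> N"
        by (auto simp: a'_def in_keys_iff lookup_minus lookup_part split: if_splits)
      then show "Q * wt B e + wt B (?h i) < N"
        using Suc.prems(2) \<open>i \<in> ?I\<close> by (metis less_SucE)
    qed
    also have "(\<Sum>i\<in>?I. (subst \<sigma> (a' i) * ?x i - subst frob (a' i) * ?x i) + subst \<sigma> (a i - a' i) * ?x i)
        = (\<Sum>i\<in>?I. subst \<sigma> (a i) * ?x i - subst frob (a' i) * ?x i)"
      by (intro sum.cong) (auto simp: subst_diff left_diff_distrib)
    finally have "low B N (- (\<Sum>i\<in>?I. subst frob (a' i) * ?x i))"
      using Suc.prems(3) by (simp add: sum_subtractf)
    then have "low B N (\<Sum>i\<in>?I. subst frob (a' i) * ?x i)" using low_uminus by fastforce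
    then have "part (\<lambda>e. wt B e = N) (\<Sum>i\<in>?I. subst frob (a' i) * ?x i) = 0"
      by (intro part_none) (auto simp: low_def)
    moreover have "part (\<lambda>e. wt B e = N) (\<Sum>i\<in>?I. subst frob (a' i) * ?x i)
        = (\<Sum>i\<in>?I. subst frob (a' i) * ?x i)"
      unfolding part_sum part_subst_frob_mult
      by (intro sum.cong) (auto simp: a'_def)
    ultimately have z: "(\<Sum>i\<in>?I. subst frob (a' i) * ?x i) = 0" by simp
    have "a' i = 0" if i: "i \<in> ?I" for i
    proof -
      have "subst frob (a' i) = 0"
        by (rule free_basis_indep[OF fb0 _ z i]) (use a' in blast)
      then show ?thesis using injD[OF inj_subst_frob, of "a' i" 0] by simp
    qed
    then have "Q * wt B e + wt B (?h i) \<noteq> N" if "i \<in> ?I" "e \<in> keys (a i)" for i e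
      using that keys_part[of "\<lambda>e. Q * wt B e + wt B (?h i) = N" "a i"] by (auto simp flip: a'_def)
    then have "\<forall>i\<in>?I. \<forall>e\<in>keys (a i). Q * wt B e + wt B (?h i) < N"
      using Suc.prems(2) by (metis less_SucE)
    then show ?case using Suc.IH Suc.prems by blast
  qed
  have "free_basis (subst \<sigma> ` C) (poly_ring Z) ?I ?x"
  proof (rule free_basisI[OF finI])
    fix p :: "'k mpoly" assume p: "p \<in> poly_ring Z"
    obtain N where "\<forall>n\<in>wt B ` keys p. n < N"
      using finite_nat_set_iff_bounded[of "wt B ` keys p"] by auto
    then have "low B N p" by (auto simp: low_def)
    then obtain a where "\<forall>i\<in>?I. a i \<in> C" "p = (\<Sum>i\<in>?I. subst \<sigma> (a i) * ?x i)"
      using span[OF p] by blast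
    then show "\<exists>a. (\<forall>i\<in>?I. a i \<in> subst \<sigma> ` C) \<and> p = (\<Sum>i\<in>?I. a i * ?x i)"
      by (intro exI[of _ "\<lambda>i. subst \<sigma> (a i)"]) blast
  next
    fix a i assume a: "\<And>i. i \<in> ?I \<Longrightarrow> a i \<in> subst \<sigma> ` C"
      and z: "(\<Sum>i\<in>?I. a i * ?x i) = 0" and i: "i \<in> ?I"
    have "\<forall>i\<in>?I. \<exists>b. b \<in> C \<and> a i = subst \<sigma> b" using a by blast
    then obtain b where b: "\<forall>i\<in>?I. b i \<in> C \<and> a i = subst \<sigma> (b i)" by metis
    let ?D = "(\<lambda>(i, e). Q * wt B e + wt B (?h i)) ` (SIGMA i:?I. keys (b i))"
    have "finite ?D" by (rule finite_imageI[OF finite_SigmaI[OF finI]]) simp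
    then obtain N where "\<forall>n\<in>?D. n < N" using finite_nat_set_iff_bounded by blast
    then have "\<forall>i\<in>?I. \<forall>e\<in>keys (b i). Q * wt B e + wt B (?h i) < N" by auto
    moreover have "(\<Sum>i\<in>?I. subst \<sigma> (b i) * ?x i) = 0" using z b by simp
    ultimately have "b i = 0" using indep[of b N] b i by blast
    then show "a i = 0" using bspec[OF b i] by simp
  qed
  then show ?thesis by (simp add: split_def)
qed

end

end

section \<open>Block bases are free bases\<close>

definition below :: "(nat \<Rightarrow>\<^sub>0 nat) \<Rightarrow> (nat \<Rightarrow>\<^sub>0 nat) set"
  where "below e0 = {e. \<forall>v. lookup e v \<le> lookup e0 v}"

lemma keys_below: "e \<in> below e0 \<Longrightarrow> keys e \<subseteq> keys e0"
proof
  fix v assume e: "e \<in> below e0" and v: "v \<in> keys e"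
  have "lookup e v \<le> lookup e0 v" using e by (simp add: below_def)
  moreover have "lookup e v \<noteq> 0" using v by (simp add: in_keys_iff)
  ultimately have "lookup e0 v \<noteq> 0" by linarith
  then show "v \<in> keys e0" by (simp add: in_keys_iff)
qed

lemma finite_below: "finite (below e0)"
proof (rule finite_subset)
  show "below e0 \<subseteq> {e. keys e \<subseteq> keys e0 \<and> (\<forall>v. lookup e v \<le> (\<Sum>v\<in>keys e0. lookup e0 v))}"
  proof (rule subsetI, intro CollectI conjI allI)
    fix e assume e: "e \<in> below e0"
    show "keys e \<subseteq> keys e0" by (rule keys_below[OF e])
    fix v
    show "lookup e v \<le> (\<Sum>v\<in>keys e0. lookup e0 v)"
    proof (cases "v \<in> keys e0")
      case True
      then have "lookup e0 v \<le> (\<Sum>v\<in>keys e0. lookup e0 v)" by (intro member_le_sum) auto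
      moreover have "lookup e v \<le> lookup e0 v" using e by (simp add: below_def)
      ultimately show ?thesis by linarith
    next
      case False
      then have "v \<notin> keys e" using keys_below[OF e] by blast
      then show ?thesis by (simp add: in_keys_iff)
    qed
  qed
qed (rule finite_exponents, simp)

lemma below_iff: "e \<in> below e0 \<longleftrightarrow> (\<exists>f. e0 = e + f)"
proof
  assume e: "e \<in> below e0"
  have "e0 = e + (e0 - e)"
    by (rule poly_mapping_eqI) (use e in \<open>auto simp: below_def lookup_add lookup_minus\<close>)
  then show "\<exists>f. e0 = e + f" by blast
qed (auto simp: below_def lookup_add)

lemma inj_mon: "inj (mon :: _ \<Rightarrow> 'k::comm_ring_1 mpoly)"
proof (rule injI)
  fix e f :: "nat \<Rightarrow>\<^sub>0 nat" assume "(mon e :: 'k mpoly) = mon f"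
  then have "keys (mon e :: 'k mpoly) = keys (mon f :: 'k mpoly)" by (rule arg_cong)
  then show "e = f" by simp
qed

lemma monomial_factors_mon: "monomial_factors (mon e0) = (mon ` below e0 :: 'k::comm_ring_1 mpoly set)"
proof (intro equalityI subsetI)
  fix h :: "'k mpoly" assume "h \<in> monomial_factors (mon e0)"
  then obtain e p where h: "h = mon e" "(mon e0 :: 'k mpoly) = mon e * p"
    unfolding monomial_factors_def monic_monomial_def dvd_def by blast
  have "e0 \<in> keys (mon e * p)" unfolding h(2)[symmetric] by simp
  then have "e \<in> below e0" by (auto simp: keys_mon_mult below_iff)
  then show "h \<in> mon ` below e0" using h by blast
next
  fix h :: "'k mpoly" assume "h \<in> mon ` below e0"
  then obtain e f where "h = mon e" "e0 = e + f" by (auto simp: below_iff)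
  then show "h \<in> monomial_factors (mon e0)"
    by (auto simp: monomial_factors_def monic_monomial_def mon_add simp del: mult_single)
qed

subsection \<open>Combinations and ideals\<close>

lemma comb_superset: "finite T \<Longrightarrow> keys c \<subseteq> T \<Longrightarrow> comb c = (\<Sum>t\<in>T. lookup c t * t)"
  unfolding comb_def by (intro sum.mono_neutral_left) (auto simp: in_keys_iff)

lemma lookup_combos: "c \<in> combos A B \<Longrightarrow> lookup c t \<in> A"
  unfolding combos_def by blast

lemma combos_exist:
  assumes "finite T" "T \<subseteq> S" "\<forall>t\<in>T. g t \<in> R" "0 \<in> R"
  shows "\<exists>c\<in>combos R S. comb c = (\<Sum>t\<in>T. g t * t) \<and> (\<forall>t\<in>T. lookup c t = g t)"
proof (intro bexI conjI ballI)
  let ?c = "\<Sum>t\<in>T. single t (g t)"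
  have lk: "lookup ?c t = (if t \<in> T then g t else 0)" for t
    using assms(1) by (simp add: lookup_sum lookup_single when_def)
  then have k: "keys ?c \<subseteq> T" by (auto simp: in_keys_iff split: if_splits)
  show "?c \<in> combos R S" using k assms by (auto simp: combos_def lk)
  show "comb ?c = (\<Sum>t\<in>T. g t * t)" unfolding comb_superset[OF assms(1) k] lk by simp
  show "lookup ?c t = g t" if "t \<in> T" for t using that lk by simp
qed

lemma in_ideal_gen_iff:
  assumes "0 \<in> R"
  shows "x \<in> ideal_gen R S \<longleftrightarrow>
    (\<exists>T g. finite T \<and> T \<subseteq> S \<and> (\<forall>t\<in>T. g t \<in> R) \<and> x = (\<Sum>t\<in>T. g t * t))" (is "_ \<longleftrightarrow> ?rhs")
proof
  assume "x \<in> ideal_gen R S"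
  then obtain c where "c \<in> combos R S" "x = comb c" by (auto simp: ideal_gen_def)
  then show ?rhs
    by (intro exI[of _ "keys c"] exI[of _ "lookup c"]) (auto simp: combos_def comb_def)
next
  assume ?rhs
  then obtain T g where "finite T" "T \<subseteq> S" "\<forall>t\<in>T. g t \<in> R" "x = (\<Sum>t\<in>T. g t * t)" by blast
  then have "\<exists>c\<in>combos R S. comb c = x" using combos_exist[of T S g R] assms by blast
  then show "x \<in> ideal_gen R S" by (auto simp: ideal_gen_def)
qed

context
  fixes R S :: "'k::comm_ring_1 mpoly set"
  assumes R: "subalgebra R"
begin

lemma ideal_gen_add:
  assumes "x \<in> ideal_gen R S" "y \<in> ideal_gen R S"
  shows "x + y \<in> ideal_gen R S"
proof -
  obtain c d where cd: "c \<in> combos R S" "x = comb c" "d \<in> combos R S" "y = comb d"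
    using assms by (auto simp: ideal_gen_def)
  have k: "keys (c + d) \<subseteq> keys c \<union> keys d" by (rule keys_add)
  then have "x + y = comb (c + d)"
    unfolding cd(2,4)
    by (simp add: comb_superset[of "keys c \<union> keys d"] lookup_add distrib_right sum.distrib)
  moreover have "c + d \<in> combos R S"
    using cd k subalgebra_add[OF R] by (auto simp: combos_def lookup_add image_subset_iff)
  ultimately show ?thesis by (auto simp: ideal_gen_def)
qed

lemma ideal_gen_zero: "0 \<in> ideal_gen R S"
  unfolding in_ideal_gen_iff[OF subalgebra_zero[OF R]] by (intro exI[of _ "{}"]) simp

lemma ideal_gen_sum: "(\<And>x. x \<in> I \<Longrightarrow> f x \<in> ideal_gen R S) \<Longrightarrow> sum f I \<in> ideal_gen R S"
  by (induction I rule: infinite_finite_induct) (auto intro: ideal_gen_add ideal_gen_zero)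

lemma ideal_gen_mult:
  assumes "r \<in> R" "x \<in> ideal_gen R S"
  shows "r * x \<in> ideal_gen R S"
proof -
  note iff = in_ideal_gen_iff[OF subalgebra_zero[OF R]]
  obtain T g where "finite T" "T \<subseteq> S" "\<forall>t\<in>T. g t \<in> R" "x = (\<Sum>t\<in>T. g t * t)"
    using assms(2) unfolding iff by blast
  then show ?thesis unfolding iff using subalgebra_mult[OF R assms(1)]
    by (intro exI[of _ T] exI[of _ "\<lambda>t. r * g t"]) (simp add: sum_distrib_left mult.assoc)
qed

lemma ideal_gen_base: "s \<in> S \<Longrightarrow> s \<in> ideal_gen R S"
  unfolding in_ideal_gen_iff[OF subalgebra_zero[OF R]]
  by (intro exI[of _ "{s}"] exI[of _ "\<lambda>_. 1"]) (simp add: subalgebra_one[OF R])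

end

text \<open>Translates a family indexed by exponents into coefficients indexed by the basis elements
  themselves, which is possible since \<open>mon\<close> is injective.\<close>

lemma combos_mon_exist:
  assumes "finite E" "\<forall>e\<in>E. g e \<in> A" "0 \<in> A"
  shows "\<exists>c\<in>combos A (mon ` E). comb c = (\<Sum>e\<in>E. g e * mon e) \<and> (\<forall>e\<in>E. lookup c (mon e) = g e)"
proof -
  have inj: "inj_on mon E" using inj_mon inj_on_subset by blast
  have "\<exists>c\<in>combos A (mon ` E). comb c = (\<Sum>t\<in>mon ` E. g (the_inv_into E mon t) * t) \<and>
      (\<forall>t\<in>mon ` E. lookup c t = g (the_inv_into E mon t))"
    using assms by (intro combos_exist) (auto simp: the_inv_into_f_f[OF inj])
  then show ?thesis
    unfolding sum.reindex[OF inj] by (simp add: the_inv_into_f_f[OF inj])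
qed

lemma comb_mon: "finite E \<Longrightarrow> c \<in> combos A (mon ` E) \<Longrightarrow> comb c = (\<Sum>e\<in>E. lookup c (mon e) * mon e)"
  using sum.reindex[OF inj_on_subset[OF inj_mon subset_UNIV], of "\<lambda>t. lookup c t * t" E]
  by (simp add: comb_superset[of "mon ` E"] combos_def)

lemma combos_mon_eqI:
  assumes "c \<in> combos A (mon ` E)" "d \<in> combos A' (mon ` E)"
    "\<And>e. e \<in> E \<Longrightarrow> lookup c (mon e) = lookup d (mon e)"
  shows "c = d"
proof (rule poly_mapping_eqI)
  fix t
  show "lookup c t = lookup d t"
  proof (cases "t \<in> mon ` E")
    case False
    then have "t \<notin> keys c" "t \<notin> keys d" using assms(1,2) by (auto simp: combos_def)
    then show ?thesis by (simp add: in_keys_iff)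
  qed (use assms(3) in auto)
qed

lemma zero_in_range_Cst: "0 \<in> range Cst"
  using Cst_0 by (rule range_eqI[OF sym])

lemma free_over_indep:
  assumes ex1: "\<forall>p\<in>R. \<exists>!c. c \<in> combos A B \<and> p = comb c" and "0 \<in> R" "0 \<in> A"
    and T: "finite T" "T \<subseteq> B" "\<And>t. t \<in> T \<Longrightarrow> g t \<in> A" and z: "(\<Sum>t\<in>T. g t * t) = 0" and t: "t \<in> T"
  shows "g t = 0"
proof -
  have "\<exists>c\<in>combos A B. comb c = (\<Sum>t\<in>T. g t * t) \<and> (\<forall>t\<in>T. lookup c t = g t)"
    using assms by (intro combos_exist) auto
  then obtain c where c: "c \<in> combos A B" "comb c = 0" "\<forall>t\<in>T. lookup c t = g t"
    using z by auto
  have "0 \<in> combos A B" "comb 0 = 0"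
    using assms(3) by (auto simp: combos_def comb_def)
  then have "c = 0" using ex1 \<open>0 \<in> R\<close> c(1,2) by metis
  then show ?thesis using c(3) t by simp
qed

subsection \<open>Constant terms\<close>

text \<open>If \<open>t = e + g\<close> with \<open>e\<close> occurring in \<open>p\<close>,
  minimality of the degree of \<open>t\<close> forces \<open>g = 0\<close>. So in lowest degree a
  factor is only seen through its constant term.\<close>

lemma lookup_mult_lowest:
  fixes p q :: "'k::comm_ring_1 mpoly"
  assumes "\<And>e. e \<in> keys p \<Longrightarrow> wt UNIV t \<le> wt UNIV e"
  shows "lookup (p * q) t = lookup p t * lookup q 0"
proof (induction q rule: mpoly_induct)
  case (single g d)
  show ?case
  proof (cases "g = 0")
    case True
    then show ?thesis using lookup_Cst_mult[of d p t] by (simp add: Cst_def mult.commute)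
  next
    case False
    have "t \<notin> keys (p * single g d)"
    proof
      assume "t \<in> keys (p * single g d)"
      then obtain e where "e \<in> keys p" "t = e + g"
        using keys_mult[of p "single g d"] by (auto split: if_splits)
      then have "wt UNIV g = 0" using assms[of e] by (simp add: wt_add)
      then show False using False by (simp add: wt_eq_0_iff)
    qed
    then show ?thesis using False by (simp add: in_keys_iff lookup_single when_def)
  qed
qed (simp add: distrib_left lookup_add)

lemma lookup_mult_0: "lookup (p * q) 0 = lookup p 0 * lookup (q :: 'k::comm_ring_1 mpoly) 0"
  by (rule lookup_mult_lowest) simp

lemma lookup_positive_part: "t \<in> positive_part A \<Longrightarrow> lookup t 0 = 0"
  unfolding positive_part_def homogeneous_graded graded_def
  by (auto simp: in_keys_iff dest: bspec[of _ _ 0])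

section \<open>The graded Nakayama lemma\<close>

context
  fixes A :: "'k::comm_ring_1 mpoly set" and X :: "nat set"
  assumes A_poly: "homogeneous_polynomial_algebra A" and AX: "A \<subseteq> poly_ring X"
begin

lemma homogeneous_polynomial_algebra_subalgebra: "subalgebra A"
proof -
  obtain r f where "bij_betw (subst f) (poly_ring {..<r}) A"
    using A_poly by (auto simp: homogeneous_polynomial_algebra_def polynomial_generators_def)
  then have "A = subst f ` poly_ring {..<r}" by (simp add: bij_betw_def)
  then show ?thesis by (simp add: subalgebra_subst_image subalgebra_poly_ring)
qed

abbreviation "aug_ideal \<equiv> ideal_gen (poly_ring X) (positive_part A)"

text \<open>An element of \<open>A\<close> is a sum of monomials in the homogeneous generators. Each
  is homogeneous, hence a scalar in degree 0 and a member of \<open>positive_part A\<close>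
  otherwise.\<close>

lemma minus_constant_in_ideal:
  assumes "a \<in> A"
  shows "a - Cst (lookup a 0) \<in> aug_ideal"
proof -
  note [simp] = subalgebra_poly_ring[of X]
  obtain r f where f: "bij_betw (subst f) (poly_ring {..<r}) A" "\<forall>i<r. \<exists>d. homogeneous d (f i)"
    using A_poly by (auto simp: homogeneous_polynomial_algebra_def polynomial_generators_def)
  then obtain d where d: "\<forall>i<r. graded (wt UNIV) (d i) (f i)"
    unfolding homogeneous_graded by metis
  obtain p where "p \<in> poly_ring {..<r}" "a = subst f p" using assms f(1) by (auto simp: bij_betw_def)
  moreover have "subst f p - Cst (lookup (subst f p) 0) \<in> aug_ideal" if "p \<in> poly_ring {..<r}" for p
    using that
  proof (induction p rule: poly_ring_mon_induct)
    case (single e c)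
    let ?t = "subst f (single e c)"
    have "?t \<in> A"
      using f(1) single by (auto simp: bij_betw_def)
    have "graded (wt UNIV) (\<Sum>v\<in>keys e. \<Sum>i<lookup e v. d v) ?t"
      unfolding subst_single using d single
      by (intro graded_Cst_mult graded_prod graded_power additive_wt) auto
    then obtain D where D: "graded (wt UNIV) D ?t" by blast
    show ?case
    proof (cases "D = 0")
      case True
      have "lookup ?t e' = lookup (Cst (lookup ?t 0)) e'" for e'
        using D True
        by (cases "e' = 0") (auto simp: graded_def in_keys_iff wt_eq_0_iff Cst_def lookup_single when_def)
      then have "?t = Cst (lookup ?t 0)" by (rule poly_mapping_eqI)
      then show ?thesis using ideal_gen_zero[OF subalgebra_poly_ring] by simp
    next
      case False
      then have "?t \<in> positive_part A"
        using D \<open>?t \<in> A\<close> by (auto simp: positive_part_def homogeneous_graded)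
      then show ?thesis
        using lookup_positive_part[of ?t A] by (simp add: ideal_gen_base)
    qed
  next
    case (add p q)
    then show ?case
      using ideal_gen_add[OF subalgebra_poly_ring add]
      by (simp add: subst_add lookup_add Cst_add add_diff_add)
  qed
  ultimately show ?thesis by blast
qed

text \<open>Spanning: modulo the ideal \<open>p\<close> is a combination of the monomials, and the
  cofactors of positive elements have smaller degree. Independence: through a basis of the free
  module, a relation over \<open>A\<close> becomes a family of relations in \<open>A\<close>; their
  terms of lowest degree give a scalar relation modulo the ideal.\<close>

lemma block_basis_imp_free_basis:
  assumes free: "free_over A (poly_ring X)" and E: "finite E"
    and basis: "projects_to_basis (range Cst) (poly_ring X) aug_ideal (mon ` E)"
  shows "free_basis A (poly_ring X) E mon"
proof (rule free_basisI[OF E])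
  note A = homogeneous_polynomial_algebra_subalgebra
  have EX: "(mon e :: 'k mpoly) \<in> poly_ring X" if "e \<in> E" for e
    using basis that unfolding projects_to_basis_def by blast
  let ?span = "\<lambda>p. \<exists>a. (\<forall>i\<in>E. a i \<in> A) \<and> p = (\<Sum>i\<in>E. a i * mon i)"
  have span_add: "?span (p + q)" if pq: "?span p" "?span q" for p q
  proof -
    obtain a b where "\<forall>i\<in>E. a i \<in> A" "p = (\<Sum>i\<in>E. a i * mon i)"
      "\<forall>i\<in>E. b i \<in> A" "q = (\<Sum>i\<in>E. b i * mon i)" using pq by blast
    then show ?thesis using subalgebra_add[OF A]
      by (intro exI[of _ "\<lambda>i. a i + b i"]) (simp add: distrib_right sum.distrib)
  qed
  have span_mult: "?span (p * t)" if p: "?span p" and t: "t \<in> A" for p t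
  proof -
    obtain a where "\<forall>i\<in>E. a i \<in> A" "p = (\<Sum>i\<in>E. a i * mon i)" using p by blast
    then show ?thesis using subalgebra_mult[OF A t]
      by (intro exI[of _ "\<lambda>i. t * a i"]) (simp add: sum_distrib_left mult.assoc mult.commute[of _ t])
  qed
  have span_0: "?span 0" by (intro exI[of _ "\<lambda>_. 0"]) (simp add: subalgebra_zero[OF A])
  have span_sum: "?span (\<Sum>x\<in>S. h x)" if "\<And>x. x \<in> S \<Longrightarrow> ?span (h x)" for S h
    using that
  proof (induction S rule: infinite_finite_induct)
    case (insert x S)
    then have "?span (h x)" "?span (\<Sum>x\<in>S. h x)" by blast+
    then have "?span (h x + (\<Sum>x\<in>S. h x))" by (rule span_add)
    then show ?case using insert.hyps by simp
  next
    case (infinite S)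
    show ?case unfolding sum.infinite[OF infinite(1)] by (rule span_0)
  qed (simp only: sum.empty span_0)
  have span_mon: "?span (Cst c * mon e)" if "e \<in> E" for c e
    using that E subalgebra_Cst[OF A] subalgebra_zero[OF A]
    by (intro exI[of _ "\<lambda>i. if i = e then Cst c else 0"])
      (auto simp: if_distrib[of "\<lambda>x. x * _"] sum.delta cong: if_cong)
  have "?span p" if "p \<in> poly_ring X" "\<forall>e\<in>keys p. wt UNIV e < N" for p N
    using that
  proof (induction N arbitrary: p)
    case 0
    then have "p = 0" by (auto intro: ccontr)
    then show ?case using span_0 by simp
  next
    case (Suc N)
    obtain c where c: "c \<in> combos (range Cst) (mon ` E)" "p - comb c \<in> aug_ideal"
      using basis Suc.prems(1) by (auto simp: projects_to_basis_def)
    obtain T g where T: "finite T" "T \<subseteq> positive_part A" "\<forall>t\<in>T. g t \<in> poly_ring X"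
      "p - comb c = (\<Sum>t\<in>T. g t * t)"
      using c(2) unfolding in_ideal_gen_iff[OF zero_in_poly_ring] by blast
    \<comment> \<open>The summands may contain high degrees that cancel in \<open>p\<close>.
      Truncating both sides leaves \<open>p\<close> unchanged and bounds every summand.\<close>
    let ?P = "part (\<lambda>e. wt UNIV e < Suc N)"
    have "?P p = p" using Suc.prems(2) by (intro part_all) auto
    moreover have "p = comb c + (\<Sum>t\<in>T. g t * t)" using T(4) by (simp add: algebra_simps)
    ultimately have "p = ?P (comb c + (\<Sum>t\<in>T. g t * t))" by simp
    then have eq: "p = (\<Sum>e\<in>E. ?P (lookup c (mon e) * mon e)) + (\<Sum>t\<in>T. ?P (g t * t))"
      by (simp add: part_add part_sum comb_mon[OF E c(1)])
    have s1: "?span (?P (lookup c (mon e) * mon e))" if e: "e \<in> E" for e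
    proof -
      obtain l where l: "lookup c (mon e) = Cst l" using lookup_combos[OF c(1)] by blast
      show ?thesis
      proof (cases "wt UNIV e < Suc N")
        case True
        then have "?P (lookup c (mon e) * mon e) = Cst l * mon e"
          unfolding l Cst_mult_mon by (intro part_all) (simp split: if_splits)
        then show ?thesis using span_mon[OF e, of l] by (simp only:)
      next
        case False
        then have "?P (lookup c (mon e) * mon e) = 0"
          unfolding l Cst_mult_mon by (intro part_none) (simp split: if_splits)
        then show ?thesis using span_0 by (simp only:)
      qed
    qed
    have s2: "?span (?P (g t * t))" if t: "t \<in> T" for t
    proof -
      obtain d where d: "d > 0" "graded (wt UNIV) d t" "t \<in> A"
        using t T(2) by (auto simp: positive_part_def homogeneous_graded)
      \<comment> \<open>Since \<open>t\<close> has degree \<open>d > 0\<close>, truncating the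
        product below \<open>Suc N\<close> truncates the cofactor below \<open>N\<close>, where the
        induction hypothesis applies.\<close>
      let ?g = "part (\<lambda>e. wt UNIV e + d < Suc N) (g t)"
      have "?g \<in> poly_ring X" using T(3) t by blast
      moreover have "\<forall>e\<in>keys ?g. wt UNIV e < N" using d(1) by (auto simp: keys_part)
      ultimately have "?span (?g * t)" using Suc.IH d(3) span_mult by blast
      then show ?thesis using part_graded_mult[OF additive_wt d(2), of "\<lambda>n. n < Suc N" "g t"] by simp
    qed
    have "?span ((\<Sum>e\<in>E. ?P (lookup c (mon e) * mon e)) + (\<Sum>t\<in>T. ?P (g t * t)))"
      by (rule span_add[OF span_sum[OF s1] span_sum[OF s2]])
    then show ?case unfolding eq[symmetric] .
  qed
  then show "?span p" if "p \<in> poly_ring X" for p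
    using that finite_nat_set_iff_bounded[of "wt UNIV ` keys p"] by auto
  show "a i = 0" if a: "\<And>i. i \<in> E \<Longrightarrow> a i \<in> A" and z: "(\<Sum>i\<in>E. a i * mon i) = 0" and i: "i \<in> E" for a i
  proof (rule ccontr)
    assume "a i \<noteq> 0"
    let ?K = "\<Union>i\<in>E. keys (a i)"
    obtain s where "s \<in> keys (a i)" using \<open>a i \<noteq> 0\<close> keys_eq_empty by blast
    then have "s \<in> ?K" using i by blast
    \<comment> \<open>A monomial of least degree among all those occurring in the coefficients
      \<open>a i\<close>; at \<open>t\<close> only the constant terms of the matrix \<open>M\<close>
      matter.\<close>
    then obtain t where t: "t \<in> ?K" "\<And>e. e \<in> ?K \<Longrightarrow> wt UNIV t \<le> wt UNIV e"
      using ex_has_least_nat[of "\<lambda>t. t \<in> ?K" s "wt UNIV"] by blast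
    obtain B where B: "B \<subseteq> poly_ring X" "\<forall>p\<in>poly_ring X. \<exists>!c. c \<in> combos A B \<and> p = comb c"
      using free by (auto simp: free_over_def)
    have "\<forall>i\<in>E. \<exists>c. c \<in> combos A B \<and> mon i = comb c" using B(2) EX by blast
    then obtain c where c: "\<forall>i\<in>E. c i \<in> combos A B \<and> mon i = comb (c i)" by metis
    define T where "T = (\<Union>i\<in>E. keys (c i))"
    have T: "finite T" "T \<subseteq> B" using E c by (auto simp: T_def combos_def)
    define M where "M i b = lookup (c i) b" for i b
    have M: "M i b \<in> A" if "i \<in> E" for i b using c that by (auto simp: combos_def M_def)
    have mon: "mon i = (\<Sum>b\<in>T. M i b * b)" if "i \<in> E" for i
      using c that comb_superset[OF T(1), of "c i"] unfolding T_def M_def by auto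
    have expand: "(\<Sum>i\<in>E. h i * mon i) = (\<Sum>b\<in>T. (\<Sum>i\<in>E. h i * M i b) * b)" for h
    proof -
      have "(\<Sum>i\<in>E. h i * mon i) = (\<Sum>i\<in>E. \<Sum>b\<in>T. h i * M i b * b)"
        by (intro sum.cong) (simp_all add: mon sum_distrib_left mult.assoc)
      also have "\<dots> = (\<Sum>b\<in>T. \<Sum>i\<in>E. h i * M i b * b)" by (rule sum.swap)
      finally show ?thesis by (simp add: sum_distrib_right)
    qed
    have "(\<Sum>i\<in>E. a i * M i b) = 0" if b: "b \<in> T" for b
    proof (rule free_over_indep[OF B(2) _ subalgebra_zero[OF A] T _ _ b])
      show "(\<Sum>i\<in>E. a i * M i b) \<in> A" for b
        using a M by (intro subalgebra_sum[OF A] subalgebra_mult[OF A])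
      show "(\<Sum>b\<in>T. (\<Sum>i\<in>E. a i * M i b) * b) = 0" using z expand by simp
    qed simp
    then have "(\<Sum>i\<in>E. lookup (a i) t * lookup (M i b) 0) = 0" if "b \<in> T" for b
    proof -
      have "lookup (a i * M i b) t = lookup (a i) t * lookup (M i b) 0" if "i \<in> E" for i
        using that t(2) by (intro lookup_mult_lowest) blast
      then have "(\<Sum>i\<in>E. lookup (a i) t * lookup (M i b) 0) = lookup (\<Sum>i\<in>E. a i * M i b) t"
        by (simp add: lookup_sum)
      then show ?thesis using \<open>\<And>b. b \<in> T \<Longrightarrow> (\<Sum>i\<in>E. a i * M i b) = 0\<close>[OF that] by simp
    qed
    then have const: "lookup (\<Sum>i\<in>E. Cst (lookup (a i) t) * M i b) 0 = 0" if "b \<in> T" for b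
      using that by (simp add: lookup_sum lookup_Cst_mult)
    \<comment> \<open>The coordinates of this scalar combination in the basis \<open>B\<close> are
      elements of \<open>A\<close> with constant term 0, hence in the ideal.\<close>
    have "(\<Sum>i\<in>E. Cst (lookup (a i) t) * mon i) \<in> aug_ideal"
      unfolding expand
    proof (rule ideal_gen_sum[OF subalgebra_poly_ring])
      fix b assume b: "b \<in> T"
      let ?z = "\<Sum>i\<in>E. Cst (lookup (a i) t) * M i b"
      have "?z \<in> A" using M by (intro subalgebra_sum[OF A] subalgebra_mult[OF A] subalgebra_Cst[OF A])
      then have "?z \<in> aug_ideal" using minus_constant_in_ideal[of ?z] const[OF b] by simp
      then have "b * ?z \<in> aug_ideal" using ideal_gen_mult[OF subalgebra_poly_ring] b T(2) B(1) by blast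
      then show "?z * b \<in> aug_ideal" by (simp add: mult.commute)
    qed
    moreover have "\<exists>d\<in>combos (range Cst) (mon ` E). comb d = (\<Sum>i\<in>E. Cst (lookup (a i) t) * mon i) \<and>
        (\<forall>i\<in>E. lookup d (mon i) = Cst (lookup (a i) t))"
      by (intro combos_mon_exist E zero_in_range_Cst) simp
    then obtain d where d: "d \<in> combos (range Cst) (mon ` E)"
      "comb d = (\<Sum>i\<in>E. Cst (lookup (a i) t) * mon i)"
      "\<forall>i\<in>E. lookup d (mon i) = Cst (lookup (a i) t)" by blast
    ultimately have "d = 0" using basis by (auto simp: projects_to_basis_def)
    then have "lookup (a i) t = 0" if "i \<in> E" for i
      using bspec[OF d(3) that] by simp
    then show False using t(1) by (auto simp: in_keys_iff)
  qed
qed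

text \<open>Modulo the ideal each coefficient in \<open>A\<close> becomes its constant term, which
  gives spanning over the field. If a scalar combination lies in the ideal, expanding the cofactors
  over \<open>A\<close> shows that each scalar equals an element with constant term 0.\<close>

lemma free_basis_imp_block_basis:
  assumes fb: "free_basis A (poly_ring X) (below e0) mon" and e0: "keys e0 \<subseteq> X"
  shows "generates_block_basis X A (mon e0)"
proof -
  note A = homogeneous_polynomial_algebra_subalgebra
  let ?E = "below e0" and ?B = "mon ` below e0 :: 'k mpoly set"
  have BX: "?B \<subseteq> poly_ring X" using keys_below e0 by fastforce
  have free: "free_over A (poly_ring X)"
    unfolding free_over_def
  proof (intro exI[of _ ?B] conjI ballI BX)
    fix p :: "'k mpoly" assume "p \<in> poly_ring X"
    then obtain a where a: "\<And>i. i \<in> ?E \<Longrightarrow> a i \<in> A" "p = (\<Sum>i\<in>?E. a i * mon i)"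
      using free_basis_span[OF fb] by blast
    have "\<exists>c\<in>combos A ?B. comb c = (\<Sum>i\<in>?E. a i * mon i) \<and> (\<forall>e\<in>?E. lookup c (mon e) = a e)"
      using a(1) by (intro combos_mon_exist finite_below subalgebra_zero[OF A]) simp
    then obtain c where c: "c \<in> combos A ?B" "comb c = p" using a(2) by auto
    show "\<exists>!c. c \<in> combos A ?B \<and> p = comb c"
    proof (rule ex1I[of _ c])
      show "c \<in> combos A ?B \<and> p = comb c" using c by simp
      fix d assume d: "d \<in> combos A ?B \<and> p = comb d"
      show "d = c"
      proof (rule combos_mon_eqI)
        fix e assume e: "e \<in> ?E"
        have "lookup d (mon e) - lookup c (mon e) = 0"
        proof (rule free_basis_indep[OF fb _ _ e])
          show "lookup d (mon e) - lookup c (mon e) \<in> A" for e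
            using d c by (intro subalgebra_diff[OF A]) (auto simp: combos_def)
          have "comb d = comb c" using d c by simp
          then have "(\<Sum>i\<in>?E. lookup d (mon i) * mon i) = (\<Sum>i\<in>?E. lookup c (mon i) * mon i)"
            using comb_mon[OF finite_below conjunct1[OF d]] comb_mon[OF finite_below c(1)] by simp
          then show "(\<Sum>i\<in>?E. (lookup d (mon i) - lookup c (mon i)) * mon i) = 0"
            by (simp add: left_diff_distrib sum_subtractf)
        qed
        then show "lookup d (mon e) = lookup c (mon e)" by simp
      qed (use d c in blast)+
    qed
  qed
  have "projects_to_basis (range Cst) (poly_ring X) aug_ideal ?B"
    unfolding projects_to_basis_def
  proof (intro conjI BX ballI impI)
    fix p :: "'k mpoly" assume "p \<in> poly_ring X"
    then obtain a where a: "\<And>i. i \<in> ?E \<Longrightarrow> a i \<in> A" "p = (\<Sum>i\<in>?E. a i * mon i)"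
      using free_basis_span[OF fb] by blast
    have "\<exists>c\<in>combos (range Cst) ?B. comb c = (\<Sum>i\<in>?E. Cst (lookup (a i) 0) * mon i) \<and>
        (\<forall>e\<in>?E. lookup c (mon e) = Cst (lookup (a e) 0))"
      by (intro combos_mon_exist finite_below zero_in_range_Cst) simp
    then obtain c where c: "c \<in> combos (range Cst) ?B" "comb c = (\<Sum>i\<in>?E. Cst (lookup (a i) 0) * mon i)"
      by blast
    have "p - comb c = (\<Sum>i\<in>?E. mon i * (a i - Cst (lookup (a i) 0)))"
      unfolding a(2) c(2) by (simp add: sum_subtractf algebra_simps)
    also have "\<dots> \<in> aug_ideal"
      using BX a(1)
      by (intro ideal_gen_sum[OF subalgebra_poly_ring] ideal_gen_mult[OF subalgebra_poly_ring]
          minus_constant_in_ideal) auto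
    finally show "\<exists>c\<in>combos (range Cst) ?B. p - comb c \<in> aug_ideal" using c(1) by blast
  next
    fix c :: "'k mpoly \<Rightarrow>\<^sub>0 'k mpoly"
    assume c: "c \<in> combos (range Cst) ?B" and "comb c \<in> aug_ideal"
    then obtain T g where T: "finite T" "T \<subseteq> positive_part A" "\<forall>t\<in>T. g t \<in> poly_ring X"
      "comb c = (\<Sum>t\<in>T. g t * t)"
      unfolding in_ideal_gen_iff[OF zero_in_poly_ring] by blast
    have "\<forall>t\<in>T. \<exists>h. (\<forall>i\<in>?E. h i \<in> A) \<and> g t = (\<Sum>i\<in>?E. h i * mon i)"
      using T(3) fb unfolding free_basis_def by blast
    then obtain h where h: "\<forall>t\<in>T. (\<forall>i\<in>?E. h t i \<in> A) \<and> g t = (\<Sum>i\<in>?E. h t i * mon i)" by metis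
    have "comb c = (\<Sum>t\<in>T. \<Sum>i\<in>?E. h t i * t * mon i)"
      unfolding T(4) using h by (intro sum.cong) (auto simp: sum_distrib_left sum_distrib_right algebra_simps)
    also have "\<dots> = (\<Sum>i\<in>?E. (\<Sum>t\<in>T. h t i * t) * mon i)"
      by (subst sum.swap) (simp add: sum_distrib_right)
    finally have z: "(\<Sum>i\<in>?E. (lookup c (mon i) - (\<Sum>t\<in>T. h t i * t)) * mon i) = 0"
      using c by (simp add: comb_mon[OF finite_below] left_diff_distrib sum_subtractf)
    have "lookup c (mon e) = 0" if e: "e \<in> ?E" for e
    proof -
      have "lookup c (mon e) - (\<Sum>t\<in>T. h t e * t) = 0"
      proof (rule free_basis_indep[OF fb _ z e])
        fix i assume i: "i \<in> ?E"
        obtain l where "lookup c (mon i) = Cst l" using lookup_combos[OF c] by blast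
        then have "lookup c (mon i) \<in> A" using subalgebra_Cst[OF A] by simp
        moreover have "t \<in> A" if "t \<in> T" for t using that T(2) by (auto simp: positive_part_def)
        ultimately show "lookup c (mon i) - (\<Sum>t\<in>T. h t i * t) \<in> A"
          using h i by (intro subalgebra_diff[OF A] subalgebra_sum[OF A] subalgebra_mult[OF A]) auto
      qed
      then have eq: "lookup c (mon e) = (\<Sum>t\<in>T. h t e * t)" by simp
      have "lookup t 0 = 0" if "t \<in> T" for t
        using lookup_positive_part[of t A] that T(2) by blast
      then have "lookup (\<Sum>t\<in>T. h t e * t) 0 = 0" by (simp add: lookup_sum lookup_mult_0)
      moreover obtain l where l: "lookup c (mon e) = Cst l" using lookup_combos[OF c] by blast
      ultimately have "l = 0" unfolding eq[symmetric] by (simp add: Cst_def)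
      then show ?thesis using l by simp
    qed
    then show "c = 0"
      using c by (intro combos_mon_eqI[OF c, of 0 "{0}"]) (auto simp: combos_def)
  qed
  then show ?thesis
    using A_poly AX free e0
    by (auto simp: generates_block_basis_def monic_monomial_def monomial_factors_mon)
qed

end

lemma generates_block_basisD:
  assumes "generates_block_basis X A (mon e0)"
  shows "homogeneous_polynomial_algebra A" "A \<subseteq> poly_ring X" "keys e0 \<subseteq> X"
    "free_basis A (poly_ring X) (below e0) mon"
  using assms block_basis_imp_free_basis[of A X "below e0"] finite_below
  by (auto simp: generates_block_basis_def monomial_factors_mon poly_ring_iff)

section \<open>Additive polynomials over a finite field\<close>

lemma finite_field_power_card:
  fixes a :: "'k::{field,finite}"
  shows "a ^ card (UNIV :: 'k set) = a"
proof (cases "a = 0")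
  case False
  let ?U = "- {0} :: 'k set"
  have "(\<Prod>x\<in>?U. a * x) = (\<Prod>x\<in>?U. x)"
    by (rule prod.reindex_bij_witness[of _ "\<lambda>x. x / a" "\<lambda>x. a * x"]) (use False in auto)
  then have "a ^ card ?U * \<Prod>?U = \<Prod>?U" by (simp add: prod.distrib)
  then have "a ^ card ?U = 1" by simp
  moreover have "card (UNIV :: 'k set) = Suc (card ?U)"
    using card_Diff_singleton[of 0 "UNIV :: 'k set"] by (simp add: Compl_eq_Diff_UNIV card_gt_0_iff)
  ultimately show ?thesis by simp
qed (simp add: card_gt_0_iff)

lemma finite_field_power_card_power:
  fixes a :: "'k::{field,finite}"
  shows "a ^ (card (UNIV :: 'k set) ^ m) = a"
  by (induction m) (simp_all add: power_mult finite_field_power_card)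

section \<open>Linear forms in the first \<open>m\<close> variables and their subspace
  polynomial\<close>

definition linear_form :: "nat \<Rightarrow> (nat \<Rightarrow> 'k::comm_ring_1) \<Rightarrow> 'k mpoly"
  where "linear_form m c = (\<Sum>i<m. Cst (c i) * Var i)"

abbreviation linear_forms :: "nat \<Rightarrow> 'k::comm_ring_1 mpoly set"
  where "linear_forms m \<equiv> range (linear_form m)"

lemma lookup_linear_form: "i < m \<Longrightarrow> lookup (linear_form m c) (single i 1) = c i"
proof -
  assume i: "i < m"
  have "single j 1 = single i (1::nat) \<longleftrightarrow> j = i" for j
    by (metis lookup_single_eq lookup_single_not_eq one_neq_zero)
  then have "lookup (linear_form m c) (single i 1) = (\<Sum>j<m. if j = i then c j else 0)"
    by (simp add: linear_form_def lookup_sum lookup_Cst_mult Var_def lookup_single when_def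
        if_distrib[of "\<lambda>x. _ * x"] cong: if_cong)
  then show ?thesis using i by simp
qed

lemma linear_form_add: "linear_form m c + linear_form m d = linear_form m (\<lambda>i. c i + d i)"
  by (simp add: linear_form_def Cst_add distrib_right sum.distrib)

lemma linear_form_Cst_mult: "Cst a * linear_form m c = linear_form m (\<lambda>i. a * c i)"
  by (simp add: linear_form_def Cst_mult sum_distrib_left mult.assoc)

lemma linear_forms_add: "u \<in> linear_forms m \<Longrightarrow> w \<in> linear_forms m \<Longrightarrow> u + w \<in> linear_forms m"
  by (auto simp: linear_form_add)

lemma linear_forms_Cst_mult: "u \<in> linear_forms m \<Longrightarrow> Cst a * u \<in> linear_forms m"
  by (auto simp: linear_form_Cst_mult)

lemma linear_forms_uminus: "u \<in> linear_forms m \<Longrightarrow> - u \<in> linear_forms m"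
  using linear_forms_Cst_mult[of u m "- 1"] by (simp add: Cst_uminus)

lemma linear_forms_zero: "0 \<in> linear_forms m"
  by (rule image_eqI[of _ _ "\<lambda>_. 0"]) (simp_all add: linear_form_def)

lemma linear_forms_poly_ring: "u \<in> linear_forms m \<Longrightarrow> u \<in> poly_ring {0..<m}"
  by (auto simp: linear_form_def intro!: sum_in_poly_ring mult_in_poly_ring Var_in_poly_ring)

lemma linear_forms_graded: "u \<in> linear_forms m \<Longrightarrow> graded (wt UNIV) 1 u"
  by (auto simp: linear_form_def graded_def Var_def wt_single
      intro!: graded_sum[unfolded graded_def] graded_Cst_mult[OF additive_wt, unfolded graded_def])

context
  fixes type_k :: "'k::{field,finite} itself"
begin

lemma card_linear_forms: "card (linear_forms m :: 'k mpoly set) = card (UNIV :: 'k set) ^ m"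
  and finite_linear_forms: "finite (linear_forms m :: 'k mpoly set)"
proof -
  let ?P = "{..<m} \<rightarrow>\<^sub>E (UNIV :: 'k set)"
  have eq: "linear_form m (restrict c {..<m}) = linear_form m c" for c :: "nat \<Rightarrow> 'k"
    unfolding linear_form_def by (intro sum.cong) auto
  have "linear_forms m = (linear_form m ` ?P :: 'k mpoly set)"
  proof (intro equalityI subsetI)
    fix u :: "'k mpoly" assume "u \<in> linear_forms m"
    then obtain c where "u = linear_form m c" by blast
    then have "u = linear_form m (restrict c {..<m})" using eq by simp
    moreover have "restrict c {..<m} \<in> ?P" by auto
    ultimately show "u \<in> linear_form m ` ?P" by blast
  qed auto
  moreover have "inj_on (linear_form m) ?P"
  proof (rule inj_onI)
    fix c d assume cd: "c \<in> ?P" "d \<in> ?P" "linear_form m c = linear_form m d"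
    have "c i = d i" if "i < m" for i
      using lookup_linear_form[OF that, of c] lookup_linear_form[OF that, of d] cd(3) by simp
    then show "c = d" using cd(1,2) by (intro PiE_ext) auto
  qed
  moreover have "finite ?P" by (intro finite_PiE) auto
  ultimately show "card (linear_forms m :: 'k mpoly set) = card (UNIV :: 'k set) ^ m"
    "finite (linear_forms m :: 'k mpoly set)"
    by (simp_all add: card_image card_PiE)
qed

text \<open>The polynomial F of the overview, known as the subspace polynomial of the space of
  linear forms. Its coefficients in \<open>z\<close> are, up to sign, the Dickson
  invariants.\<close>

definition additive_poly :: "nat \<Rightarrow> 'k mpoly \<Rightarrow> 'k mpoly"
  where "additive_poly m z = (\<Prod>u\<in>linear_forms m. z + u)"

lemma additive_poly_shift:
  assumes "w \<in> linear_forms m"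
  shows "additive_poly m (z + w) = additive_poly m z"
  unfolding additive_poly_def
  by (rule prod.reindex_bij_witness[of _ "\<lambda>u. u - w" "\<lambda>u. w + u"])
    (use assms linear_forms_add[OF _ linear_forms_uminus[OF assms]] in
      \<open>auto simp: add.assoc intro: linear_forms_add\<close>)

lemma additive_poly_linear_form: "w \<in> linear_forms m \<Longrightarrow> additive_poly m w = 0"
  unfolding additive_poly_def using linear_forms_uminus[of w m]
  by (intro prod_zero finite_linear_forms bexI[of _ "- w"]) auto

text \<open>
  As polynomials in \<^term>\<open>z\<close> both sides have leading term \<^term>\<open>z ^ card (linear_forms m)\<close>, and
  they agree for every linear form \<^term>\<open>z\<close>.
\<close>

lemma additive_poly_add: "additive_poly m (z + w) = additive_poly m z + additive_poly m w"
proof -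
  let ?L = "linear_forms m :: 'k mpoly set"
  have deg: "degree (\<Prod>u\<in>?L. [:a u, 1:]) = card ?L" for a :: "'k mpoly \<Rightarrow> 'k mpoly"
    by (subst degree_prod_sum_eq) auto
  have lead: "coeff (\<Prod>u\<in>?L. [:a u, 1:]) (card ?L) = 1" for a :: "'k mpoly \<Rightarrow> 'k mpoly"
    using lead_coeff_prod[of "\<lambda>u. [:a u, 1:]" ?L] unfolding deg by simp
  have pos: "card ?L \<noteq> 0" using linear_forms_zero finite_linear_forms by (auto simp: card_gt_0_iff)
  have "(\<Prod>u\<in>?L. [:w + u, 1:]) = (\<Prod>u\<in>?L. [:u, 1:]) + [:additive_poly m w:]"
  proof (rule poly_eqI_degree_lead_coeff[where A = ?L and n = "card ?L"])
    show "coeff (\<Prod>u\<in>?L. [:w + u, 1:]) (card ?L)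
        = coeff ((\<Prod>u\<in>?L. [:u, 1:]) + [:additive_poly m w:]) (card ?L)"
      using pos by (simp add: lead coeff_eq_0)
    show "degree ((\<Prod>u\<in>?L. [:u, 1:]) + [:additive_poly m w:]) \<le> card ?L"
      by (rule degree_add_le) (simp_all add: deg)
    fix x assume x: "x \<in> ?L"
    have "poly (\<Prod>u\<in>?L. [:w + u, 1:]) x = additive_poly m (w + x)"
      unfolding poly_prod additive_poly_def by (intro prod.cong) (auto simp: algebra_simps)
    moreover have "poly (\<Prod>u\<in>?L. [:u, 1:]) x = additive_poly m x"
      unfolding poly_prod additive_poly_def by (intro prod.cong) (auto simp: algebra_simps)
    ultimately show "poly (\<Prod>u\<in>?L. [:w + u, 1:]) x = poly ((\<Prod>u\<in>?L. [:u, 1:]) + [:additive_poly m w:]) x"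
      by (simp add: additive_poly_shift[OF x] additive_poly_linear_form[OF x])
  qed (simp_all add: deg)
  then have "poly (\<Prod>u\<in>?L. [:w + u, 1:]) z = poly (\<Prod>u\<in>?L. [:u, 1:]) z + additive_poly m w" by simp
  moreover have "poly (\<Prod>u\<in>?L. [:w + u, 1:]) z = additive_poly m (z + w)"
    unfolding poly_prod additive_poly_def by (intro prod.cong) (auto simp: algebra_simps)
  moreover have "poly (\<Prod>u\<in>?L. [:u, 1:]) z = additive_poly m z"
    unfolding poly_prod additive_poly_def by (intro prod.cong) (auto simp: algebra_simps)
  ultimately show ?thesis by simp
qed

text \<open>For nonzero \<open>a\<close> the substitution \<open>u \<mapsto> a u\<close> permutes
  the linear forms, so \<open>a\<close> can be drawn out of each of the \<open>q ^ m\<close>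
  factors; over the field with \<open>q\<close> elements \<open>a ^ (q ^ m) = a\<close>.\<close>

lemma additive_poly_Cst_mult: "additive_poly m (Cst a * z) = Cst a * additive_poly m z"
proof (cases "a = 0")
  case True
  then show ?thesis using additive_poly_linear_form[OF linear_forms_zero] by simp
next
  case False
  have inv: "Cst a * (Cst (1 / a) * u) = u" "Cst (1 / a) * (Cst a * u) = u" for u :: "'k mpoly"
    using False by (simp_all add: mult.assoc[symmetric] Cst_mult[symmetric])
  have "additive_poly m (Cst a * z) = (\<Prod>u\<in>linear_forms m. Cst a * (z + u))"
    unfolding additive_poly_def
    by (rule prod.reindex_bij_witness[of _ "\<lambda>u. Cst a * u" "\<lambda>u. Cst (1 / a) * u"])
      (auto simp: inv distrib_left intro: linear_forms_Cst_mult)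
  also have "\<dots> = Cst (a ^ (card (UNIV :: 'k set) ^ m)) * additive_poly m z"
    by (simp add: prod.distrib Cst_power card_linear_forms additive_poly_def)
  finally show ?thesis by (simp add: finite_field_power_card_power)
qed

lemma additive_poly_sum:
  "additive_poly m (\<Sum>i\<in>I. Cst (c i) * z i) = (\<Sum>i\<in>I. Cst (c i) * additive_poly m (z i))"
  using additive_poly_linear_form[OF linear_forms_zero]
  by (induction I rule: infinite_finite_induct) (simp_all add: additive_poly_add additive_poly_Cst_mult)

lemma subst_additive_poly:
  assumes "bij_betw (subst \<tau>) (linear_forms m) (linear_forms m)"
  shows "subst \<tau> (additive_poly m z) = additive_poly m (subst \<tau> z)"
  unfolding additive_poly_def subst_prod
  using prod.reindex_bij_betw[OF assms, of "\<lambda>u. subst \<tau> z + u"] by (simp add: subst_add)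

lemma additive_poly_in_poly_ring: "{0..<m} \<subseteq> X \<Longrightarrow> z \<in> poly_ring X \<Longrightarrow> additive_poly m z \<in> poly_ring X"
  unfolding additive_poly_def
  using linear_forms_poly_ring poly_ring_mono by (intro prod_in_poly_ring add_in_poly_ring) blast+

lemma additive_poly_graded:
  assumes "graded (wt UNIV) 1 z"
  shows "graded (wt UNIV) (card (UNIV :: 'k set) ^ m) (additive_poly m z)"
  using graded_prod[OF additive_wt, of "linear_forms m" UNIV "\<lambda>_. 1" "\<lambda>u. z + u"]
    graded_add[OF assms linear_forms_graded]
  by (simp add: additive_poly_def card_linear_forms)

text \<open>Each factor \<open>Var v + u\<close> has leading part \<open>Var v\<close>, as
  \<open>u\<close> involves no variable of \<open>B\<close>; leading parts are
  multiplicative.\<close>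

lemma leads_additive_poly:
  assumes "v \<in> B" "B \<inter> {0..<m} = {}"
  shows "leads B (card (UNIV :: 'k set) ^ m) (additive_poly m (Var v)) (Var v ^ (card (UNIV :: 'k set) ^ m))"
proof -
  have "leads B 1 (Var v + u) (Var v)" if "u \<in> linear_forms m" for u :: "'k mpoly"
  proof -
    have "wt B e = 0" if "e \<in> keys u" for e
    proof -
      have "keys e \<inter> B = {}"
        using linear_forms_poly_ring[OF \<open>u \<in> linear_forms m\<close>] that assms(2)
        by (auto simp: poly_ring_iff)
      then show ?thesis by (simp add: wt_def)
    qed
    then have "low B 1 u" by (simp add: low_def)
    moreover have "graded (wt B) 1 (Var v :: 'k mpoly)"
      using assms(1) by (simp add: graded_def Var_def wt_single)
    ultimately show ?thesis by (simp add: leads_def)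
  qed
  then have "leads B (\<Sum>u\<in>(linear_forms m :: 'k mpoly set). 1) (additive_poly m (Var v)) (\<Prod>u\<in>(linear_forms m :: 'k mpoly set). Var v)"
    unfolding additive_poly_def by (intro leads_prod) blast
  then show ?thesis by (simp add: card_linear_forms)
qed

end

section \<open>Adjoining a block\<close>

context
  fixes q m d :: nat
  assumes q: "q = card (UNIV :: 'k::{field,finite} set)"
begin

abbreviation (input) "old_vars \<equiv> {0..<m}"
abbreviation (input) "new_vars \<equiv> {m..<m + d}"
abbreviation (input) "all_vars \<equiv> {0..<m + d}"
abbreviation (input) "orbit_size \<equiv> q ^ m"

lemma orbit_size_pos: "0 < orbit_size"
  by (simp add: q card_gt_0_iff)

lemma disjoint_vars: "old_vars \<inter> new_vars = {}" "new_vars \<inter> old_vars = {}"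
  by auto

text \<open>The substitution \<open>\<Phi>\<close> of the overview. For a new variable, the factors
  of F(x_v) form the orbit of x_v under the translations by linear forms in the old
  variables.\<close>

definition orbit_product :: "nat \<Rightarrow> 'k mpoly"
  where "orbit_product v = (if v \<in> new_vars then additive_poly m (Var v) else Var v)"

lemma orbit_product_out: "v \<notin> new_vars \<Longrightarrow> orbit_product v = Var v"
  and orbit_product_in: "v \<in> new_vars \<Longrightarrow> orbit_product v = additive_poly m (Var v)"
  by (auto simp: orbit_product_def)

lemma leads_orbit_product:
  assumes "v \<in> new_vars"
  shows "leads new_vars orbit_size (orbit_product v) (Var v ^ orbit_size)"
  using leads_additive_poly[OF assms disjoint_vars(2)] assms by (simp add: orbit_product_def q)

lemma orbit_product_in_poly_ring: "v \<in> new_vars \<Longrightarrow> orbit_product v \<in> poly_ring all_vars"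
  by (auto simp: orbit_product_def intro!: additive_poly_in_poly_ring Var_in_poly_ring)

lemma new_vars_subset: "finite new_vars" "new_vars \<subseteq> all_vars"
  by auto

lemma free_basis_orbit_product:
  assumes "subalgebra C" "C \<subseteq> poly_ring all_vars"
    and "\<And>p R. p \<in> C \<Longrightarrow> part (\<lambda>e. R (wt new_vars e)) p \<in> C"
    and "\<And>e. e \<in> E \<Longrightarrow> keys e \<subseteq> all_vars" and "free_basis C (poly_ring all_vars) E mon"
  shows "free_basis (subst orbit_product ` C) (poly_ring all_vars) (E \<times> box new_vars orbit_size)
    (\<lambda>(b, g). mon (stretch new_vars orbit_size b + g))"
  by (rule free_basis_deform[OF new_vars_subset orbit_size_pos orbit_product_out leads_orbit_product
      orbit_product_in_poly_ring]) (use assms in blast)+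

lemma inj_orbit_product: "inj (subst orbit_product)"
  by (rule inj_subst_deformation[OF new_vars_subset orbit_size_pos orbit_product_out
      leads_orbit_product orbit_product_in_poly_ring])

lemma subst_orbit_product_in_poly_ring: "p \<in> poly_ring all_vars \<Longrightarrow> subst orbit_product p \<in> poly_ring all_vars"
  by (erule subst_in_poly_ring)
    (metis orbit_product_in_poly_ring orbit_product_out Var_in_poly_ring)

lemma subst_orbit_product_translate:
  assumes v: "v \<in> new_vars" and u: "u \<in> linear_forms m"
  shows "subst (Var(v := Var v + u)) (subst orbit_product p) = subst orbit_product p"
proof -
  let ?\<tau> = "Var(v := Var v + u)"
  have id: "subst ?\<tau> w = w" if "w \<in> linear_forms m" for w
    by (rule subst_id[OF linear_forms_poly_ring[OF that]]) (use v in auto)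
  then have "bij_betw (subst ?\<tau>) (linear_forms m) (linear_forms m)"
    by (subst bij_betw_cong[OF id]) (auto simp: bij_betw_def)
  then have "subst ?\<tau> (orbit_product w) = orbit_product w" for w
    using v u by (simp add: orbit_product_def subst_additive_poly additive_poly_shift)
  then show ?thesis by (simp add: subst_subst)
qed

text \<open>
  Write \<open>p\<close> in the basis of monomials \<open>mon g\<close>, \<open>g \<in> box\<close>, with coefficients in the image. Replacing
  the variable \<open>x\<^sub>v\<close> by a new indeterminate in \<open>mon g\<close> only gives a polynomial of degree less than
  \<open>orbit_size\<close> that takes the value \<open>p\<close> at all \<open>x\<^sub>v + u\<close>. So it is constant.
\<close>

lemma translation_invariant_imp_orbit_product:
  assumes p: "p \<in> poly_ring all_vars"
    and inv: "\<And>v u. v \<in> new_vars \<Longrightarrow> u \<in> linear_forms m \<Longrightarrow> subst (Var(v := Var v + u)) p = p"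
  shows "p \<in> subst orbit_product ` poly_ring all_vars"
proof -
  let ?C = "subst orbit_product ` poly_ring all_vars" and ?G = "box new_vars orbit_size"
  have C: "subalgebra ?C" by (intro subalgebra_subst_image subalgebra_poly_ring)
  \<comment> \<open>The one-element basis of the ring over itself; deforming it leaves just the
    \<open>box\<close> monomials as a basis over the image.\<close>
  have "free_basis (poly_ring all_vars) (poly_ring all_vars :: 'k mpoly set) {0} mon"
    by (rule free_basisI) (auto intro: exI[of _ "\<lambda>_. _"])
  then have "free_basis ?C (poly_ring all_vars) ({0} \<times> ?G) (\<lambda>(b, g). mon (stretch new_vars orbit_size b + g))"
    by (intro free_basis_orbit_product subalgebra_poly_ring) auto
  then have fb: "free_basis ?C (poly_ring all_vars) ?G mon"
    by (rule free_basis_reindex[where h = snd])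
      (auto simp: bij_betw_def inj_on_def image_iff additive_zero[OF additive_stretch])
  obtain a where a: "\<And>g. g \<in> ?G \<Longrightarrow> a g \<in> ?C" "p = (\<Sum>g\<in>?G. a g * mon g)"
    using free_basis_span[OF fb p] by blast
  have fin: "finite ?G" by (rule free_basis_finite[OF fb])
  have zero: "a g0 = 0" if g0: "g0 \<in> ?G" "g0 \<noteq> 0" for g0
  proof -
    have "keys g0 \<noteq> {}" using g0(2) by simp
    then obtain v where "v \<in> keys g0" by blast
    moreover from this have "v \<in> new_vars" using g0(1) unfolding box_def by blast
    ultimately have v: "v \<in> new_vars" "lookup g0 v \<noteq> 0" by (simp_all add: in_keys_iff)
    let ?L = "linear_forms m :: 'k mpoly set"
    \<comment> \<open>\<open>c j\<close> is the coefficient of the \<open>j\<close>-th power once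
      \<open>x_v\<close> inside the basis monomials is replaced by the indeterminate;
      \<open>R\<close> is the resulting polynomial minus the constant \<open>p\<close>.\<close>
    define c where "c j = (\<Sum>g\<in>?G. if lookup g v = j then a g * mon (restr (- {v}) g) else 0)" for j
    define R where "R = (\<Sum>j<orbit_size. monom (c j) j) - [:p:]"
    have split: "mon g = mon (restr (- {v}) g) * Var v ^ lookup g v" for g
    proof -
      have "g = restr (- {v}) g + single v (lookup g v)"
        by (rule poly_mapping_eqI) (auto simp: lookup_restr lookup_add lookup_single when_def)
      then show ?thesis unfolding Var_power by (metis mon_add)
    qed
    have root: "poly R (Var v + u) = 0" if u: "u \<in> ?L" for u
    proof -
      let ?\<tau> = "Var(v := Var v + u)"
      have \<tau>a: "subst ?\<tau> (a g) = a g" if "g \<in> ?G" for g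
        using a(1)[OF that] by (elim imageE) (simp only: subst_orbit_product_translate[OF v(1) u])
      have \<tau>m: "subst ?\<tau> (mon (restr (- {v}) g)) = mon (restr (- {v}) g)" for g
        by (rule subst_id[of _ "- {v}"]) (auto simp: keys_restr)
      have "poly R (Var v + u) = (\<Sum>j<orbit_size. c j * (Var v + u) ^ j) - p"
        by (simp add: R_def poly_sum poly_monom)
      also have "(\<Sum>j<orbit_size. c j * (Var v + u) ^ j) = (\<Sum>g\<in>?G. \<Sum>j<orbit_size.
          if j = lookup g v then a g * mon (restr (- {v}) g) * (Var v + u) ^ j else 0)"
        unfolding c_def sum_distrib_right by (subst sum.swap) (intro sum.cong refl, simp)
      also have "\<dots> = (\<Sum>g\<in>?G. a g * mon (restr (- {v}) g) * (Var v + u) ^ lookup g v)"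
        by (intro sum.cong refl) (simp add: sum.delta box_def)
      also have "\<dots> = subst ?\<tau> p"
        unfolding a(2) subst_sum
      proof (rule sum.cong[OF refl])
        fix g assume g: "g \<in> ?G"
        have "subst ?\<tau> (Var v) = Var v + u" by simp
        then show "a g * mon (restr (- {v}) g) * (Var v + u) ^ lookup g v = subst ?\<tau> (a g * mon g)"
          by (simp only: split[of g] subst_mult subst_power \<tau>a[OF g] \<tau>m mult.assoc)
      qed
      also have "\<dots> = p" by (rule inv[OF v(1) u])
      finally show ?thesis by simp
    qed
    \<comment> \<open>The elements \<open>Var v + u\<close> are \<open>q ^ m\<close> distinct roots,
      one more than the degree of \<open>R\<close> allows.\<close>
    have "R = 0"
    proof (rule poly_eqI_degree[where A = "(+) (Var v) ` ?L"])
      have card: "card ((+) (Var v) ` ?L) = orbit_size"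
        by (simp add: card_image card_linear_forms q)
      have "degree R < orbit_size"
        unfolding R_def
        by (intro degree_diff_less degree_sum_less le_less_trans[OF degree_monom_le])
          (use orbit_size_pos in simp_all)
      then show "degree R < card ((+) (Var v) ` ?L)" unfolding card .
      show "degree 0 < card ((+) (Var v) ` ?L)" unfolding card using orbit_size_pos by simp
    qed (use root in auto)
    have "lookup g0 v < orbit_size" using g0(1) by (simp add: box_def)
    then have "coeff R (lookup g0 v) = c (lookup g0 v)"
      using v(2) by (simp add: R_def coeff_sum coeff_pCons split: nat.split)
    then have "c (lookup g0 v) = 0" using \<open>R = 0\<close> by simp
    \<comment> \<open>As \<open>lookup g0 v\<close> is nonzero, the constant \<open>p\<close> does
      not enter this coefficient. Multiplying it by the power of \<open>x_v\<close> restores the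
      basis monomials and gives a relation in which \<open>a g0\<close> occurs.\<close>
    then have "(\<Sum>g\<in>?G. (if lookup g v = lookup g0 v then a g else 0) * mon g) = 0"
    proof -
      have "(\<Sum>g\<in>?G. (if lookup g v = lookup g0 v then a g else 0) * mon g) = c (lookup g0 v) * Var v ^ lookup g0 v"
        unfolding c_def sum_distrib_right
      proof (rule sum.cong[OF refl])
        fix g
        show "(if lookup g v = lookup g0 v then a g else 0) * mon g
            = (if lookup g v = lookup g0 v then a g * mon (restr (- {v}) g) else 0) * Var v ^ lookup g0 v"
        proof (cases "lookup g v = lookup g0 v")
          case True
          have "mon g = mon (restr (- {v}) g) * Var v ^ lookup g0 v"
            using split[of g] unfolding True .
          from arg_cong[OF this, of "(*) (a g)"] show ?thesis
            using True by (simp only: if_True simp_thms mult.assoc)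
        qed simp
      qed
      then show ?thesis using \<open>c (lookup g0 v) = 0\<close> by simp
    qed
    then have "(if lookup g0 v = lookup g0 v then a g0 else 0) = 0"
      by (rule free_basis_indep[OF fb, rotated]) (use a(1) g0(1) subalgebra_zero[OF C] in auto)
    then show ?thesis by simp
  qed
  have "p = (\<Sum>g\<in>?G. if g = 0 then a g else 0)"
    unfolding a(2) by (intro sum.cong refl) (simp add: zero)
  also have "\<dots> \<in> ?C"
    by (intro subalgebra_sum[OF C]) (use a(1) subalgebra_zero[OF C] in auto)
  finally show ?thesis .
qed

end

section \<open>Block triangular groups with two blocks\<close>

text \<open>The map on variables behind \<open>act\<close>, isolated so that a group of matrices
  yields a set of substitutions in the sense of \<open>fixed\<close>.\<close>

definition act_var :: "nat \<Rightarrow> 'k::field mat \<Rightarrow> nat \<Rightarrow> 'k mpoly"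
  where "act_var s g v = (if s \<le> v \<and> v < s + dim_col g
    then \<Sum>i<dim_row g. Cst (g $$ (i, v - s)) * Var (s + i) else Var v)"

lemma invariants_eq_fixed: "invariants s d H = fixed {s..<s + d} (act_var s ` H)"
  by (simp add: invariants_def fixed_def act_def act_var_def[abs_def])

lemma act_var_in:
  "g \<in> carrier_mat d d \<Longrightarrow> v \<in> {s..<s + d} \<Longrightarrow> act_var s g v = (\<Sum>i<d. Cst (g $$ (i, v - s)) * Var (s + i))"
  and act_var_out: "g \<in> carrier_mat d d \<Longrightarrow> v \<notin> {s..<s + d} \<Longrightarrow> act_var s g v = Var v"
  by (auto simp: act_var_def)

lemma act_var_in_poly_ring: "g \<in> carrier_mat d d \<Longrightarrow> v \<in> {s..<s + d} \<Longrightarrow> act_var s g v \<in> poly_ring {s..<s + d}"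
  by (auto simp: act_var_in intro!: sum_in_poly_ring mult_in_poly_ring Var_in_poly_ring)

lemma moves_only_act: "H \<subseteq> carrier_mat d d \<Longrightarrow> moves_only {s..<s + d} (act_var s ` H)"
  unfolding moves_only_def using act_var_out act_var_in_poly_ring by blast

lemma act_var_one: "act_var s (1\<^sub>m d) = Var"
proof
  fix v
  show "act_var s (1\<^sub>m d) v = Var v"
  proof (cases "v \<in> {s..<s + d}")
    case True
    then have "act_var s (1\<^sub>m d) v = (\<Sum>i<d. if i = v - s then Var (s + i) else 0)"
      unfolding act_var_in[OF one_carrier_mat True] by (intro sum.cong) (auto simp: less_diff_conv2)
    moreover have "v - s < d" using True by auto
    ultimately show ?thesis using True by simp
  qed (rule act_var_out[OF one_carrier_mat])
qed

lemma subst_act_var_linear_form: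
  assumes A: "A \<in> carrier_mat m m"
  shows "subst (act_var 0 A) (linear_form m c) = linear_form m (\<lambda>i. \<Sum>j<m. A $$ (i, j) * c j)"
proof -
  have "subst (act_var 0 A) (linear_form m c) = (\<Sum>j<m. \<Sum>i<m. Cst (A $$ (i, j) * c j) * Var i)"
    unfolding linear_form_def
    by (simp add: subst_hom act_var_in[OF A] sum_distrib_left Cst_mult mult_ac)
  also have "\<dots> = (\<Sum>i<m. \<Sum>j<m. Cst (A $$ (i, j) * c j) * Var i)" by (rule sum.swap)
  finally show ?thesis by (simp add: linear_form_def Cst_sum sum_distrib_right)
qed

lemma graded_act_var:
  assumes "g \<in> carrier_mat d d" and "{s..<s + d} \<subseteq> B"
  shows "graded (wt B) (wt B (single v 1)) (act_var s g v)"
proof (cases "v \<in> {s..<s + d}")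
  case True
  then have "wt B (single v 1) = 1" using assms(2) by (auto simp: wt_single)
  moreover have "graded (wt B) 1 (Var (s + i) :: 'a mpoly)" if "i < d" for i
  proof -
    have "s + i \<in> B" using assms(2) that by auto
    then show ?thesis by (simp add: graded_def Var_def wt_single)
  qed
  ultimately show ?thesis
    unfolding act_var_in[OF assms(1) True]
    by (auto intro!: graded_sum graded_Cst_mult additive_wt)
next
  case False
  then show ?thesis by (simp add: act_var_out[OF assms(1)] Var_def graded_mon)
qed

definition two_block_group :: "nat \<Rightarrow> nat \<Rightarrow> 'k::field mat set \<Rightarrow> 'k mat set \<Rightarrow> 'k mat set"
  where "two_block_group m d H K = {four_block_mat A B (0\<^sub>m d m) D | A B D.
    A \<in> H \<and> B \<in> carrier_mat m d \<and> D \<in> K}"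

context
  fixes q m d :: nat
  assumes q: "q = card (UNIV :: 'k::{field,finite} set)"
begin

context
  fixes A B D :: "'k mat"
  assumes A: "A \<in> carrier_mat m m" and B: "B \<in> carrier_mat m d" and D: "D \<in> carrier_mat d d"
begin

abbreviation (input) "glued_mat \<equiv> four_block_mat A B (0\<^sub>m d m) D"

lemma act_var_four_block_old: "v \<in> old_vars m \<Longrightarrow> act_var 0 glued_mat v = act_var 0 A v"
proof -
  assume v: "v \<in> old_vars m"
  have "act_var 0 glued_mat v = (\<Sum>i<m + d. if i < m then Cst (A $$ (i, v)) * Var i else 0)"
    using v A B D by (auto simp: act_var_def intro!: sum.cong)
  also have "\<dots> = (\<Sum>i<m. Cst (A $$ (i, v)) * Var i)"
    by (intro sum.mono_neutral_cong_right) auto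
  finally show ?thesis using v A by (simp add: act_var_def)
qed

lemma act_var_four_block_new:
  "v \<in> new_vars m d \<Longrightarrow> act_var 0 glued_mat v = linear_form m (\<lambda>i. B $$ (i, v - m)) + act_var m D v"
proof -
  assume v: "v \<in> new_vars m d"
  let ?t = "\<lambda>i. Cst (glued_mat $$ (i, v)) * Var i"
  have "act_var 0 glued_mat v = sum ?t {0..<m + d}"
    using v A D by (auto simp: act_var_def atLeast0LessThan)
  also have "\<dots> = sum ?t {0..<m} + sum ?t {m..<m + d}"
    by (simp add: sum.atLeastLessThan_concat)
  also have "sum ?t {0..<m} = linear_form m (\<lambda>i. B $$ (i, v - m))"
    unfolding linear_form_def atLeast0LessThan using v A D by (intro sum.cong) auto
  also have "sum ?t {m..<m + d} = (\<Sum>i<d. Cst (D $$ (i, v - m)) * Var (m + i))"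
    using v A D by (intro sum.reindex_bij_witness[of _ "\<lambda>i. m + i" "\<lambda>i. i - m"]) auto
  finally show ?thesis by (simp add: act_var_in[OF D v])
qed

lemma act_var_four_block_out: "v \<notin> all_vars m d \<Longrightarrow> act_var 0 glued_mat v = Var v"
  using A D by (simp add: act_var_def)

text \<open>Intertwining of the glued matrix with its diagonal part through \<open>\<Phi>\<close>.
  On a new variable, \<open>A\<close> permutes the linear forms and so passes through F,
  \<open>B\<close> adds a linear form that F does not see, and \<open>D\<close> passes through by
  linearity of F.\<close>

lemma subst_four_block_orbit_product:
  assumes A': "A' \<in> carrier_mat m m" "A * A' = 1\<^sub>m m"
  shows "subst (act_var 0 glued_mat) (subst (orbit_product m d) p)
    = subst (orbit_product m d) (subst (act_var 0 A) (subst (act_var m D) p))"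
proof -
  let ?op = "orbit_product m d :: nat \<Rightarrow> 'k mpoly"
  have lin: "subst (act_var 0 glued_mat) u = subst (act_var 0 A) u" if "u \<in> poly_ring (old_vars m)" for u
    by (rule subst_cong[OF that]) (rule act_var_four_block_old)
  have inv: "subst (act_var 0 A) (subst (act_var 0 A') u) = u" if u': "u \<in> linear_forms m" for u
  proof -
    obtain c where u: "u = linear_form m c" using u' by blast
    have "(\<Sum>j<m. A $$ (i, j) * (\<Sum>k<m. A' $$ (j, k) * c k)) = c i" if i: "i < m" for i
    proof -
      have AA: "(\<Sum>j<m. A $$ (i, j) * A' $$ (j, k)) = (if i = k then 1 else 0)" if "k < m" for k
      proof -
        have "(\<Sum>j<m. A $$ (i, j) * A' $$ (j, k)) = (A * A') $$ (i, k)"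
          using A A'(1) i that by (simp add: scalar_prod_def atLeast0LessThan)
        then show ?thesis using i that by (simp add: A'(2))
      qed
      have "(\<Sum>j<m. A $$ (i, j) * (\<Sum>k<m. A' $$ (j, k) * c k))
          = (\<Sum>j<m. \<Sum>k<m. A $$ (i, j) * A' $$ (j, k) * c k)"
        by (simp add: sum_distrib_left mult.assoc)
      also have "\<dots> = (\<Sum>k<m. (\<Sum>j<m. A $$ (i, j) * A' $$ (j, k)) * c k)"
        unfolding sum_distrib_right by (rule sum.swap)
      also have "\<dots> = (\<Sum>k<m. if i = k then c k else 0)"
        by (intro sum.cong refl) (simp add: AA)
      finally show ?thesis using i by simp
    qed
    then show ?thesis
      unfolding u subst_act_var_linear_form[OF A] subst_act_var_linear_form[OF A'(1)]
      unfolding linear_form_def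
      by (intro sum.cong) simp_all
  qed
  have "subst (act_var 0 A) ` linear_forms m = linear_forms m"
  proof (intro equalityI subsetI)
    show "u \<in> linear_forms m" if "u \<in> subst (act_var 0 A) ` linear_forms m" for u
      using that subst_act_var_linear_form[OF A] by auto
    fix u :: "'k mpoly" assume u: "u \<in> linear_forms m"
    then have "subst (act_var 0 A') u \<in> linear_forms m"
      using subst_act_var_linear_form[OF A'(1)] by auto
    then show "u \<in> subst (act_var 0 A) ` linear_forms m" using inv[OF u] by (metis imageI)
  qed
  \<comment> \<open>The right inverse gives surjectivity; injectivity follows since there are
    finitely many linear forms.\<close>
  then have "bij_betw (subst (act_var 0 A)) (linear_forms m) (linear_forms m)"
    using eq_card_imp_inj_on[OF finite_linear_forms, of "subst (act_var 0 A)" m] by (simp add: bij_betw_def)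
  then have bij: "bij_betw (subst (act_var 0 glued_mat)) (linear_forms m) (linear_forms m)"
    by (subst bij_betw_cong[OF lin[OF linear_forms_poly_ring]])
  have "subst (act_var 0 glued_mat) (?op v) = subst ?op (subst (act_var 0 A) (act_var m D v))" for v
  proof (cases "v \<in> new_vars m d")
    case True
    have "subst (act_var 0 glued_mat) (?op v) = additive_poly m (act_var 0 glued_mat v)"
      by (simp add: orbit_product_in[OF q True] subst_additive_poly[OF bij])
    also have "\<dots> = additive_poly m (act_var m D v)"
      unfolding act_var_four_block_new[OF True] add.commute[of "linear_form m _"]
      by (rule additive_poly_shift) blast
    also have "\<dots> = (\<Sum>i<d. Cst (D $$ (i, v - m)) * ?op (m + i))"
      unfolding act_var_in[OF D True] additive_poly_sum by (intro sum.cong refl) (simp add: orbit_product_in[OF q])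
    also have "\<dots> = subst ?op (act_var m D v)"
      by (simp add: act_var_in[OF D True] subst_hom)
    also have "act_var m D v = subst (act_var 0 A) (act_var m D v)"
      by (rule subst_id[symmetric, OF act_var_in_poly_ring[OF D True]]) (rule act_var_out[OF A], simp)
    finally show ?thesis .
  next
    case v: False
    have eq: "act_var m D v = Var v" "?op v = Var v"
      using v by (simp_all add: act_var_out[OF D] orbit_product_out[OF q])
    show ?thesis
    proof (cases "v \<in> old_vars m")
      case True
      have "act_var 0 A v \<in> poly_ring (old_vars m)" using act_var_in_poly_ring[OF A, of v 0] True by simp
      then have "subst ?op (act_var 0 A v) = act_var 0 A v"
        by (rule subst_id) (simp add: orbit_product_out[OF q])
      then show ?thesis by (simp add: eq act_var_four_block_old[OF True])
    next
      case False
      then have "v \<notin> all_vars m d" using v by auto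
      then show ?thesis using False eq act_var_out[OF A, of v 0] by (simp add: act_var_four_block_out)
    qed
  qed
  then show ?thesis by (simp add: subst_subst)
qed

end

context
  fixes H K :: "'k mat set"
  assumes H: "H \<subseteq> carrier_mat m m" "1\<^sub>m m \<in> H" "\<And>A. A \<in> H \<Longrightarrow> \<exists>A'\<in>carrier_mat m m. A * A' = 1\<^sub>m m"
    and K: "K \<subseteq> carrier_mat d d" "1\<^sub>m d \<in> K"
begin

text \<open>The image of \<open>\<Phi>\<close> is invariant by the intertwining property. Conversely
  the unipotent elements of the group force \<open>p = \<Phi> a\<close>, and the block diagonal
  elements together with injectivity of \<open>\<Phi>\<close> force \<open>a\<close> to be
  invariant.\<close>

lemma invariants_two_block_group:
  "invariants 0 (m + d) (two_block_group m d H K)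
    = subst (orbit_product m d) ` fixed (all_vars m d) (act_var 0 ` H \<union> act_var m ` K)"
proof (intro equalityI subsetI)
  let ?op = "orbit_product m d :: nat \<Rightarrow> 'k mpoly"
  fix p assume "p \<in> subst ?op ` fixed (all_vars m d) (act_var 0 ` H \<union> act_var m ` K)"
  then obtain a where a: "a \<in> fixed (all_vars m d) (act_var 0 ` H \<union> act_var m ` K)" "p = subst ?op a" by blast
  have "p \<in> poly_ring (all_vars m d)"
    using a subst_orbit_product_in_poly_ring[OF q] by (simp add: fixed_def)
  moreover have "subst (act_var 0 g) p = p" if g': "g \<in> two_block_group m d H K" for g
  proof -
    obtain A B D where g: "g = four_block_mat A B (0\<^sub>m d m) D" "A \<in> H" "B \<in> carrier_mat m d" "D \<in> K"
      using g' unfolding two_block_group_def by blast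
    obtain A' where "A' \<in> carrier_mat m m" "A * A' = 1\<^sub>m m" using H(3)[OF g(2)] by blast
    then have "subst (act_var 0 g) p = subst ?op (subst (act_var 0 A) (subst (act_var m D) a))"
      unfolding g(1) a(2) using g H(1) K(1) by (intro subst_four_block_orbit_product) auto
    then show ?thesis using a g by (simp add: fixed_def)
  qed
  ultimately show "p \<in> invariants 0 (m + d) (two_block_group m d H K)"
    by (auto simp: invariants_eq_fixed fixed_def)
next
  let ?op = "orbit_product m d :: nat \<Rightarrow> 'k mpoly"
  fix p assume "p \<in> invariants 0 (m + d) (two_block_group m d H K)"
  then have p: "p \<in> poly_ring (all_vars m d)" and inv: "\<And>g. g \<in> two_block_group m d H K \<Longrightarrow> subst (act_var 0 g) p = p"
    by (auto simp: invariants_eq_fixed fixed_def)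
  have "p \<in> subst ?op ` poly_ring (all_vars m d)"
  proof (rule translation_invariant_imp_orbit_product[OF q p])
    fix v and u :: "'k mpoly" assume v: "v \<in> new_vars m d" and "u \<in> linear_forms m"
    then obtain c where u: "u = linear_form m c" by blast
    \<comment> \<open>Only the column of \<open>v\<close> is nonzero and carries the coefficients of
      \<open>u\<close>, so the unipotent matrix translates \<open>x_v\<close> by \<open>u\<close>
      and fixes all other variables.\<close>
    define B where "B = mat m d (\<lambda>(i, j). if j = v - m then c i else 0)"
    have B: "B \<in> carrier_mat m d" by (simp add: B_def)
    let ?g = "four_block_mat (1\<^sub>m m) B (0\<^sub>m d m) (1\<^sub>m d)"
    have "?g \<in> two_block_group m d H K" unfolding two_block_group_def using H(2) K(2) B by blast
    moreover have "act_var 0 ?g = Var(v := Var v + u)"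
    proof
      fix w
      note * = act_var_four_block_old[OF one_carrier_mat B one_carrier_mat]
        act_var_four_block_new[OF one_carrier_mat B one_carrier_mat]
        act_var_four_block_out[OF one_carrier_mat B one_carrier_mat]
      consider "w \<in> old_vars m" | "w \<in> new_vars m d" "w = v" | "w \<in> new_vars m d" "w \<noteq> v" | "w \<notin> all_vars m d" by fastforce
      then show "act_var 0 ?g w = (Var(v := Var v + u)) w"
      proof cases
        case 1
        then show ?thesis using v by (simp add: * act_var_one)
      next
        case 2
        have "linear_form m (\<lambda>i. B $$ (i, v - m)) = u"
          unfolding u linear_form_def using v by (intro sum.cong) (auto simp: B_def)
        then show ?thesis unfolding 2(2) *(2)[OF v] by (simp add: act_var_one add.commute)
      next
        case 3
        have "linear_form m (\<lambda>i. B $$ (i, w - m)) = 0"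
          unfolding linear_form_def using v 3 by (intro sum.neutral) (auto simp: B_def)
        then show ?thesis using 3(2) by (simp add: *(2)[OF 3(1)] act_var_one)
      next
        case 4
        then have "w \<noteq> v" using v by auto
        then show ?thesis using 4 by (simp add: *)
      qed
    qed
    ultimately show "subst (Var(v := Var v + u)) p = p" using inv by metis
  qed
  then obtain a where a: "a \<in> poly_ring (all_vars m d)" "p = subst ?op a" by blast
  have eq: "subst (act_var 0 A) (subst (act_var m D) a) = a" if AD: "A \<in> H" "D \<in> K" for A D
  proof -
    let ?g = "four_block_mat A (0\<^sub>m m d) (0\<^sub>m d m) D"
    have "?g \<in> two_block_group m d H K" unfolding two_block_group_def using AD zero_carrier_mat by blast
    obtain A' where "A' \<in> carrier_mat m m" "A * A' = 1\<^sub>m m" using H(3)[OF AD(1)] by blast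
    then have "subst ?op (subst (act_var 0 A) (subst (act_var m D) a)) = subst (act_var 0 ?g) (subst ?op a)"
      using AD H(1) K(1) by (intro subst_four_block_orbit_product[symmetric]) auto
    also have "\<dots> = subst ?op a" using inv[OF \<open>?g \<in> two_block_group m d H K\<close>] a(2) by simp
    finally show ?thesis by (rule injD[OF inj_orbit_product[OF q]])
  qed
  have id: "subst Var b = b" for b :: "'k mpoly" by (rule subst_id[of _ UNIV]) auto
  \<comment> \<open>Taking one of the two diagonal blocks to be the identity separates the actions
    of \<open>H\<close> and \<open>K\<close>.\<close>
  have "a \<in> fixed (all_vars m d) (act_var 0 ` H \<union> act_var m ` K)"
    using a(1) eq[OF _ K(2)] eq[OF H(2)] by (auto simp: fixed_def act_var_one id)
  then show "p \<in> subst ?op ` fixed (all_vars m d) (act_var 0 ` H \<union> act_var m ` K)" using a(2) by blast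
qed

end

end

text \<open>The numbers up to \<open>(c + 1) * Q - 1\<close> are exactly the
  \<open>Q * a + b\<close> with \<open>a \<le> c\<close> and \<open>b < Q\<close>. Hence the index
  set of the product basis is again the set of exponents of all divisors of a single
  monomial.\<close>

lemma bij_betw_below_stretch:
  assumes "0 < Q" and XY: "X \<inter> Y = {}" and e1: "keys e1 \<subseteq> X" and e2: "keys e2 \<subseteq> Y"
    and e3: "keys e3 \<subseteq> X \<union> Y" "\<And>v. v \<in> X \<Longrightarrow> lookup e3 v = lookup e1 v"
      "\<And>v. v \<in> Y \<Longrightarrow> lookup e3 v = (lookup e2 v + 1) * Q - 1"
  shows "bij_betw (\<lambda>(e, f, g). e + (stretch Y Q f + g)) (below e1 \<times> (below e2 \<times> box Y Q)) (below e3)"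
proof -
  have X: "lookup e v = 0" if "keys e \<subseteq> X" "v \<in> Y" for e :: "nat \<Rightarrow>\<^sub>0 nat" and v
    using that XY by (metis disjoint_iff in_keys_iff subsetD)
  have le: "Q * a + b \<le> (c + 1) * Q - 1 \<longleftrightarrow> a \<le> c" if "b < Q" for a b c :: nat
  proof
    assume "Q * a + b \<le> (c + 1) * Q - 1"
    then have "Q * a < Q * (c + 1)" using \<open>0 < Q\<close> by (simp add: algebra_simps)
    then have "a < c + 1" unfolding nat_mult_less_cancel_disj by simp
    then show "a \<le> c" by simp
  next
    assume "a \<le> c"
    then have "Q * a \<le> Q * c" by simp
    then have "Q * a + b < Q * c + Q" using that by (rule add_le_less_mono)
    then show "Q * a + b \<le> (c + 1) * Q - 1" by (simp add: algebra_simps)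
  qed
  let ?h = "\<lambda>(e, f, g). e + (stretch Y Q f + g)"
  have on_X: "lookup (e + (stretch Y Q f + g)) v = lookup e v"
    if "e \<in> below e1" "f \<in> below e2" "g \<in> box Y Q" "v \<notin> Y" for e f g v
  proof -
    have "v \<notin> keys f" using keys_below[OF that(2)] e2 that(4) by blast
    moreover have "v \<notin> keys g" using that by (auto simp: box_def)
    ultimately show ?thesis using that(4) by (simp add: lookup_add lookup_stretch in_keys_iff)
  qed
  have on_Y: "lookup (e + (stretch Y Q f + g)) v = Q * lookup f v + lookup g v"
    if "e \<in> below e1" "v \<in> Y" for e f g v
    using X[OF order_trans[OF keys_below[OF that(1)] e1] that(2)] that(2) by (simp add: lookup_add lookup_stretch)
  show ?thesis
    unfolding bij_betw_def
  proof (intro conjI inj_onI equalityI subsetI)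
    fix x y assume "x \<in> below e1 \<times> (below e2 \<times> box Y Q)" "y \<in> below e1 \<times> (below e2 \<times> box Y Q)" "?h x = ?h y"
    then obtain e f g e' f' g' where xy: "x = (e, f, g)" "y = (e', f', g')"
      "e \<in> below e1" "f \<in> below e2" "g \<in> box Y Q" "e' \<in> below e1" "f' \<in> below e2" "g' \<in> box Y Q"
      and eq: "e + (stretch Y Q f + g) = e' + (stretch Y Q f' + g')"
      by auto
    have "lookup e v = lookup e' v" for v
    proof (cases "v \<in> Y")
      case True
      then show ?thesis
        using X[OF order_trans[OF keys_below[OF xy(3)] e1]] X[OF order_trans[OF keys_below[OF xy(6)] e1]] by simp
    next
      case False
      then show ?thesis using on_X[OF xy(3-5) False] on_X[OF xy(6-8) False] eq by simp
    qed
    then have "e = e'" by (rule poly_mapping_eqI)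
    moreover from this have "stretch Y Q f + g = stretch Y Q f' + g'" using eq by simp
    then have "f = f' \<and> g = g'" using xy(5,8) by (rule stretch_add_box_inject)
    ultimately show "x = y" by (simp add: xy)
  next
    fix z assume "z \<in> ?h ` (below e1 \<times> (below e2 \<times> box Y Q))"
    then obtain e f g where z: "z = e + (stretch Y Q f + g)" "e \<in> below e1" "f \<in> below e2" "g \<in> box Y Q" by auto
    have "lookup z v \<le> lookup e3 v" for v
    proof (cases "v \<in> Y")
      case True
      have "lookup f v \<le> lookup e2 v" "lookup g v < Q" using z by (auto simp: below_def box_def)
      then show ?thesis unfolding z(1) on_Y[OF z(2) True] e3(3)[OF True] by (simp only: le)
    next
      case False
      show ?thesis
      proof (cases "v \<in> X")
        case True
        then show ?thesis using z(2) unfolding z(1) on_X[OF z(2-4) False] e3(2)[OF True] by (simp add: below_def)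
      next
        case False
        then have "lookup e v = 0" using keys_below[OF z(2)] e1 by (auto simp: in_keys_iff)
        then show ?thesis unfolding z(1) on_X[OF z(2-4) \<open>v \<notin> Y\<close>] by simp
      qed
    qed
    then show "z \<in> below e3" by (simp add: below_def)
  next
    fix z assume z: "z \<in> below e3"
    obtain f g where fg: "restr Y z = stretch Y Q f + g" "g \<in> box Y Q" "keys f \<subseteq> keys (restr Y z)"
      using stretch_add_box_exists[OF \<open>0 < Q\<close>, of "restr Y z" Y] by metis
    have "- Y \<inter> (X \<union> Y) = X" using XY by auto
    then have kz: "keys (restr (- Y) z) \<subseteq> X" using keys_below[OF z] e3(1) by (auto simp: keys_restr)
    have zeq: "z = restr (- Y) z + (stretch Y Q f + g)"
      using restr_split[of z Y] fg(1) by (simp add: add.commute)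
    have "lookup (restr (- Y) z) v \<le> lookup e1 v" for v
    proof (cases "v \<in> X")
      case True
      then have "v \<notin> Y" using XY by auto
      then show ?thesis using z e3(2)[OF True] by (metis (mono_tags) below_def mem_Collect_eq lookup_restr ComplI)
    next
      case False
      then have "v \<notin> keys (restr (- Y) z)" using kz by blast
      then show ?thesis by (simp add: in_keys_iff)
    qed
    then have "restr (- Y) z \<in> below e1" by (simp add: below_def)
    moreover have "lookup f v \<le> lookup e2 v" for v
    proof (cases "v \<in> Y")
      case True
      have "lookup z v = Q * lookup f v + lookup g v"
        using arg_cong[OF fg(1), of "\<lambda>x. lookup x v"] True by (simp add: lookup_restr lookup_add lookup_stretch)
      moreover have "lookup z v \<le> (lookup e2 v + 1) * Q - 1"
        using z e3(3)[OF True] by (metis (mono_tags) below_def mem_Collect_eq)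
      moreover have "lookup g v < Q" using fg(2) by (simp add: box_def)
      ultimately show ?thesis using le by metis
    next
      case False
      then have "v \<notin> keys f" using fg(3) by (auto simp: keys_restr)
      then show ?thesis by (simp add: in_keys_iff)
    qed
    then have "f \<in> below e2" by (simp add: below_def)
    ultimately show "z \<in> ?h ` (below e1 \<times> (below e2 \<times> box Y Q))"
      using fg(2) zeq by (intro image_eqI[of _ _ "(restr (- Y) z, f, g)"]) auto
  qed
qed

lemma homogeneous_polynomial_algebraE:
  assumes "homogeneous_polynomial_algebra A"
  obtains r f where "bij_betw (subst f) (poly_ring {..<r}) A" "\<And>i. i < r \<Longrightarrow> \<exists>D. graded (wt UNIV) D (f i)"
  using assms unfolding homogeneous_polynomial_algebra_def polynomial_generators_def homogeneous_graded by blast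

section \<open>The inductive step: one more diagonal block\<close>

context
  fixes q m d :: nat and H K :: "'k::{field,finite} mat set" and e1 e2 e3 :: "nat \<Rightarrow>\<^sub>0 nat"
  assumes q: "q = card (UNIV :: 'k::{field,finite} set)"
    and H: "H \<subseteq> carrier_mat m m" "1\<^sub>m m \<in> H" "\<And>A. A \<in> H \<Longrightarrow> \<exists>A'\<in>carrier_mat m m. A * A' = 1\<^sub>m m"
    and K: "K \<subseteq> carrier_mat d d" "1\<^sub>m d \<in> K"
    and old: "generates_block_basis {0..<m} (invariants 0 m H) (mon e1)"
    and new: "generates_block_basis {m..<m + d} (invariants m d K) (mon e2)"
    and e3: "keys e3 \<subseteq> {0..<m + d}" "\<And>v. v \<in> {0..<m} \<Longrightarrow> lookup e3 v = lookup e1 v"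
      "\<And>v. v \<in> {m..<m + d} \<Longrightarrow> lookup e3 v = (lookup e2 v + 1) * q ^ m - 1"
begin

abbreviation (input) "old_action \<equiv> act_var 0 ` H"
abbreviation (input) "new_action \<equiv> act_var m ` K"
abbreviation (input) "actions \<equiv> old_action \<union> new_action"
abbreviation (input) "\<Phi> \<equiv> orbit_product m d :: nat \<Rightarrow> 'k mpoly"

lemma moves: "moves_only (old_vars m) old_action" "moves_only (new_vars m d) new_action"
  using moves_only_act[OF H(1), of 0] moves_only_act[OF K(1), of m] by simp_all

lemma basis_old: "free_basis (fixed (old_vars m) old_action) (poly_ring (old_vars m)) (below e1) mon"
  and basis_new: "free_basis (fixed (new_vars m d) new_action) (poly_ring (new_vars m d)) (below e2) mon"
  using generates_block_basisD(4)[OF old] generates_block_basisD(4)[OF new]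
  by (simp_all add: invariants_eq_fixed)

lemma keys_old: "keys e1 \<subseteq> old_vars m" and keys_new: "keys e2 \<subseteq> new_vars m d"
  using generates_block_basisD(3)[OF old] generates_block_basisD(3)[OF new] by simp_all

lemma disjoint: "old_vars m \<inter> new_vars m d = {}" "new_vars m d \<inter> old_vars m = {}"
  and all_eq: "old_vars m \<union> new_vars m d = all_vars m d" "new_vars m d \<union> old_vars m = all_vars m d"
  by auto

text \<open>Linear substitutions of the new variables preserve the degree in them. This is the
  gradedness that the deformation lemma requires of the coefficient ring.\<close>

lemma part_fixed_new:
  "p \<in> fixed (all_vars m d) new_action \<Longrightarrow> part (\<lambda>e. R (wt (new_vars m d) e)) p \<in> fixed (all_vars m d) new_action"
proof -
  assume p: "p \<in> fixed (all_vars m d) new_action"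
  have "subst (act_var m D) (part (\<lambda>e. R (wt (new_vars m d) e)) p) = part (\<lambda>e. R (wt (new_vars m d) e)) p"
    if "D \<in> K" for D
  proof -
    have "part (\<lambda>e. R (wt (new_vars m d) e)) (subst (act_var m D) p)
        = subst (act_var m D) (part (\<lambda>e. R (wt (new_vars m d) e)) p)"
      using that K(1) by (intro part_subst additive_wt graded_act_var[where d = d]) auto
    then show ?thesis using p that by (simp add: fixed_def)
  qed
  then show ?thesis using p by (auto simp: fixed_def)
qed

text \<open>The tower law with middle ring \<open>\<Phi>\<close> of the invariants of
  \<open>K\<close>. Above it the basis of the new block is deformed; below it the basis of the old
  block is restricted to \<open>K\<close>-invariants and transported by \<open>\<Phi>\<close>, which
  does not change these monomials.\<close>

lemma basis_two_blocks:
  "free_basis (subst \<Phi> ` fixed (all_vars m d) actions) (poly_ring (all_vars m d)) (below e3) mon"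
proof -
  let ?Z = "all_vars m d" and ?Y = "new_vars m d" and ?X = "old_vars m"
  have b1: "e \<in> below e1 \<Longrightarrow> keys e \<subseteq> ?X" and b2: "e \<in> below e2 \<Longrightarrow> keys e \<subseteq> ?Y" for e
    using keys_below keys_old keys_new by blast+
  have "free_basis (fixed ?Z new_action) (poly_ring ?Z) (below e2) mon"
    using free_basis_fixed_extend[OF disjoint(1) moves(2) b2 basis_new] unfolding all_eq by blast
  then have fb2: "free_basis (subst \<Phi> ` fixed ?Z new_action) (poly_ring ?Z) (below e2 \<times> box ?Y (q ^ m))
      (\<lambda>(b, g). mon (stretch ?Y (q ^ m) b + g))"
    using b2 all_eq
    by (intro free_basis_orbit_product[OF q subalgebra_fixed fixed_subset part_fixed_new]) blast+
  have "free_basis (fixed ?Z old_action) (poly_ring ?Z) (below e1) mon"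
    using free_basis_fixed_extend[OF disjoint(2) moves(1) b1 basis_old] unfolding all_eq by blast
  then have "free_basis (fixed ?Z actions) (fixed ?Z new_action) (below e1) mon"
    using free_basis_fixed_restrict[OF disjoint(1) moves b1] unfolding all_eq by blast
  then have fb0: "free_basis (subst \<Phi> ` fixed ?Z actions) (subst \<Phi> ` fixed ?Z new_action) (below e1) (\<lambda>e. subst \<Phi> (mon e))"
  proof (rule free_basis_subst)
    show "inj_on (subst \<Phi>) (fixed ?Z new_action)" using inj_orbit_product[OF q] by (rule inj_on_subset) simp
    show "0 \<in> fixed ?Z new_action" by (rule subalgebra_zero[OF subalgebra_fixed])
    fix a assume a: "\<And>i. i \<in> below e1 \<Longrightarrow> a i \<in> fixed ?Z actions"
    have "mon i \<in> fixed ?Z new_action" if "i \<in> below e1" for i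
      using mult_in_fixed[OF disjoint(1) moves(2) single_in_poly_ring[OF b1[OF that]] subalgebra_one[OF subalgebra_fixed], of 1]
      unfolding all_eq by simp
    then show "(\<Sum>i\<in>below e1. a i * mon i) \<in> fixed ?Z new_action"
      using a by (intro subalgebra_sum[OF subalgebra_fixed] subalgebra_mult[OF subalgebra_fixed]) (auto simp: fixed_Un)
  qed
  have op_mon: "mon e = subst \<Phi> (mon e)" if "e \<in> below e1" for e
    using b1[OF that] by (intro subst_id[symmetric, of _ ?X] single_in_poly_ring) (auto simp: orbit_product_out[OF q])
  have fb1: "free_basis (subst \<Phi> ` fixed ?Z actions) (subst \<Phi> ` fixed ?Z new_action) (below e1) mon"
    by (rule free_basis_reindex[OF fb0 bij_betw_id]) (unfold id_apply, erule op_mon)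
  have "free_basis (subst \<Phi> ` fixed ?Z actions) (poly_ring ?Z) (below e1 \<times> (below e2 \<times> box ?Y (q ^ m)))
      (\<lambda>(e, i). mon e * (case i of (b, g) \<Rightarrow> mon (stretch ?Y (q ^ m) b + g)))"
  proof (rule free_basis_trans[OF fb1 fb2])
    fix a assume a: "\<And>i. i \<in> below e1 \<Longrightarrow> a i \<in> subst \<Phi> ` fixed ?Z actions"
    have mem: "mon e \<in> subst \<Phi> ` fixed ?Z new_action" if e: "e \<in> below e1" for e
    proof -
      have "mon e \<in> fixed ?Z new_action"
        using mult_in_fixed[OF disjoint(1) moves(2) single_in_poly_ring[OF b1[OF e]] subalgebra_one[OF subalgebra_fixed], of 1]
        unfolding all_eq by simp
      then show ?thesis using op_mon[OF e] by (metis imageI)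
    qed
    have sub: "subst \<Phi> ` fixed ?Z actions \<subseteq> subst \<Phi> ` fixed ?Z new_action"
      by (intro image_mono) (simp add: fixed_Un)
    have alg: "subalgebra (subst \<Phi> ` fixed ?Z new_action)" by (intro subalgebra_subst_image subalgebra_fixed)
    show "(\<Sum>i\<in>below e1. a i * mon i) \<in> subst \<Phi> ` fixed ?Z new_action"
      by (rule subalgebra_sum[OF alg]) (rule subalgebra_mult[OF alg subsetD[OF sub a] mem])
  qed
  then show ?thesis
    by (rule free_basis_reindex[OF _ bij_betw_below_stretch[OF orbit_size_pos[OF q] disjoint(1) keys_old keys_new]])
      (use e3 all_eq in \<open>auto simp: mult_single\<close>)
qed

text \<open>Confined to the new variables: \<open>\<Phi>\<close> multiplies degrees by
  \<open>q ^ m\<close> there but preserves them on the old variables, so homogeneity of mixed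
  polynomials need not survive.\<close>

lemma graded_subst_orbit_product:
  assumes "p \<in> poly_ring (new_vars m d)" "graded (wt UNIV) D p"
  shows "graded (wt UNIV) (q ^ m * D) (subst \<Phi> p)"
proof -
  have "graded (wt UNIV) (q ^ m * D) (subst \<Phi> (single e c))" if "keys e \<subseteq> new_vars m d" "wt UNIV e = D" for e c
  proof -
    have "graded (wt UNIV) (\<Sum>v\<in>keys e. \<Sum>i<lookup e v. q ^ m) (subst \<Phi> (single e c))"
      unfolding subst_single
    proof (intro graded_Cst_mult graded_prod graded_power additive_wt)
      fix v assume "v \<in> keys e"
      then have v: "v \<in> new_vars m d" using that(1) by blast
      have "graded (wt UNIV) 1 (Var v :: 'k mpoly)" by (simp add: graded_def Var_def wt_single)
      then show "graded (wt UNIV) (q ^ m) (\<Phi> v)"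
        unfolding orbit_product_in[OF q v] unfolding q by (rule additive_poly_graded)
    qed
    also have "(\<Sum>v\<in>keys e. \<Sum>i<lookup e v. q ^ m) = q ^ m * D"
      using that(2) by (simp add: wt_def mult.commute flip: sum_distrib_right)
    finally show ?thesis .
  qed
  then have "graded (wt UNIV) (q ^ m * D) (\<Sum>e\<in>keys p. subst \<Phi> (single e (lookup p e)))"
    using assms by (intro graded_sum) (auto simp: graded_def poly_ring_iff)
  then show ?thesis unfolding subst_sum[symmetric] expand[symmetric] .
qed

text \<open>The generators are those of the old block, which \<open>\<Phi>\<close> fixes, and the
  images under \<open>\<Phi>\<close> of those of the new block. Each family involves only one kind
  of variable, so it stays homogeneous.\<close>

lemma generators_two_blocks:
  "homogeneous_polynomial_algebra (subst \<Phi> ` fixed (all_vars m d) actions)"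
proof -
  have "homogeneous_polynomial_algebra (fixed (old_vars m) old_action)" "homogeneous_polynomial_algebra (fixed (new_vars m d) new_action)"
    using generates_block_basisD(1)[OF old] generates_block_basisD(1)[OF new] by (simp_all add: invariants_eq_fixed)
  then obtain r f s g where
    f: "bij_betw (subst f) (poly_ring {..<r}) (fixed (old_vars m) old_action)" "\<And>i. i < r \<Longrightarrow> \<exists>D. graded (wt UNIV) D (f i)" and
    g: "bij_betw (subst g) (poly_ring {..<s}) (fixed (new_vars m d) new_action)" "\<And>i. i < s \<Longrightarrow> \<exists>D. graded (wt UNIV) D (g i)"
    by (elim homogeneous_polynomial_algebraE) blast
  define h where "h v = (if v < r then f v else g (v - r))" for v
  have "bij_betw (subst h) (poly_ring {..<r + s}) (fixed (all_vars m d) actions)"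
    unfolding h_def all_eq(1)[symmetric]
  proof (rule bij_betw_subst_fixed_Un[OF disjoint(1) moves _ _ basis_old f(1) g(1)])
    show "keys e \<subseteq> old_vars m" if "e \<in> below e1" for e using keys_below[OF that] keys_old by blast
  qed (simp add: below_def)
  moreover have "bij_betw (subst \<Phi>) (fixed (all_vars m d) actions) (subst \<Phi> ` fixed (all_vars m d) actions)"
    by (rule inj_on_imp_bij_betw[OF inj_on_subset[OF inj_orbit_product[OF q]]]) simp
  ultimately have bij: "bij_betw (subst (\<lambda>v. subst \<Phi> (h v))) (poly_ring {..<r + s}) (subst \<Phi> ` fixed (all_vars m d) actions)"
    using bij_betw_trans by (force simp: comp_def subst_subst)
  have "\<exists>D. graded (wt UNIV) D (subst \<Phi> (h i))" if i: "i < r + s" for i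
  proof (cases "i < r")
    case True
    have "f i \<in> fixed (old_vars m) old_action" using generator_in_image[OF f(1)] True by blast
    then have "subst \<Phi> (f i) = f i"
      by (intro subst_id[of _ "old_vars m"]) (auto simp: fixed_def orbit_product_out[OF q])
    then show ?thesis using f(2)[OF True] True by (simp add: h_def)
  next
    case False
    then have "i - r < s" using i by simp
    then have "g (i - r) \<in> fixed (new_vars m d) new_action" using generator_in_image[OF g(1)] by blast
    moreover obtain D where "graded (wt UNIV) D (g (i - r))" using g(2)[OF \<open>i - r < s\<close>] by blast
    ultimately show ?thesis using False graded_subst_orbit_product by (auto simp: h_def fixed_def)
  qed
  with bij show ?thesis
    unfolding homogeneous_polynomial_algebra_def polynomial_generators_def homogeneous_graded by blast
qed

lemma generates_block_basis_two_blocks: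
  "generates_block_basis {0..<m + d} (invariants 0 (m + d) (two_block_group m d H K)) (mon e3)"
proof -
  have "generates_block_basis {0..<m + d} (subst \<Phi> ` fixed (all_vars m d) actions) (mon e3)"
  proof (rule free_basis_imp_block_basis[OF generators_two_blocks _ basis_two_blocks e3(1)])
    show "subst \<Phi> ` fixed (all_vars m d) actions \<subseteq> poly_ring (all_vars m d)"
      using subst_orbit_product_in_poly_ring[OF q] fixed_subset by blast
  qed
  then show ?thesis by (simp only: invariants_two_block_group[OF q H K])
qed

end

section \<open>Arbitrary compositions\<close>

lemma GL_iff: "(g :: 'k::field mat) \<in> carrier (GL d) \<longleftrightarrow> g \<in> carrier_mat d d \<and> det g \<noteq> 0"
  unfolding GL_def units_of_carrier
  using det_non_zero_imp_unit[of g d "()"] unit_imp_det_non_zero[of g d "()"]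
  by (auto simp: Units_def ring_mat_simps)

lemma GL_right_inverse: "(g :: 'k::field mat) \<in> carrier (GL d) \<Longrightarrow> \<exists>h\<in>carrier_mat d d. g * h = 1\<^sub>m d"
  by (auto simp: GL_def units_of_carrier Units_def ring_mat_simps)

lemma one_in_subgroup_GL: "subgroup K (GL d) \<Longrightarrow> (1\<^sub>m d :: 'k::field mat) \<in> K"
  using subgroup.one_closed[of K "GL d"] by (simp add: GL_def units_of_one ring_mat_simps)

lemma offset_mono: "i \<le> j \<Longrightarrow> offset ns i \<le> offset ns j"
proof -
  assume "i \<le> j"
  then obtain k where "j = i + k" using le_Suc_ex by blast
  then show ?thesis by (simp add: offset_def take_add)
qed

lemma offset_Suc: "i < length ns \<Longrightarrow> offset ns (Suc i) = offset ns i + ns ! i"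
  by (simp add: offset_def take_Suc_conv_app_nth)

lemma offset_length: "offset ns (length ns) = sum_list ns"
  by (simp add: offset_def)

lemma offset_add_less: "i < j \<Longrightarrow> j \<le> length ns \<Longrightarrow> a < ns ! i \<Longrightarrow> offset ns i + a < offset ns j"
  using offset_Suc[of i ns] offset_mono[of "Suc i" j ns] by simp

lemma offset_add_less_sum_list: "i < length ns \<Longrightarrow> a < ns ! i \<Longrightarrow> offset ns i + a < sum_list ns"
  using offset_add_less[of i "length ns" ns a] by (simp add: offset_length)

lemma offset_append: "i \<le> length ns \<Longrightarrow> offset (ns @ ms) i = offset ns i"
  by (simp add: offset_def)

lemma less_sum_list_block:
  "b < sum_list ns \<Longrightarrow> \<exists>j<length ns. \<exists>a<ns ! j. b = offset ns j + a"
proof (induction ns rule: rev_induct)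
  case (snoc d ns)
  show ?case
  proof (cases "b < sum_list ns")
    case True
    then obtain j a where ja: "j < length ns" "a < ns ! j" "b = offset ns j + a" using snoc.IH by blast
    then show ?thesis by (intro exI[of _ j] conjI exI[of _ a]) (auto simp: nth_append offset_append)
  next
    case False
    then show ?thesis using snoc.prems
      by (intro exI[of _ "length ns"] conjI exI[of _ "b - sum_list ns"]) (auto simp: offset_append offset_length)
  qed
qed simp

text \<open>Appending a block leaves the earlier offsets unchanged, so the conditions on the earlier
  blocks concern \<open>A\<close> only, and triangularity of the last row of blocks is the vanishing
  of the lower left corner. Invertibility splits because the determinant is the product of those of
  \<open>A\<close> and \<open>D\<close>.\<close>

lemma block_group_snoc:
  fixes G :: "nat \<Rightarrow> 'k::field mat set"
  assumes G: "G (length ns) \<subseteq> carrier (GL d)"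
  shows "block_group (ns @ [d]) G = two_block_group (sum_list ns) d (block_group ns G) (G (length ns))"
proof -
  let ?m = "sum_list ns" and ?l = "length ns" and ?ns = "ns @ [d]"
  have nth: "?ns ! i = ns ! i" if "i < ?l" for i using that by (simp add: nth_append)
  have iff: "four_block_mat A B (0\<^sub>m d ?m) D \<in> block_group ?ns G \<longleftrightarrow> A \<in> block_group ns G \<and> D \<in> G ?l"
    if A: "A \<in> carrier_mat ?m ?m" and B: "B \<in> carrier_mat ?m d" and D: "D \<in> carrier_mat d d" for A B D
  proof -
    let ?g = "four_block_mat A B (0\<^sub>m d ?m) D"
    have entry: "?g $$ (offset ns i + a, offset ns j + b) = A $$ (offset ns i + a, offset ns j + b)"
      if "i < ?l" "a < ns ! i" "j < ?l" "b < ns ! j" for i j a b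
      using offset_add_less_sum_list[of i ns a] offset_add_less_sum_list[of j ns b] that A D by simp
    have diag: "diag_block ?ns i ?g = diag_block ns i A" if "i < ?l" for i
      using that by (intro eq_matI) (auto simp: diag_block_def nth offset_append entry)
    have diag': "diag_block ?ns ?l ?g = D"
      using A D by (intro eq_matI) (auto simp: diag_block_def offset_append offset_length)
    have upper: "block_upper_triangular ?ns ?g \<longleftrightarrow> block_upper_triangular ns A"
    proof
      assume u: "block_upper_triangular ?ns ?g"
      show "block_upper_triangular ns A"
        unfolding block_upper_triangular_def
      proof (intro allI impI)
        fix i j a b assume *: "i < ?l" "j < i" "a < ns ! i" "b < ns ! j"
        then have "?g $$ (offset ?ns i + a, offset ?ns j + b) = 0"
          using u[unfolded block_upper_triangular_def, rule_format, of i j a b] by (simp add: nth)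
        then show "A $$ (offset ns i + a, offset ns j + b) = 0"
          using * entry[of i a j b] by (simp add: offset_append)
      qed
    next
      assume u: "block_upper_triangular ns A"
      show "block_upper_triangular ?ns ?g"
        unfolding block_upper_triangular_def
      proof (intro allI impI)
        fix i j a b assume *: "i < length ?ns" "j < i" "a < ?ns ! i" "b < ?ns ! j"
        then have b: "j < ?l" "b < ns ! j" by (auto simp: nth)
        show "?g $$ (offset ?ns i + a, offset ?ns j + b) = 0"
        proof (cases "i < ?l")
          case True
          then have "A $$ (offset ns i + a, offset ns j + b) = 0"
            using u * b by (simp add: block_upper_triangular_def nth)
          then show ?thesis using True * b entry[of i a j b] by (simp add: offset_append nth)
        next
          case False
          then have "i = ?l" using * by simp
          then show ?thesis
            using * b A D offset_add_less_sum_list[OF b] by (simp add: offset_append offset_length)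
        qed
      qed
    qed
    have "det ?g = det A * det D" by (rule det_four_block_mat_lower_left_zero[OF A B refl D])
    moreover have "?g \<in> carrier_mat (?m + d) (?m + d)" using A D by simp
    moreover have "det D \<noteq> 0" if "D \<in> G ?l" using that G GL_iff by blast
    ultimately show ?thesis
      using A D by (auto simp: block_group_def GL_iff upper diag diag' less_Suc_eq)
  qed
  have form: "\<exists>A B D. g = four_block_mat A B (0\<^sub>m d ?m) D \<and> A \<in> carrier_mat ?m ?m \<and> B \<in> carrier_mat ?m d \<and> D \<in> carrier_mat d d"
    if g: "g \<in> block_group ?ns G" for g
  proof -
    have dim: "g \<in> carrier_mat (?m + d) (?m + d)" and u: "block_upper_triangular ?ns g"
      using g by (auto simp: block_group_def GL_iff)
    have z: "g $$ (i, j) = 0" if ij: "\<not> i < ?m" "i < ?m + d" "j < ?m" for i j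
    proof -
      obtain k a where k: "k < ?l" "a < ns ! k" "j = offset ns k + a" using less_sum_list_block[OF ij(3)] by blast
      have "g $$ (offset ?ns ?l + (i - ?m), offset ?ns k + a) = 0"
        using u[unfolded block_upper_triangular_def, rule_format, of ?l k "i - ?m" a] k ij by (simp add: nth)
      then show ?thesis using k ij by (simp add: offset_append offset_length)
    qed
    let ?A = "mat ?m ?m (($$) g)" and ?B = "mat ?m d (\<lambda>(i, j). g $$ (i, ?m + j))"
      and ?D = "mat d d (\<lambda>(i, j). g $$ (?m + i, ?m + j))"
    have "g = four_block_mat ?A ?B (0\<^sub>m d ?m) ?D"
      using dim z by (intro eq_matI) auto
    then show ?thesis by (intro exI[of _ ?A] exI[of _ ?B] exI[of _ ?D]) simp
  qed
  show ?thesis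
  proof (intro equalityI subsetI)
    fix g assume g: "g \<in> block_group ?ns G"
    obtain A B D where ABD: "g = four_block_mat A B (0\<^sub>m d ?m) D"
      "A \<in> carrier_mat ?m ?m" "B \<in> carrier_mat ?m d" "D \<in> carrier_mat d d" using form[OF g] by blast
    have AD: "A \<in> block_group ns G \<and> D \<in> G ?l"
      using g unfolding ABD(1) iff[OF ABD(2-4)] .
    show "g \<in> two_block_group ?m d (block_group ns G) (G ?l)"
      unfolding two_block_group_def
      by (intro CollectI exI[of _ A] exI[of _ B] exI[of _ D] conjI ABD AD[THEN conjunct1] AD[THEN conjunct2])
  next
    fix g assume "g \<in> two_block_group ?m d (block_group ns G) (G ?l)"
    then obtain A B D where ABD: "g = four_block_mat A B (0\<^sub>m d ?m) D"
      "A \<in> block_group ns G" "B \<in> carrier_mat ?m d" "D \<in> G ?l" unfolding two_block_group_def by blast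
    have A: "A \<in> carrier_mat ?m ?m" using ABD(2) by (simp add: block_group_def GL_iff)
    have D: "D \<in> carrier_mat d d" using ABD(4) G GL_iff by blast
    show "g \<in> block_group ?ns G"
      unfolding ABD(1) iff[OF A ABD(3) D] using ABD(2,4) ..
  qed
qed

lemma one_in_block_group:
  assumes "\<And>i. i < length ns \<Longrightarrow> subgroup (G i) (GL (ns ! i))"
  shows "(1\<^sub>m (sum_list ns) :: 'k::field mat) \<in> block_group ns G"
proof -
  have "block_upper_triangular ns (1\<^sub>m (sum_list ns) :: 'k mat)"
    unfolding block_upper_triangular_def
  proof (intro allI impI)
    fix i j a b assume *: "i < length ns" "j < i" "a < ns ! i" "b < ns ! j"
    have "offset ns j + b < offset ns i" using * by (intro offset_add_less) auto
    then show "(1\<^sub>m (sum_list ns) :: 'k mat) $$ (offset ns i + a, offset ns j + b) = 0"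
      using offset_add_less_sum_list[OF *(1,3)] by simp
  qed
  moreover have "diag_block ns i (1\<^sub>m (sum_list ns)) = (1\<^sub>m (ns ! i) :: 'k mat)" if "i < length ns" for i
    using offset_add_less_sum_list[OF that] by (intro eq_matI) (auto simp: diag_block_def)
  ultimately show ?thesis
    using one_in_subgroup_GL[OF assms] by (simp add: block_group_def GL_iff)
qed

text \<open>The induction starts without variables: every substitution fixes the constants, and 1 is
  a basis of the field over itself.\<close>

lemma generates_block_basis_constants: "generates_block_basis {} (invariants 0 0 H) (1 :: 'k::field mpoly)"
proof -
  have id: "subst \<sigma> p = p" if "p \<in> poly_ring {}" for \<sigma> and p :: "'k mpoly"
    using that by (rule subst_id) simp
  have inv: "invariants 0 0 H = (poly_ring {} :: 'k mpoly set)"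
    by (auto simp: invariants_def act_def id)
  have b0: "below 0 = {0}"
    by (auto simp: below_def intro: poly_mapping_eqI)
  have "polynomial_generators 0 Var (poly_ring {} :: 'k mpoly set)"
    unfolding polynomial_generators_def lessThan_0 by (subst bij_betw_cong[OF id]) (simp_all add: bij_betw_def)
  then have "homogeneous_polynomial_algebra (poly_ring {} :: 'k mpoly set)"
    unfolding homogeneous_polynomial_algebra_def by blast
  moreover have "free_basis (poly_ring {}) (poly_ring {} :: 'k mpoly set) (below 0) mon"
    unfolding b0 by (rule free_basisI) auto
  ultimately have "generates_block_basis {} (poly_ring {} :: 'k mpoly set) (mon 0)"
    by (intro free_basis_imp_block_basis) auto
  then show ?thesis by (simp add: inv)
qed

lemma prod_Var_power: "(\<Prod>j\<in>J. Var (f j) ^ a j) = mon (\<Sum>j\<in>J. single (f j) (a j))"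
  by (simp add: mon_sum Var_power)

lemma lookup_block_exponent:
  fixes s d v :: nat
  shows "lookup (\<Sum>j<d. single (s + j) (a j)) v = (if v \<in> {s..<s + d} then a (v - s) else 0)"
proof -
  have "s + j = v \<longleftrightarrow> s \<le> v \<and> j = v - s" for j by auto
  then have "lookup (\<Sum>j<d. single (s + j) (a j)) v = (\<Sum>j<d. if s \<le> v \<and> j = v - s then a j else 0)"
    unfolding lookup_sum by (simp only: lookup_single when_def)
  then show ?thesis by (cases "s \<le> v") (auto simp: sum.delta)
qed

text \<open>Induction from the right end: the offset of the appended block is the number
  \<open>m\<close> of old variables, which produces the factor \<open>q ^ m\<close> in the inductive
  step, while the exponents of the earlier blocks are already final.\<close>

lemma generates_block_basis_block_group:
  fixes G :: "nat \<Rightarrow> 'k::{field,finite} mat set"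
  assumes q: "q = card (UNIV :: 'k set)"
    and "\<And>i. i < length ns \<Longrightarrow> subgroup (G i) (GL (ns ! i))"
    and "\<And>i. i < length ns \<Longrightarrow>
      generates_block_basis {offset ns i..<offset ns i + ns ! i}
        (invariants (offset ns i) (ns ! i) (G i)) (\<Prod>j<ns ! i. Var (offset ns i + j) ^ \<alpha> i j)"
  shows "generates_block_basis {0..<sum_list ns} (invariants 0 (sum_list ns) (block_group ns G))
    (\<Prod>i<length ns. \<Prod>j<ns ! i. Var (offset ns i + j) ^ ((\<alpha> i j + 1) * q ^ offset ns i - 1))"
  using assms(2,3)
proof (induction ns rule: rev_induct)
  case Nil
  show ?case using generates_block_basis_constants[of "block_group [] G"] by simp
next
  case (snoc d ns)
  let ?m = "sum_list ns" and ?l = "length ns"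
  \<comment> \<open>\<open>?e1\<close> is the final exponent of the earlier blocks,
    \<open>?e2\<close> the given exponent of the last block and \<open>?e\<close> its stretched
    form.\<close>
  let ?e1 = "\<Sum>i<?l. \<Sum>j<ns ! i. single (offset ns i + j) ((\<alpha> i j + 1) * q ^ offset ns i - 1)"
  let ?e2 = "\<Sum>j<d. single (?m + j) (\<alpha> ?l j)"
  let ?e = "\<Sum>j<d. single (?m + j) ((\<alpha> ?l j + 1) * q ^ ?m - 1)"
  have sub: "subgroup (G i) (GL (ns ! i))" if "i < ?l" for i
    using snoc.prems(1)[of i] that by (simp add: nth_append)
  have gbb: "generates_block_basis {offset ns i..<offset ns i + ns ! i}
      (invariants (offset ns i) (ns ! i) (G i)) (\<Prod>j<ns ! i. Var (offset ns i + j) ^ \<alpha> i j)" if "i < ?l" for i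
    using snoc.prems(2)[of i] that by (simp add: nth_append offset_append)
  have old: "generates_block_basis {0..<?m} (invariants 0 ?m (block_group ns G)) (mon ?e1)"
    using snoc.IH[OF sub gbb] by (simp add: prod_Var_power flip: mon_sum)
  have new: "generates_block_basis {?m..<?m + d} (invariants ?m d (G ?l)) (mon ?e2)"
    using snoc.prems(2)[of ?l] by (simp add: prod_Var_power offset_append offset_length)
  have Gl: "subgroup (G ?l) (GL d)" using snoc.prems(1)[of ?l] by simp
  then have Gl': "G ?l \<subseteq> carrier (GL d)" by (rule subgroup.subset)
  have k1: "keys ?e1 \<subseteq> {0..<?m}" by (rule generates_block_basisD(3)[OF old])
  have k: "keys ?e \<subseteq> {?m..<?m + d}" by (auto simp: in_keys_iff lookup_block_exponent split: if_splits)
  have "generates_block_basis {0..<?m + d}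
      (invariants 0 (?m + d) (two_block_group ?m d (block_group ns G) (G ?l))) (mon (?e1 + ?e))"
  proof (rule generates_block_basis_two_blocks[OF q _ _ _ _ _ old new])
    show "block_group ns G \<subseteq> carrier_mat ?m ?m" by (auto simp: block_group_def GL_iff)
    show "1\<^sub>m ?m \<in> block_group ns G" by (rule one_in_block_group[OF sub])
    show "\<exists>A'\<in>carrier_mat ?m ?m. A * A' = 1\<^sub>m ?m" if "A \<in> block_group ns G" for A
      using that by (intro GL_right_inverse) (simp add: block_group_def)
    show "G ?l \<subseteq> carrier_mat d d" using Gl' GL_iff by blast
    show "1\<^sub>m d \<in> G ?l" by (rule one_in_subgroup_GL[OF Gl])
    show "keys (?e1 + ?e) \<subseteq> {0..<?m + d}"
      unfolding keys_add_nat using order_trans[OF k1] order_trans[OF k] by (intro Un_least) auto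
    show "lookup (?e1 + ?e) v = lookup ?e1 v" if "v \<in> {0..<?m}" for v
      using that unfolding lookup_add lookup_block_exponent by simp
    show "lookup (?e1 + ?e) v = (lookup ?e2 v + 1) * q ^ ?m - 1" if v: "v \<in> {?m..<?m + d}" for v
    proof -
      have "v \<notin> keys ?e1" using k1 v by auto
      then have "lookup ?e1 v = 0" by (simp only: in_keys_iff not_not)
      then show ?thesis using v unfolding lookup_add lookup_block_exponent by simp
    qed
  qed
  moreover have "(\<Prod>i<length (ns @ [d]). \<Prod>j<(ns @ [d]) ! i.
      Var (offset (ns @ [d]) i + j) ^ ((\<alpha> i j + 1) * q ^ offset (ns @ [d]) i - 1)) = (mon (?e1 + ?e) :: 'k mpoly)"
  proof -
    have "(\<Prod>i<?l. \<Prod>j<(ns @ [d]) ! i. Var (offset (ns @ [d]) i + j) ^ ((\<alpha> i j + 1) * q ^ offset (ns @ [d]) i - 1))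
        = (mon ?e1 :: 'k mpoly)"
      unfolding mon_sum by (intro prod.cong refl) (auto simp: nth_append offset_append Var_power intro!: prod.cong)
    then show ?thesis by (simp add: mon_add prod_Var_power offset_append offset_length)
  qed
  ultimately show ?case by (simp only: block_group_snoc[of G ns d, OF Gl'] sum_list.append sum_list_simps) simp
qed

theorem theorem6p3:
  fixes n q :: nat
    and ns :: "nat list"
    and G :: "nat \<Rightarrow> 'k::{field,finite} mat set"
    and \<alpha> :: "nat \<Rightarrow> nat \<Rightarrow> nat"
  assumes "q = card (UNIV :: 'k set)"
    and "composition ns n"
    and "\<And>i. i < length ns \<Longrightarrow> subgroup (G i) (GL (ns ! i))"
    and "\<And>i. i < length ns \<Longrightarrow> polynomial_algebra (invariants (offset ns i) (ns ! i) (G i))"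
    and "\<And>i. i < length ns \<Longrightarrow>
      generates_block_basis {offset ns i..<offset ns i + ns ! i}
        (invariants (offset ns i) (ns ! i) (G i))
        (\<Prod>j<ns ! i. Var (offset ns i + j) ^ \<alpha> i j)"
  shows "generates_block_basis {0..<n}
    (invariants 0 n (block_group ns G))
    (\<Prod>i<length ns. \<Prod>j<ns ! i.
      Var (offset ns i + j) ^ ((\<alpha> i j + 1) * q ^ offset ns i - 1))"
proof -
  have "n = sum_list ns" using assms(2) by (simp add: composition_def)
  then show ?thesis using generates_block_basis_block_group[OF assms(1,3,5)] by simp
qed

end
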